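(* Let $(M,g)$ be a Riemannian manifold, $\Sigma\subset M$ a hypersurface, $k\ge2$, $a<0<b$, and let $y:[a,b]\times\Sigma\to M$ be a $\mathcal C^k$-diffeomorphism onto a domain $D\subset M$ such that $y(0,p)=p$ and $\frac{\partial y}{\partial\tau}(0,p)\in (T_p\Sigma)^\perp$ for all $p\in\Sigma$. Then there exists a positive $\mathcal C^{k-1}$-function $\Psi:D\to\mathbb R^+$ such that, for all $p\in\Sigma$, the curve $[a,b]\ni\tau\mapsto y(\tau,p)$ is a unit speed geodesic with respect to the conformal metric $\widetilde g=\Psi\cdot g$ in $D$ if and only if $$g\big(\tfrac{\partial y}{\partial\tau}(\tau,p),\mathrm dy(\tau,p)[w]\big)=0$$ for all $(\tau,p)\in[a,b]\times\Sigma$ and all $w\in T_p\Sigma$. In this case, the conformal factor $\Psi$ is given by $$\Psi\big(y(\tau,p)\big)=g\Big(\tfrac{\partial y}{\partial\tau}(\tau,p),\tfrac{\partial y}{\partial\tau}(\tau,p)\Big)^{-1}.$$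
   Context: $\tau\in[a,b]$ is the first variable of $y$; for $w\in T_p\Sigma$, $\mathrm dy(\tau,p)[w]$ denotes the differential of $y$ at $(\tau,p)$ applied to $(0,w)\in T_\tau\mathbb R\times T_p\Sigma$. $(T_p\Sigma)^\perp$ is the $g$-orthogonal complement of $T_p\Sigma$ in $T_pM$. Since $\Psi$ may be only $\mathcal C^1$, "$\gamma$ is a geodesic of $\Psi g$" means that it satisfies the geodesic equation $\frac{\mathrm D}{\mathrm d\tau}[\Psi(\gamma)\gamma']=\frac12 g(\gamma',\gamma')\nabla\Psi(\gamma)$, with $\frac{\mathrm D}{\mathrm d\tau}$ and $\nabla$ the $g$-covariant derivative along $\gamma$ and the $g$-gradient. *)

theory Defs
  imports "HOL-Analysis.Analysis"
begin

section \<open>Maps of class \<open>C\<^sup>k\<close> between Euclidean spaces\<close>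

text \<open>On an open set: all directional derivatives are of class \<open>C\<^sup>n\<close> (the spaces are
  finite-dimensional in every use, so this is the usual notion).\<close>

primrec Ck_open ::
  "nat \<Rightarrow> 'a::real_normed_vector set \<Rightarrow> ('a \<Rightarrow> 'b::real_normed_vector) \<Rightarrow> bool" where
  "Ck_open 0 U f \<longleftrightarrow> continuous_on U f"
| "Ck_open (Suc n) U f \<longleftrightarrow>
     (\<forall>x\<in>U. f differentiable (at x)) \<and> (\<forall>v. Ck_open n U (\<lambda>x. frechet_derivative f (at x) v))"

text \<open>On an arbitrary set: local extendability to open sets.  This is what gives a meaning to
  \<open>C\<^sup>k\<close> up to the boundary, and on subsets of lower dimension.\<close>

definition Ck_on ::
  "nat \<Rightarrow> 'a::real_normed_vector set \<Rightarrow> ('a \<Rightarrow> 'b::real_normed_vector) \<Rightarrow> bool" where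
  "Ck_on n T f \<longleftrightarrow>
     (\<forall>x\<in>T. \<exists>U F. open U \<and> x \<in> U \<and> Ck_open n U F \<and> (\<forall>z\<in>U \<inter> T. F z = f z))"


section \<open>Manifolds\<close>

text \<open>The manifold is a whole type \<open>'m\<close>, Hausdorff and second countable by its type class,
  with a smooth atlas modelled on \<open>'e\<close>; its dimension is \<open>DIM('e)\<close>.
  The atlas need not be maximal.\<close>

type_synonym ('m, 'e) chart = "'m set \<times> ('m \<Rightarrow> 'e)"

abbreviation chart_inv :: "('m, 'e) chart \<Rightarrow> 'e \<Rightarrow> 'm" where
  "chart_inv c \<equiv> inv_into (fst c) (snd c)"

definition is_chart :: "('m::topological_space, 'e::euclidean_space) chart \<Rightarrow> bool" where
  "is_chart c \<longleftrightarrow> open (fst c) \<and> open (snd c ` fst c) \<and> inj_on (snd c) (fst c) \<and>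
     homeomorphism (fst c) (snd c ` fst c) (snd c) (chart_inv c)"

definition Ck_compatible :: "nat \<Rightarrow> ('m, 'e::euclidean_space) chart \<Rightarrow> ('m, 'e) chart \<Rightarrow> bool" where
  "Ck_compatible k c d \<longleftrightarrow>
     Ck_on k (snd c ` (fst c \<inter> fst d)) (snd d \<circ> chart_inv c) \<and>
     Ck_on k (snd d ` (fst c \<inter> fst d)) (snd c \<circ> chart_inv d)"

definition smooth_atlas :: "('m::topological_space, 'e::euclidean_space) chart set \<Rightarrow> bool" where
  "smooth_atlas A \<longleftrightarrow>
     (\<forall>c\<in>A. is_chart c) \<and> (\<Union>c\<in>A. fst c) = UNIV \<and> (\<forall>c\<in>A. \<forall>d\<in>A. \<forall>n. Ck_compatible n c d)"

definition charts_at :: "('m, 'e) chart set \<Rightarrow> 'm \<Rightarrow> ('m, 'e) chart set" where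
  "charts_at A p = {c \<in> A. p \<in> fst c}"

definition real_atlas :: "(real, real) chart set" where
  "real_atlas = {(UNIV, \<lambda>x. x)}"

text \<open>The product manifold \<open>\<real> \<times> M\<close> has the atlas \<open>cylinder ` A\<close>.\<close>

definition cylinder :: "('m, 'e) chart \<Rightarrow> (real \<times> 'm, real \<times> 'e) chart" where
  "cylinder c = (UNIV \<times> fst c, map_prod id (snd c))"

text \<open>\<open>f\<close> maps the subset \<open>S\<close> of a manifold with atlas \<open>A\<close> into a manifold with atlas \<open>B\<close>.\<close>

definition Ck_map :: "nat \<Rightarrow> ('m::topological_space, 'e::euclidean_space) chart set \<Rightarrow> 'm set \<Rightarrow>
    ('n::topological_space, 'f::euclidean_space) chart set \<Rightarrow> ('m \<Rightarrow> 'n) \<Rightarrow> bool" where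
  "Ck_map k A S B f \<longleftrightarrow> continuous_on S f \<and>
     (\<forall>c\<in>A. \<forall>d\<in>B. Ck_on k (snd c ` (S \<inter> fst c \<inter> f -` fst d)) (snd d \<circ> f \<circ> chart_inv c))"

definition Ck_diffeomorphism ::
  "nat \<Rightarrow> ('m::topological_space, 'e::euclidean_space) chart set \<Rightarrow> 'm set \<Rightarrow>
    ('n::topological_space, 'f::euclidean_space) chart set \<Rightarrow> 'n set \<Rightarrow> ('m \<Rightarrow> 'n) \<Rightarrow> bool" where
  "Ck_diffeomorphism k A S B D f \<longleftrightarrow>
     bij_betw f S D \<and> Ck_map k A S B f \<and> Ck_map k B D A (inv_into S f)"

text \<open>Embedded hypersurface without boundary: around each of its points there is a \<open>C\<^sup>k\<close>
  chart of \<open>M\<close> that straightens it to a hyperplane.\<close>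

definition Ck_hypersurface ::
  "nat \<Rightarrow> ('m::topological_space, 'e::euclidean_space) chart set \<Rightarrow> 'm set \<Rightarrow> bool" where
  "Ck_hypersurface k A S \<longleftrightarrow>
     (\<forall>p\<in>S. \<exists>c n. is_chart c \<and> (\<forall>d\<in>A. Ck_compatible k c d) \<and> p \<in> fst c \<and> n \<noteq> 0 \<and>
        snd c ` (S \<inter> fst c) = {x \<in> snd c ` fst c. n \<bullet> x = 0})"


section \<open>Tangent vectors\<close>

text \<open>A tangent vector at \<open>p\<close> is the family of its components in all charts of the atlas
  around \<open>p\<close>, related by the derivatives of the coordinate changes; as a total function it is
  \<open>0\<close> on all other charts.  The vector space operations are pointwise.\<close>

type_synonym ('m, 'e) tvec = "('m, 'e) chart \<Rightarrow> 'e"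

definition tangent_space ::
  "('m, 'e::euclidean_space) chart set \<Rightarrow> 'm \<Rightarrow> ('m, 'e) tvec set" where
  "tangent_space A p = {v. (\<forall>c. c \<notin> charts_at A p \<longrightarrow> v c = 0) \<and>
     (\<forall>c\<in>charts_at A p. \<forall>d\<in>charts_at A p.
        v d = frechet_derivative (snd d \<circ> chart_inv c) (at (snd c p)) (v c))}"

text \<open>The tangent vector at \<open>p\<close> whose components in the chart \<open>c\<close> are \<open>v\<close>.\<close>

definition coord_vector ::
  "('m, 'e::euclidean_space) chart set \<Rightarrow> ('m, 'e) chart \<Rightarrow> 'm \<Rightarrow> 'e \<Rightarrow> ('m, 'e) tvec" where
  "coord_vector A c p v = (\<lambda>d. if d \<in> charts_at A p
     then frechet_derivative (snd d \<circ> chart_inv c) (at (snd c p)) v else 0)"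

text \<open>\<open>I\<close> is a nondegenerate interval; derivatives at its end points are one-sided.\<close>

definition velocity ::
  "('m, 'e::euclidean_space) chart set \<Rightarrow> real set \<Rightarrow> (real \<Rightarrow> 'm) \<Rightarrow> real \<Rightarrow> ('m, 'e) tvec" where
  "velocity A I \<gamma> \<tau> = (\<lambda>c. if c \<in> charts_at A (\<gamma> \<tau>)
     then vector_derivative (\<lambda>s. snd c (\<gamma> s)) (at \<tau> within I) else 0)"

text \<open>\<open>T\<^sub>pS\<close> as a subset of \<open>T\<^sub>pM\<close>: the velocities at \<open>p\<close> of the \<open>C\<^sup>1\<close> curves in \<open>S\<close>.\<close>

definition tangent_of_subset ::
  "('m::topological_space, 'e::euclidean_space) chart set \<Rightarrow> 'm set \<Rightarrow> 'm \<Rightarrow> ('m, 'e) tvec set" where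
  "tangent_of_subset A S p = {w. \<exists>\<epsilon>>0. \<exists>\<gamma>. Ck_map 1 real_atlas {-\<epsilon><..<\<epsilon>} A \<gamma> \<and>
     \<gamma> ` {-\<epsilon><..<\<epsilon>} \<subseteq> S \<and> \<gamma> 0 = p \<and> w = velocity A {-\<epsilon><..<\<epsilon>} \<gamma> 0}"

text \<open>The element \<open>(s, w)\<close> of the tangent space of \<open>\<real> \<times> M\<close> at a point over \<open>p\<close>.\<close>

definition product_vector ::
  "('m, 'e::euclidean_space) chart set \<Rightarrow> 'm \<Rightarrow> real \<Rightarrow> ('m, 'e) tvec \<Rightarrow>
    (real \<times> 'm, real \<times> 'e) tvec" where
  "product_vector A p s w = (\<lambda>C. if C \<in> cylinder ` charts_at A p
     then (s, w (the_inv cylinder C)) else 0)"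

text \<open>Derivative at \<open>x\<close> in the direction \<open>v\<close> of a vector-valued function defined on a subset
  \<open>S\<close> of the manifold.  The derivative \<open>L\<close> within \<open>S\<close> may fail to be unique as a linear map,
  but its value is determined on vectors tangent to \<open>S\<close>.\<close>

definition dir_deriv ::
  "('m, 'e::euclidean_space) chart set \<Rightarrow> 'm set \<Rightarrow> ('m \<Rightarrow> 'f::real_normed_vector) \<Rightarrow>
    'm \<Rightarrow> ('m, 'e) tvec \<Rightarrow> 'f" where
  "dir_deriv A S f x v = (THE u. \<exists>c\<in>charts_at A x. \<exists>L.
     ((f \<circ> chart_inv c) has_derivative L) (at (snd c x) within snd c ` (S \<inter> fst c)) \<and> u = L (v c))"

definition differential ::
  "('m, 'e::euclidean_space) chart set \<Rightarrow> 'm set \<Rightarrow> ('n, 'f::euclidean_space) chart set \<Rightarrow>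
    ('m \<Rightarrow> 'n) \<Rightarrow> 'm \<Rightarrow> ('m, 'e) tvec \<Rightarrow> ('n, 'f) tvec" where
  "differential A S B f x v =
     (\<lambda>d. if d \<in> charts_at B (f x) then dir_deriv A S (snd d \<circ> f) x v else 0)"


section \<open>Riemannian metrics\<close>

type_synonym ('m, 'e) metric = "'m \<Rightarrow> ('m, 'e) tvec \<Rightarrow> ('m, 'e) tvec \<Rightarrow> real"

text \<open>The metric in the chart \<open>c\<close>, as a bilinear form on \<open>'e\<close> depending on \<open>x \<in> snd c ` fst c\<close>.\<close>

definition metric_coeff :: "('m, 'e::euclidean_space) chart set \<Rightarrow> ('m, 'e) metric \<Rightarrow>
    ('m, 'e) chart \<Rightarrow> 'e \<Rightarrow> 'e \<Rightarrow> 'e \<Rightarrow> real" where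
  "metric_coeff A g c x v w =
     g (chart_inv c x) (coord_vector A c (chart_inv c x) v) (coord_vector A c (chart_inv c x) w)"

definition riemannian_metric ::
  "('m, 'e::euclidean_space) chart set \<Rightarrow> ('m, 'e) metric \<Rightarrow> bool" where
  "riemannian_metric A g \<longleftrightarrow>
     (\<forall>p. \<forall>u\<in>tangent_space A p. \<forall>v\<in>tangent_space A p.
        g p u v = g p v u \<and>
        (\<forall>w\<in>tangent_space A p. \<forall>r s.
          g p (\<lambda>c. r *\<^sub>R u c + s *\<^sub>R v c) w = r * g p u w + s * g p v w)) \<and>
     (\<forall>p. \<forall>v\<in>tangent_space A p. v \<noteq> (\<lambda>c. 0) \<longrightarrow> 0 < g p v v) \<and>
     (\<forall>c\<in>A. \<forall>v w n. Ck_on n (snd c ` fst c) (\<lambda>x. metric_coeff A g c x v w))"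

definition orth_complement :: "('m, 'e::euclidean_space) chart set \<Rightarrow> ('m, 'e) metric \<Rightarrow>
    'm \<Rightarrow> ('m, 'e) tvec set \<Rightarrow> ('m, 'e) tvec set" where
  "orth_complement A g p W = {v \<in> tangent_space A p. \<forall>w\<in>W. g p v w = 0}"

text \<open>\<open>\<Gamma>\<^sub>x(v, w)\<close> for the Levi-Civita connection in the chart \<open>c\<close>, by the Koszul formula for
  constant vector fields.\<close>

definition christoffel :: "('m, 'e::euclidean_space) chart set \<Rightarrow> ('m, 'e) metric \<Rightarrow>
    ('m, 'e) chart \<Rightarrow> 'e \<Rightarrow> 'e \<Rightarrow> 'e \<Rightarrow> 'e" where
  "christoffel A g c x v w = (THE z. \<forall>u. metric_coeff A g c x z u =
     (frechet_derivative (\<lambda>y. metric_coeff A g c y w u) (at x) v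
      + frechet_derivative (\<lambda>y. metric_coeff A g c y v u) (at x) w
      - frechet_derivative (\<lambda>y. metric_coeff A g c y v w) (at x) u) / 2)"

text \<open>The covariant derivative at \<open>\<tau>\<close> of a vector field \<open>V\<close> along the curve \<open>\<gamma>\<close>.\<close>

definition cov_deriv :: "('m, 'e::euclidean_space) chart set \<Rightarrow> ('m, 'e) metric \<Rightarrow> real set \<Rightarrow>
    (real \<Rightarrow> 'm) \<Rightarrow> (real \<Rightarrow> ('m, 'e) tvec) \<Rightarrow> real \<Rightarrow> ('m, 'e) tvec" where
  "cov_deriv A g I \<gamma> V \<tau> = (\<lambda>c. if c \<in> charts_at A (\<gamma> \<tau>)
     then vector_derivative (\<lambda>s. V s c) (at \<tau> within I)
          + christoffel A g c (snd c (\<gamma> \<tau>)) (velocity A I \<gamma> \<tau> c) (V \<tau> c)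
     else 0)"

text \<open>The \<open>g\<close>-gradient at \<open>q\<close> of a function \<open>\<Psi>\<close> defined on \<open>D\<close>, a region with boundary
  (the derivative of \<open>\<Psi>\<close> is taken within \<open>D\<close>).\<close>

definition gradient :: "('m, 'e::euclidean_space) chart set \<Rightarrow> ('m, 'e) metric \<Rightarrow> 'm set \<Rightarrow>
    ('m \<Rightarrow> real) \<Rightarrow> 'm \<Rightarrow> ('m, 'e) tvec" where
  "gradient A g D \<Psi> q = (THE v. v \<in> tangent_space A q \<and>
     (\<forall>w\<in>tangent_space A q. g q v w = dir_deriv A D \<Psi> q w))"

definition conformal_metric ::
  "('m \<Rightarrow> real) \<Rightarrow> ('m, 'e) metric \<Rightarrow> ('m, 'e) metric" where
  "conformal_metric \<Psi> g = (\<lambda>q v w. \<Psi> q * g q v w)"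

definition unit_speed :: "('m, 'e::euclidean_space) chart set \<Rightarrow> ('m, 'e) metric \<Rightarrow> real set \<Rightarrow>
    (real \<Rightarrow> 'm) \<Rightarrow> bool" where
  "unit_speed A h I \<gamma> \<longleftrightarrow>
     (\<forall>\<tau>\<in>I. h (\<gamma> \<tau>) (velocity A I \<gamma> \<tau>) (velocity A I \<gamma> \<tau>) = 1)"

text \<open>\<open>\<gamma>\<close> is a geodesic of \<open>\<Psi> g\<close> in \<open>D\<close>.  As \<open>\<Psi>\<close> may be only \<open>C\<^sup>1\<close>, this is expressed by
  \<open>D/d\<tau> [\<Psi>(\<gamma>) \<gamma>'] = 1/2 g(\<gamma>', \<gamma>') \<nabla>\<Psi>(\<gamma>)\<close>, with the covariant derivative and the gradient of \<open>g\<close>.\<close>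

definition conformal_geodesic :: "('m::topological_space, 'e::euclidean_space) chart set \<Rightarrow>
    ('m, 'e) metric \<Rightarrow> 'm set \<Rightarrow> ('m \<Rightarrow> real) \<Rightarrow> real set \<Rightarrow> (real \<Rightarrow> 'm) \<Rightarrow> bool" where
  "conformal_geodesic A g D \<Psi> I \<gamma> \<longleftrightarrow>
     \<gamma> ` I \<subseteq> D \<and> Ck_map 1 real_atlas I A \<gamma> \<and>
     (\<forall>\<tau>\<in>I.
        (\<forall>c\<in>charts_at A (\<gamma> \<tau>).
          (\<lambda>s. \<Psi> (\<gamma> s) *\<^sub>R velocity A I \<gamma> s c) differentiable (at \<tau> within I)) \<and>
        cov_deriv A g I \<gamma> (\<lambda>s c. \<Psi> (\<gamma> s) *\<^sub>R velocity A I \<gamma> s c) \<tau> =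
          (\<lambda>c. (1 / 2 * g (\<gamma> \<tau>) (velocity A I \<gamma> \<tau>) (velocity A I \<gamma> \<tau>))
                 *\<^sub>R gradient A g D \<Psi> (\<gamma> \<tau>) c))"

end

(* In coordinates let B be the metric g, F(t, z) the curves of the flow, and H a function with
   H B(dF/dt, dF/dt) = 1.  Differentiating this identity in a direction eta, and using the symmetry
   of the second derivatives of F, one finds that H B(dF/dt, DF eta) changes along the curves at the
   rate B(R, DF eta), where R is the defect of the geodesic equation of the conformal metric H g.
   If the curves are geodesics, then R = 0, so the pairing with a direction tangent to the
   hypersurface is constant in t, and it vanishes at t = 0.  Conversely, unit speed forces
   H = 1 / B(dF/dt, dF/dt); if the pairings vanish identically, then R is orthogonal to the
   range of DF, which is everything, so R = 0.

   The flow is only defined on a closed time interval times a hypersurface, so all derivatives are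
   taken of local extensions to open sets; they are determined by the values on the strip
   [a,b] x R^n, which meets every coordinate line through each of its points in an interval. *)

theory Submission
  imports Defs
begin

section \<open>Maps of class \<open>C\<^sup>k\<close> on open sets\<close>

text \<open>The rate formula is the Gauss lemma in first-variation form:
  \<open>H B(dF/dt, DF eta)\<close> is the momentum of a curve paired with a variation field. It
  differentiates \<open>H\<close> once and \<open>F\<close> twice, which is what
  \<open>k = 2\<close> provides. In the converse, the direction \<open>eta = (1, 0)\<close> is
  settled by unit speed, which makes the pairing the constant 1. Two obstacles shape the rest.
  Gradient and differential are chosen with \<open>THE\<close> among derivatives within sets that
  need not be open, so every choice must first be shown unique: on the strip fully, along the
  hypersurface on tangent vectors, by testing with curves. And the hypersurface is parametrized by
  an open set of the full model space, constantly along a normal \<open>n\<close>, so that the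
  calculus on open sets applies. This puts \<open>(0, n)\<close> into the kernel of
  \<open>DF\<close>; that \<open>DF\<close> is still onto comes from the inverse of the
  diffeomorphism, read in the same coordinates as \<open>K\<close>, and a dimension count. The same
  \<open>K\<close> turns the velocity field into a function on an open set of the target, at the
  cost of one derivative of \<open>F\<close>.\<close>

lemma frechet_derivative_eqI:
  "(f has_derivative f') (at x) \<Longrightarrow> frechet_derivative f (at x) = f'"
  using frechet_derivative_at by metis

text \<open>Openness of \<open>U\<close> lets agreement of values pass to agreement of derivatives,
  at every level of the recursion.\<close>

lemma Ck_open_cong:
  assumes "open U" "\<And>x. x \<in> U \<Longrightarrow> f x = g x" "Ck_open n U f"
  shows "Ck_open n U g"
  using assms(2,3)
proof (induction n arbitrary: f g)
  case 0
  then show ?case by (auto cong: continuous_on_cong)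
next
  case (Suc n)
  have dg: "(g has_derivative frechet_derivative f (at x)) (at x)" if x: "x \<in> U" for x
  proof (rule has_derivative_transform_within_open[OF _ assms(1) x])
    show "(f has_derivative frechet_derivative f (at x)) (at x)"
      using Suc.prems(2) x by (simp add: frechet_derivative_works)
  qed (use Suc.prems in auto)
  have "Ck_open n U (\<lambda>x. frechet_derivative g (at x) v)" for v
  proof (rule Suc.IH)
    show "Ck_open n U (\<lambda>x. frechet_derivative f (at x) v)"
      using Suc.prems(2) by simp
    show "frechet_derivative f (at x) v = frechet_derivative g (at x) v" if "x \<in> U" for x
      using frechet_derivative_eqI[OF dg[OF that]] by simp
  qed
  then show ?case
    using dg by (auto simp: differentiable_def)
qed

text \<open>Replaces the chosen \<open>frechet_derivative\<close> by any derivative that has been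
  computed; the inductive closure proofs below go through this rule.\<close>

lemma Ck_open_SucI:
  assumes "open U" "\<And>x. x \<in> U \<Longrightarrow> (f has_derivative f' x) (at x)"
    and "\<And>v. Ck_open n U (\<lambda>x. f' x v)"
  shows "Ck_open (Suc n) U f"
proof -
  have "Ck_open n U (\<lambda>x. frechet_derivative f (at x) v)" for v
    by (rule Ck_open_cong[OF assms(1) _ assms(3)[of v]])
      (simp add: frechet_derivative_eqI[OF assms(2)])
  then show ?thesis
    using assms(2) by (auto simp: differentiable_def)
qed

lemma Ck_open_has_derivative:
  assumes "Ck_open (Suc n) U f" "x \<in> U"
  shows "(f has_derivative frechet_derivative f (at x)) (at x)"
  using assms by (simp add: frechet_derivative_works)

lemma Ck_open_has_derivative':
  assumes "Ck_open n U f" "n \<ge> 1" "x \<in> U"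
  shows "(f has_derivative frechet_derivative f (at x)) (at x)"
  using assms by (cases n) (auto simp: frechet_derivative_works)

lemma Ck_open_frechet:
  "Ck_open (Suc n) U f \<Longrightarrow> Ck_open n U (\<lambda>x. frechet_derivative f (at x) v)"
  by simp

lemma Ck_open_subset:
  "Ck_open n U f \<Longrightarrow> V \<subseteq> U \<Longrightarrow> Ck_open n V f"
  by (induction n arbitrary: f) (auto intro: continuous_on_subset)

lemma Ck_open_Suc_imp:
  "Ck_open (Suc n) U f \<Longrightarrow> Ck_open n U f"
proof (induction n arbitrary: f)
  case 0
  then show ?case
    by (auto intro!: differentiable_imp_continuous_on differentiable_at_imp_differentiable_on)
next
  case (Suc n)
  then show ?case
    by (metis Ck_open.simps(2))
qed

lemma Ck_open_mono:
  assumes "Ck_open n U f" "m \<le> n"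
  shows "Ck_open m U f"
  using assms(2,1) by (induction rule: dec_induct) (blast intro: Ck_open_Suc_imp)+

lemma Ck_open_continuous_on: "Ck_open n U f \<Longrightarrow> continuous_on U f"
  using Ck_open_mono[of n U f 0] by simp

lemma Ck_open_local:
  assumes "\<And>x. x \<in> U \<Longrightarrow> \<exists>V. open V \<and> x \<in> V \<and> Ck_open n V f"
  shows "Ck_open n U f"
  using assms
proof (induction n arbitrary: f)
  case 0
  then have "isCont f x" if "x \<in> U" for x
    using that by (metis Ck_open.simps(1) continuous_on_eq_continuous_at)
  then show ?case
    by (simp add: continuous_at_imp_continuous_on)
next
  case (Suc n)
  then show ?case
    by (metis Ck_open.simps(2))
qed

text \<open>Near each point of an open set a local extension coincides with the function itself, and
  \<open>Ck_open\<close> is a local property.\<close>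

lemma Ck_on_open_imp:
  assumes "Ck_on n U f" "open U"
  shows "Ck_open n U f"
proof (rule Ck_open_local)
  fix x assume "x \<in> U"
  then obtain V F where V: "open V" "x \<in> V" "Ck_open n V F" "\<forall>z\<in>V \<inter> U. F z = f z"
    using assms(1) unfolding Ck_on_def by blast
  have "Ck_open n (V \<inter> U) f"
    by (rule Ck_open_cong[OF _ _ Ck_open_subset[OF V(3)]]) (use V assms in auto)
  then show "\<exists>V. open V \<and> x \<in> V \<and> Ck_open n V f"
    using V assms \<open>x \<in> U\<close> by blast
qed

section \<open>Algebra, composition and inversion of maps of class \<open>Ck_open\<close>\<close>

lemma Ck_open_const: "Ck_open n U (\<lambda>x. c)"
proof (induction n arbitrary: c)
  case (Suc n)
  have "frechet_derivative (\<lambda>x::'a. c) (at x) = (\<lambda>v. 0)" for x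
    by (rule frechet_derivative_eqI) simp
  then show ?case
    using Suc by simp
qed simp

lemma Ck_open_bounded_linear:
  assumes "bounded_linear L"
  shows "Ck_open n U L"
proof (cases n)
  case 0
  then show ?thesis
    using assms by (simp add: linear_continuous_on)
next
  case (Suc m)
  have "frechet_derivative L (at x) = L" for x
    by (rule frechet_derivative_eqI) (rule bounded_linear_imp_has_derivative[OF assms])
  then show ?thesis
    using Suc assms by (auto simp: Ck_open_const bounded_linear_imp_differentiable)
qed

lemma Ck_open_linear_compose:
  assumes "bounded_linear L" "open U" "Ck_open n U f"
  shows "Ck_open n U (\<lambda>x. L (f x))"
  using assms(3)
proof (induction n arbitrary: f)
  case 0
  then show ?case
    by (simp add: bounded_linear.continuous_on[OF assms(1)])
next
  case (Suc n)
  show ?case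
  proof (rule Ck_open_SucI[OF assms(2)])
    show "((\<lambda>x. L (f x)) has_derivative (\<lambda>v. L (frechet_derivative f (at x) v))) (at x)"
      if "x \<in> U" for x
      by (rule bounded_linear.has_derivative[OF assms(1) Ck_open_has_derivative[OF Suc.prems that]])
  qed (intro Suc.IH Ck_open_frechet Suc.prems)
qed

lemma Ck_open_add:
  assumes "open U" "Ck_open n U f" "Ck_open n U g"
  shows "Ck_open n U (\<lambda>x. f x + g x)"
  using assms(2,3)
proof (induction n arbitrary: f g)
  case 0
  then show ?case by (auto intro: continuous_on_add)
next
  case (Suc n)
  show ?case
  proof (rule Ck_open_SucI[OF assms(1)])
    show "((\<lambda>x. f x + g x) has_derivative
        (\<lambda>v. frechet_derivative f (at x) v + frechet_derivative g (at x) v)) (at x)"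
      if "x \<in> U" for x
      by (intro has_derivative_add Ck_open_has_derivative[OF Suc.prems(1) that]
          Ck_open_has_derivative[OF Suc.prems(2) that])
  qed (intro Suc.IH Ck_open_frechet Suc.prems)
qed

lemma Ck_open_sum:
  assumes "open U" "\<And>i. i \<in> I \<Longrightarrow> Ck_open n U (f i)"
  shows "Ck_open n U (\<lambda>x. \<Sum>i\<in>I. f i x)"
  using assms(2)
proof (induction I rule: infinite_finite_induct)
  case (insert i I)
  then show ?case
    by (simp add: Ck_open_add[OF assms(1)])
qed (auto simp: Ck_open_const)

lemma Ck_open_bilinear:
  assumes B: "bounded_bilinear B" and "open U" "Ck_open n U f" "Ck_open n U g"
  shows "Ck_open n U (\<lambda>x. B (f x) (g x))"
  using assms(3,4)
proof (induction n arbitrary: f g)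
  case 0
  then show ?case by (simp add: bounded_bilinear.continuous_on[OF B])
next
  case (Suc n)
  show ?case
  proof (rule Ck_open_SucI[OF \<open>open U\<close>])
    show "((\<lambda>x. B (f x) (g x)) has_derivative
        (\<lambda>v. B (f x) (frechet_derivative g (at x) v) + B (frechet_derivative f (at x) v) (g x))) (at x)"
      if "x \<in> U" for x
      by (intro bounded_bilinear.FDERIV[OF B] Ck_open_has_derivative[OF Suc.prems(1) that]
          Ck_open_has_derivative[OF Suc.prems(2) that])
    show "Ck_open n U (\<lambda>x. B (f x) (frechet_derivative g (at x) v) + B (frechet_derivative f (at x) v) (g x))" for v
      by (intro Ck_open_add[OF \<open>open U\<close>] Suc.IH Ck_open_Suc_imp[OF Suc.prems(1)]
        Ck_open_Suc_imp[OF Suc.prems(2)] Ck_open_frechet Suc.prems)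
  qed
qed

lemmas Ck_open_scaleR = Ck_open_bilinear[OF bounded_bilinear_scaleR]
lemmas Ck_open_mult = Ck_open_bilinear[OF bounded_bilinear_mult]
lemmas Ck_open_inner_left = Ck_open_linear_compose[OF bounded_linear_inner_left]
lemmas Ck_open_fst = Ck_open_linear_compose[OF bounded_linear_fst]
lemmas Ck_open_snd = Ck_open_linear_compose[OF bounded_linear_snd]

lemma Ck_open_Pair:
  assumes "open U" "Ck_open n U f" "Ck_open n U g"
  shows "Ck_open n U (\<lambda>x. (f x, g x))"
proof -
  have "Ck_open n U (\<lambda>x. (f x, 0) + (0, g x))"
    using assms by (intro Ck_open_add Ck_open_linear_compose[where L = "\<lambda>u. (u, 0)"]
      Ck_open_linear_compose[where L = "\<lambda>u. (0, u)"])
      (auto intro!: bounded_linear_intros)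
  then show ?thesis by simp
qed

text \<open>In the chain rule the inner derivative is a direction that moves with the point, whereas
  \<open>Ck_open\<close> controls derivatives in fixed directions only. Expanding that direction in
  the basis leaves sums of products of known regularity.\<close>

lemma Ck_open_compose:
  fixes g :: "'a::real_normed_vector \<Rightarrow> 'b::euclidean_space"
  assumes "open U" "Ck_open n U g" "open V" "Ck_open n V f" "g ` U \<subseteq> V"
  shows "Ck_open n U (\<lambda>x. f (g x))"
  using assms(2,4)
proof (induction n arbitrary: f)
  case 0
  then show ?case
    using assms(5) by (auto intro: continuous_on_compose2)
next
  case (Suc n)
  have expand: "frechet_derivative f (at y) w = (\<Sum>b\<in>Basis. (w \<bullet> b) *\<^sub>R frechet_derivative f (at y) b)"
    if "y \<in> V" for y w
  proof -
    have "linear (frechet_derivative f (at y))"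
      using Suc.prems(2) that by (simp add: linear_frechet_derivative)
    then have "frechet_derivative f (at y) (\<Sum>b\<in>Basis. (w \<bullet> b) *\<^sub>R b)
        = (\<Sum>b\<in>Basis. (w \<bullet> b) *\<^sub>R frechet_derivative f (at y) b)"
      by (simp add: linear_sum linear_scale)
    then show ?thesis
      by (simp only: euclidean_representation)
  qed
  show ?case
  proof (rule Ck_open_SucI[OF assms(1)])
    fix x assume x: "x \<in> U"
    have "((\<lambda>x. f (g x)) has_derivative
        (\<lambda>v. frechet_derivative f (at (g x)) (frechet_derivative g (at x) v))) (at x)"
      using x assms(5) by (intro has_derivative_compose[OF Ck_open_has_derivative[OF Suc.prems(1) x]
          Ck_open_has_derivative[OF Suc.prems(2)]]) auto
    moreover have "(\<lambda>v. frechet_derivative f (at (g x)) (frechet_derivative g (at x) v)) =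
        (\<lambda>v. \<Sum>b\<in>Basis. (frechet_derivative g (at x) v \<bullet> b) *\<^sub>R frechet_derivative f (at (g x)) b)"
      using x assms(5) by (intro ext expand) auto
    ultimately show "((\<lambda>x. f (g x)) has_derivative
        (\<lambda>v. \<Sum>b\<in>Basis. (frechet_derivative g (at x) v \<bullet> b) *\<^sub>R frechet_derivative f (at (g x)) b)) (at x)"
      by (rule back_subst)
  next
    fix v
    show "Ck_open n U (\<lambda>x. \<Sum>b\<in>Basis. (frechet_derivative g (at x) v \<bullet> b) *\<^sub>R frechet_derivative f (at (g x)) b)"
      by (intro Ck_open_sum Ck_open_scaleR Ck_open_inner_left assms(1)
          Suc.IH[OF Ck_open_Suc_imp[OF Suc.prems(1)] Ck_open_frechet[OF Suc.prems(2)]]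
          Ck_open_frechet[OF Suc.prems(1)])
  qed
qed

text \<open>The derivative is a product of \<open>Df\<close> with two factors \<open>1/f\<close>, so
  the induction hypothesis for \<open>1/f\<close> itself provides the next order.\<close>

lemma Ck_open_inverse:
  fixes f :: "'a::real_normed_vector \<Rightarrow> real"
  assumes "open U" "Ck_open n U f" "\<And>x. x \<in> U \<Longrightarrow> f x \<noteq> 0"
  shows "Ck_open n U (\<lambda>x. inverse (f x))"
  using assms(2)
proof (induction n)
  case 0
  then show ?case
    using assms(3) by (auto intro: continuous_on_inverse)
next
  case (Suc n)
  show ?case
  proof (rule Ck_open_SucI[OF assms(1)])
    show "((\<lambda>x. inverse (f x)) has_derivative
        (\<lambda>v. (- 1) *\<^sub>R (inverse (f x) * frechet_derivative f (at x) v * inverse (f x)))) (at x)"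
      if "x \<in> U" for x
      using Deriv.has_derivative_inverse[OF assms(3)[OF that] Ck_open_has_derivative[OF Suc.prems that]]
      by simp
    show "Ck_open n U (\<lambda>x. (- 1) *\<^sub>R (inverse (f x) * frechet_derivative f (at x) v * inverse (f x)))" for v
      by (intro Ck_open_linear_compose[OF bounded_linear_scaleR_right assms(1)] Ck_open_mult assms(1)
          Suc.IH Ck_open_Suc_imp[OF Suc.prems] Ck_open_frechet Suc.prems)
  qed
qed

section \<open>Symmetry of second derivatives\<close>

text \<open>Two mean value steps: the second difference over a parallelogram becomes a difference of
  \<open>u\<close>-derivatives on two opposite sides, and this in turn a
  \<open>v\<close>-derivative. The equality is exact at some inner point.\<close>

lemma second_difference_mvt:
  fixes f :: "'a::real_normed_vector \<Rightarrow> real"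
  assumes f: "Ck_open 2 U f" and h: "h > 0"
    and sub: "\<And>s t. \<lbrakk>0 \<le> s; s \<le> h; 0 \<le> t; t \<le> h\<rbrakk> \<Longrightarrow> x + s *\<^sub>R u + t *\<^sub>R v \<in> U"
  shows "\<exists>s t. 0 < s \<and> s < h \<and> 0 < t \<and> t < h \<and>
    f (x + h *\<^sub>R u + h *\<^sub>R v) - f (x + h *\<^sub>R u) - f (x + h *\<^sub>R v) + f x =
      h * h * frechet_derivative (\<lambda>z. frechet_derivative f (at z) u) (at (x + s *\<^sub>R u + t *\<^sub>R v)) v"
proof -
  have f2: "Ck_open (Suc (Suc 0)) U f"
    using f by (simp only: numeral_2_eq_2)
  have df: "(f has_derivative frechet_derivative f (at z)) (at z)" if "z \<in> U" for z
    by (rule Ck_open_has_derivative[OF f2 that])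
  have ddf: "((\<lambda>z. frechet_derivative f (at z) u) has_derivative
      frechet_derivative (\<lambda>z. frechet_derivative f (at z) u) (at z)) (at z)" if "z \<in> U" for z
    by (rule Ck_open_has_derivative[OF Ck_open_frechet[OF f2] that])
  have line: "((\<lambda>s. f (c + s *\<^sub>R w)) has_real_derivative L w) (at s)"
    if "(f has_derivative L) (at (c + s *\<^sub>R w))" for c w s L and f :: "'a \<Rightarrow> real"
  proof -
    have "((\<lambda>s. f (c + s *\<^sub>R w)) has_derivative (\<lambda>r. L (r *\<^sub>R w))) (at s)"
      by (rule has_derivative_compose[where f = "\<lambda>s. c + s *\<^sub>R w", OF _ that]) (auto intro!: derivative_eq_intros)
    moreover have "L (r *\<^sub>R w) = r * L w" for r
      using has_derivative_linear[OF that] by (simp add: linear_scale)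
    ultimately show ?thesis
      by (simp add: has_field_derivative_def mult_commute_abs)
  qed
  define p where "p s = f (x + h *\<^sub>R v + s *\<^sub>R u) - f (x + s *\<^sub>R u)" for s
  have "(p has_real_derivative (frechet_derivative f (at (x + h *\<^sub>R v + s *\<^sub>R u)) u
      - frechet_derivative f (at (x + s *\<^sub>R u)) u)) (at s)" if "0 \<le> s" "s \<le> h" for s
    unfolding p_def using sub[of s h] sub[of s 0] that h
    by (intro DERIV_diff line df) (auto simp: algebra_simps)
  from MVT2[OF h this] obtain s where s: "0 < s" "s < h"
    "p h - p 0 = h * (frechet_derivative f (at (x + h *\<^sub>R v + s *\<^sub>R u)) u
      - frechet_derivative f (at (x + s *\<^sub>R u)) u)"
    by auto
  define q where "q t = frechet_derivative f (at (x + s *\<^sub>R u + t *\<^sub>R v)) u" for t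
  have "(q has_real_derivative
      frechet_derivative (\<lambda>z. frechet_derivative f (at z) u) (at (x + s *\<^sub>R u + t *\<^sub>R v)) v) (at t)"
    if "0 \<le> t" "t \<le> h" for t
    unfolding q_def using sub[of s t] that s by (intro line[OF ddf]) auto
  from MVT2[OF h this] obtain t where t: "0 < t" "t < h"
    "q h - q 0 = h * frechet_derivative (\<lambda>z. frechet_derivative f (at z) u) (at (x + s *\<^sub>R u + t *\<^sub>R v)) v"
    by auto
  have "p h - p 0 = h * (q h - q 0)"
    using s(3) by (simp add: q_def algebra_simps)
  then show ?thesis
    using s(1,2) t by (intro exI[of _ s] exI[of _ t]) (simp add: p_def algebra_simps)
qed

text \<open>The second difference is unchanged when \<open>u\<close> and \<open>v\<close> are
  exchanged. Hence the two mixed derivatives take a common value at points arbitrarily close to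
  \<open>x\<close>, and continuity carries this to \<open>x\<close>.\<close>

lemma second_derivative_symmetric_real:
  fixes f :: "'a::real_normed_vector \<Rightarrow> real"
  assumes U: "open U" "x \<in> U" and f: "Ck_open 2 U f"
  shows "frechet_derivative (\<lambda>z. frechet_derivative f (at z) u) (at x) v =
    frechet_derivative (\<lambda>z. frechet_derivative f (at z) v) (at x) u"
proof (rule ccontr)
  let ?D = "\<lambda>u v z. frechet_derivative (\<lambda>z. frechet_derivative f (at z) u) (at z) v"
  assume ne: "?D u v x \<noteq> ?D v u x"
  \<comment> \<open>Half the gap, so that no number is closer than \<open>e\<close> to both
    values.\<close>
  define e where "e = \<bar>?D u v x - ?D v u x\<bar> / 2"
  have e: "e > 0" using ne by (simp add: e_def)
  have "Ck_open 0 U (?D u v)" for u v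
    using f by (simp only: numeral_2_eq_2 Ck_open.simps(2))
  then have cont: "continuous (at x) (?D u v)" for u v
    using U by (auto simp: continuous_on_eq_continuous_at)
  obtain d1 where d1: "d1 > 0" "\<And>z. dist z x < d1 \<Longrightarrow> dist (?D u v z) (?D u v x) < e"
    using cont[of u v] e unfolding continuous_at by (auto simp: Lim_at) (metis dist_self)
  obtain d2 where d2: "d2 > 0" "\<And>z. dist z x < d2 \<Longrightarrow> dist (?D v u z) (?D v u x) < e"
    using cont[of v u] e unfolding continuous_at by (auto simp: Lim_at) (metis dist_self)
  obtain d3 where d3: "d3 > 0" "ball x d3 \<subseteq> U"
    using U openE by blast
  define d where "d = min d1 (min d2 d3)"
  have d: "d > 0" using d1 d2 d3 by (simp add: d_def)
  \<comment> \<open>The summand 1 keeps the denominator positive when both directions vanish, and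
    makes the bound in \<open>small\<close> strict.\<close>
  define h where "h = d / (2 * (norm u + norm v + 1))"
  have h: "h > 0" using d by (simp add: h_def add_nonneg_pos)
  have small: "dist (x + s *\<^sub>R u + t *\<^sub>R v) x < d" if "0 \<le> s" "s \<le> h" "0 \<le> t" "t \<le> h" for s t
  proof -
    have "dist (x + s *\<^sub>R u + t *\<^sub>R v) x \<le> s * norm u + t * norm v"
      using that norm_triangle_ineq[of "s *\<^sub>R u" "t *\<^sub>R v"] by (simp add: dist_norm add.assoc)
    also have "\<dots> \<le> h * norm u + h * norm v"
      using that by (intro add_mono mult_right_mono) auto
    also have "\<dots> < h * (2 * (norm u + norm v + 1))"
    proof -
      have "norm u + norm v < 2 * (norm u + norm v + 1)"
        by (smt (verit) norm_ge_zero)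
      then have "h * (norm u + norm v) < h * (2 * (norm u + norm v + 1))"
        using h by (rule mult_strict_left_mono)
      then show ?thesis by (simp add: distrib_left)
    qed
    also have "\<dots> = d"
    proof -
      have "norm u + norm v + 1 > 0" by (smt (verit) norm_ge_zero)
      then show ?thesis by (simp add: h_def)
    qed
    finally show ?thesis .
  qed
  have subU: "x + s *\<^sub>R u + t *\<^sub>R v \<in> U" if "0 \<le> s" "s \<le> h" "0 \<le> t" "t \<le> h" for s t
    using small[OF that] d3 by (auto simp: d_def dist_commute mem_ball)
  obtain s t where st: "0 < s" "s < h" "0 < t" "t < h"
    "f (x + h *\<^sub>R u + h *\<^sub>R v) - f (x + h *\<^sub>R u) - f (x + h *\<^sub>R v) + f x =
      h * h * ?D u v (x + s *\<^sub>R u + t *\<^sub>R v)"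
    using second_difference_mvt[OF f h, of x u v] subU by blast
  have subU': "x + s *\<^sub>R v + t *\<^sub>R u \<in> U" if "0 \<le> s" "s \<le> h" "0 \<le> t" "t \<le> h" for s t
    using subU[OF that(3,4,1,2)] by (simp add: algebra_simps)
  obtain s' t' where st': "0 < s'" "s' < h" "0 < t'" "t' < h"
    "f (x + h *\<^sub>R v + h *\<^sub>R u) - f (x + h *\<^sub>R v) - f (x + h *\<^sub>R u) + f x =
      h * h * ?D v u (x + s' *\<^sub>R v + t' *\<^sub>R u)"
    using second_difference_mvt[OF f h, of x v u] subU' by blast
  have "h * h * ?D u v (x + s *\<^sub>R u + t *\<^sub>R v) = h * h * ?D v u (x + s' *\<^sub>R v + t' *\<^sub>R u)"
    using st(5) st'(5) by (simp add: algebra_simps)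
  then have eq: "?D u v (x + s *\<^sub>R u + t *\<^sub>R v) = ?D v u (x + s' *\<^sub>R v + t' *\<^sub>R u)"
    using h by simp
  have "dist (?D u v (x + s *\<^sub>R u + t *\<^sub>R v)) (?D u v x) < e"
    using small[of s t] st by (intro d1(2)) (auto simp: d_def)
  moreover have "dist (?D v u (x + s' *\<^sub>R v + t' *\<^sub>R u)) (?D v u x) < e"
    using small[of t' s'] st' by (intro d2(2)) (auto simp: d_def algebra_simps)
  ultimately show False
    using eq unfolding e_def dist_real_def by argo
qed

lemma second_derivative_symmetric:
  fixes f :: "'a::real_normed_vector \<Rightarrow> 'b::euclidean_space"
  assumes U: "open U" "x \<in> U" and f: "Ck_open 2 U f"
  shows "frechet_derivative (\<lambda>z. frechet_derivative f (at z) u) (at x) v =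
    frechet_derivative (\<lambda>z. frechet_derivative f (at z) v) (at x) u"
proof (rule euclidean_eqI)
  fix b :: 'b assume "b \<in> Basis"
  have f2: "Ck_open (Suc (Suc 0)) U f"
    using f by (simp only: numeral_2_eq_2)
  have fb: "Ck_open 2 U (\<lambda>z. f z \<bullet> b)"
    by (rule Ck_open_inner_left[OF U(1) f])
  have 1: "frechet_derivative (\<lambda>z. f z \<bullet> b) (at z) u = frechet_derivative f (at z) u \<bullet> b" if "z \<in> U" for z u
    by (subst frechet_derivative_eqI[OF has_derivative_inner_left[OF Ck_open_has_derivative[OF f2 that]]]) simp
  have 2: "frechet_derivative (\<lambda>z. frechet_derivative (\<lambda>z. f z \<bullet> b) (at z) u) (at x) v =
      frechet_derivative (\<lambda>z. frechet_derivative f (at z) u) (at x) v \<bullet> b" for u v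
  proof -
    have "((\<lambda>z. frechet_derivative f (at z) u \<bullet> b) has_derivative
        (\<lambda>v. frechet_derivative (\<lambda>z. frechet_derivative f (at z) u) (at x) v \<bullet> b)) (at x)"
      by (rule has_derivative_inner_left[OF Ck_open_has_derivative[OF Ck_open_frechet[OF f2] U(2)]])
    then have "((\<lambda>z. frechet_derivative (\<lambda>z. f z \<bullet> b) (at z) u) has_derivative
        (\<lambda>v. frechet_derivative (\<lambda>z. frechet_derivative f (at z) u) (at x) v \<bullet> b)) (at x)"
      by (rule has_derivative_transform_within_open[OF _ U]) (simp add: 1)
    then show ?thesis
      by (simp add: frechet_derivative_eqI)
  qed
  show "frechet_derivative (\<lambda>z. frechet_derivative f (at z) u) (at x) v \<bullet> b =
    frechet_derivative (\<lambda>z. frechet_derivative f (at z) v) (at x) u \<bullet> b"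
    using second_derivative_symmetric_real[OF U fb, of u v] by (simp add: 2)
qed

section \<open>Metrics on open subsets of Euclidean space\<close>

text \<open>A metric in a single chart, with \<open>X\<close> the image of the chart, so that the
  variational computation can be done without the manifold.\<close>

locale metric_family =
  fixes X :: "'e::euclidean_space set" and B :: "'e \<Rightarrow> 'e \<Rightarrow> 'e \<Rightarrow> real"
  assumes open_X: "open X"
    and linear_left: "\<And>x w. x \<in> X \<Longrightarrow> linear (\<lambda>v. B x v w)"
    and sym: "\<And>x v w. x \<in> X \<Longrightarrow> B x v w = B x w v"
    and pos: "\<And>x v. x \<in> X \<Longrightarrow> v \<noteq> 0 \<Longrightarrow> 0 < B x v v"
    and smooth: "\<And>n v w. Ck_open n X (\<lambda>x. B x v w)"
begin

definition D_metric :: "'e \<Rightarrow> 'e \<Rightarrow> 'e \<Rightarrow> 'e \<Rightarrow> real" where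
  "D_metric x u v w = frechet_derivative (\<lambda>y. B y v w) (at x) u"

text \<open>The Christoffel symbol, in the same shape as \<open>christoffel\<close> so that the two
  agree by unfolding; \<open>riesz\<close> makes the description definite.\<close>

definition koszul :: "'e \<Rightarrow> 'e \<Rightarrow> 'e \<Rightarrow> 'e" where
  "koszul x v w = (THE z. \<forall>u. B x z u =
     (D_metric x v w u + D_metric x w v u - D_metric x u v w) / 2)"

lemma linear_right: "x \<in> X \<Longrightarrow> linear (\<lambda>w. B x v w)"
  using linear_left[of x v] sym by simp

lemma zero_left [simp]: "x \<in> X \<Longrightarrow> B x 0 w = 0"
  using linear_0[OF linear_left] .

lemma add_left: "x \<in> X \<Longrightarrow> B x (u + v) w = B x u w + B x v w"
  using linear_add[OF linear_left] .

lemma diff_left: "x \<in> X \<Longrightarrow> B x (u - v) w = B x u w - B x v w"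
  using linear_diff[OF linear_left] .

lemma scale_left: "x \<in> X \<Longrightarrow> B x (r *\<^sub>R v) w = r * B x v w"
  using linear_scale[OF linear_left] by simp

lemma nondegenerate: "x \<in> X \<Longrightarrow> (\<And>u. B x z u = 0) \<Longrightarrow> z = 0"
  using pos[of x z] by fastforce

text \<open>Smoothness is assumed for fixed vectors only. Where the vectors move with the point,
  regularity and derivatives are obtained through this sum.\<close>

lemma expand:
  assumes "x \<in> X"
  shows "B x v w = (\<Sum>i\<in>Basis. \<Sum>j\<in>Basis. (v \<bullet> i) * (w \<bullet> j) * B x i j)"
proof -
  have "B x v w = B x (\<Sum>i\<in>Basis. (v \<bullet> i) *\<^sub>R i) w"
    by (simp add: euclidean_representation)
  also have "\<dots> = (\<Sum>i\<in>Basis. (v \<bullet> i) * B x i w)"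
    by (simp add: linear_sum[OF linear_left[OF assms]] scale_left[OF assms])
  also have "\<dots> = (\<Sum>i\<in>Basis. (v \<bullet> i) * B x i (\<Sum>j\<in>Basis. (w \<bullet> j) *\<^sub>R j))"
    by (simp add: euclidean_representation)
  also have "\<dots> = (\<Sum>i\<in>Basis. (v \<bullet> i) * (\<Sum>j\<in>Basis. (w \<bullet> j) * B x i j))"
    by (simp add: linear_sum[OF linear_right[OF assms]] linear_scale[OF linear_right[OF assms]])
  finally show ?thesis
    by (simp add: sum_distrib_left mult.assoc)
qed

lemma Ck_open_metric:
  fixes f :: "'z::real_normed_vector \<Rightarrow> 'e"
  assumes U: "open U" "f ` U \<subseteq> X" and C: "Ck_open n U f" "Ck_open n U v" "Ck_open n U w"
  shows "Ck_open n U (\<lambda>z. B (f z) (v z) (w z))"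
proof (rule Ck_open_cong[OF U(1)])
  show "Ck_open n U (\<lambda>z. \<Sum>i\<in>Basis. \<Sum>j\<in>Basis. (v z \<bullet> i) * (w z \<bullet> j) * B (f z) i j)"
    by (intro Ck_open_sum Ck_open_mult Ck_open_inner_left U(1) C
        Ck_open_compose[OF U(1) C(1) open_X smooth U(2)])
qed (use U expand in auto)

text \<open>\<open>T\<close> encodes the functional \<open>B x z\<close> by its values on the basis.
  Positivity makes \<open>T\<close> injective, hence onto in finite dimension. The result serves the
  Koszul formula as well as the gradient.\<close>

lemma riesz:
  assumes x: "x \<in> X" and l: "linear (l :: 'e \<Rightarrow> real)"
  shows "\<exists>!z. \<forall>u. B x z u = l u"
proof -
  define T where "T z = (\<Sum>b\<in>Basis. B x z b *\<^sub>R b)" for z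
  have T: "T z \<bullet> b = B x z b" if "b \<in> Basis" for z b
    using that by (simp add: T_def)
  have lT: "linear T"
    unfolding T_def
    by (intro linear_compose_sum ballI linearI)
      (simp_all add: add_left[OF x] scale_left[OF x] scaleR_add_left)
  have eqI: "B x z u = l' u" if "\<And>b. b \<in> Basis \<Longrightarrow> B x z b = l' b" "linear l'"
    for z u and l' :: "'e \<Rightarrow> real"
  proof -
    have "u \<in> span Basis" by simp
    from linear_eq_on_span[OF linear_right[OF x] that(2) that(1) this] show ?thesis .
  qed
  have "inj T"
  proof (subst linear_injective_0[OF lT], intro allI impI)
    fix z assume "T z = 0"
    then have "B x z b = 0" if "b \<in> Basis" for b
      using T[OF that, of z] by simp
    then have "B x z u = 0" for u
      by (rule eqI[of z "\<lambda>_. 0", OF _ linear_zero])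
    then show "z = 0"
      by (rule nondegenerate[OF x])
  qed
  then have "surj T"
    using lT linear_injective_imp_surjective by blast
  then obtain z where z: "T z = (\<Sum>b\<in>Basis. l b *\<^sub>R b)"
    by (metis surjD)
  have "B x z b = l b" if "b \<in> Basis" for b
    using T[OF that, of z] that unfolding z by simp
  then have 1: "\<forall>u. B x z u = l u"
    using eqI l by blast
  show ?thesis
  proof (rule ex1I[of _ z])
    fix z' assume z': "\<forall>u. B x z' u = l u"
    have "z' - z = 0"
      by (rule nondegenerate[OF x]) (simp add: diff_left[OF x] 1 z')
    then show "z' = z" by simp
  qed (rule 1)
qed

lemma has_derivative_coeff:
  "x \<in> X \<Longrightarrow> ((\<lambda>x. B x v w) has_derivative (\<lambda>u. D_metric x u v w)) (at x)"
  using Ck_open_has_derivative[OF smooth[of "Suc 0"]] by (simp add: D_metric_def)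

lemma linear_D_metric: "x \<in> X \<Longrightarrow> linear (\<lambda>u. D_metric x u v w)"
  using has_derivative_coeff has_derivative_linear by blast

lemma D_metric_expand:
  assumes "x \<in> X"
  shows "D_metric x u v w = (\<Sum>i\<in>Basis. \<Sum>j\<in>Basis. (v \<bullet> i) * (w \<bullet> j) * D_metric x u i j)"
proof -
  have "((\<lambda>x. \<Sum>i\<in>Basis. \<Sum>j\<in>Basis. (v \<bullet> i) * (w \<bullet> j) * B x i j) has_derivative
      (\<lambda>u. \<Sum>i\<in>Basis. \<Sum>j\<in>Basis. (v \<bullet> i) * (w \<bullet> j) * D_metric x u i j)) (at x)"
    by (intro has_derivative_sum has_derivative_mult_right has_derivative_coeff assms)
  then have "((\<lambda>x. B x v w) has_derivative
      (\<lambda>u. \<Sum>i\<in>Basis. \<Sum>j\<in>Basis. (v \<bullet> i) * (w \<bullet> j) * D_metric x u i j)) (at x)"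
    by (rule has_derivative_transform_within_open[OF _ open_X assms]) (simp add: expand[symmetric])
  from frechet_derivative_eqI[OF this] show ?thesis
    by (simp add: D_metric_def)
qed

lemma D_metric_sym:
  assumes "x \<in> X"
  shows "D_metric x u v w = D_metric x u w v"
proof -
  have "((\<lambda>y. B y v w) has_derivative (\<lambda>u. D_metric x u w v)) (at x)"
    by (rule has_derivative_transform_within_open[OF has_derivative_coeff[OF assms] open_X assms])
      (rule sym)
  from frechet_derivative_eqI[OF this] show ?thesis
    by (simp add: D_metric_def)
qed

lemma linear_D_metric_right: "x \<in> X \<Longrightarrow> linear (\<lambda>w. D_metric x u v w)"
  by (rule linearI; subst (1 2) D_metric_expand)
    (simp_all add: D_metric_expand[of x u v] algebra_simps sum.distrib sum_distrib_left)

lemma linear_D_metric_left: "x \<in> X \<Longrightarrow> linear (\<lambda>v. D_metric x u v w)"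
  using linear_D_metric_right[of x u w] D_metric_sym by simp

lemma koszul:
  assumes "x \<in> X"
  shows "B x (koszul x v w) u = (D_metric x v w u + D_metric x w v u - D_metric x u v w) / 2"
proof -
  have "linear (\<lambda>u. D_metric x v w u + D_metric x w v u - D_metric x u v w)"
    by (intro linear_compose_add linear_compose_sub linear_D_metric_right linear_D_metric assms)
  from linear_compose_scale_right[OF this, of "1/2"]
  have "linear (\<lambda>u. (D_metric x v w u + D_metric x w v u - D_metric x u v w) / 2)"
    by simp
  from theI'[OF riesz[OF assms this]] show ?thesis
    unfolding koszul_def by blast
qed

text \<open>A product rule in three slots. \<open>G\<close> is bilinear in the two vector slots with
  coefficients depending on the base point, so its total derivative follows from the expansion in
  the basis; composing with the three given maps finishes.\<close>

lemma has_derivative_metric: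
  fixes f :: "'z::real_normed_vector \<Rightarrow> 'e"
  assumes f: "(f has_derivative f') (at z within S)" "f z \<in> X"
    and v: "(v has_derivative v') (at z within S)" and w: "(w has_derivative w') (at z within S)"
  shows "((\<lambda>z. B (f z) (v z) (w z)) has_derivative
    (\<lambda>h. D_metric (f z) (f' h) (v z) (w z) + B (f z) (v' h) (w z) + B (f z) (v z) (w' h)))
    (at z within S)"
proof -
  let ?x = "f z" and ?v = "v z" and ?w = "w z"
  define G where "G p = B (fst p) (fst (snd p)) (snd (snd p))" for p :: "'e \<times> 'e \<times> 'e"
  have "((\<lambda>p. \<Sum>i\<in>Basis. \<Sum>j\<in>Basis. (fst (snd p) \<bullet> i) * (snd (snd p) \<bullet> j) * B (fst p) i j)
      has_derivative (\<lambda>h. \<Sum>i\<in>Basis. \<Sum>j\<in>Basis.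
        (?v \<bullet> i) * (?w \<bullet> j) * D_metric ?x (fst h) i j +
        ((?v \<bullet> i) * (snd (snd h) \<bullet> j) + (fst (snd h) \<bullet> i) * (?w \<bullet> j)) * B ?x i j)) (at (?x, ?v, ?w))"
    by (intro has_derivative_sum)
      (rule derivative_eq_intros has_derivative_compose[OF _ has_derivative_coeff] | simp add: f(2))+
  moreover have "open (X \<times> UNIV \<times> (UNIV :: 'e set))"
    by (auto intro: open_Times open_X)
  ultimately have "(G has_derivative (\<lambda>h. \<Sum>i\<in>Basis. \<Sum>j\<in>Basis.
        (?v \<bullet> i) * (?w \<bullet> j) * D_metric ?x (fst h) i j +
        ((?v \<bullet> i) * (snd (snd h) \<bullet> j) + (fst (snd h) \<bullet> i) * (?w \<bullet> j)) * B ?x i j)) (at (?x, ?v, ?w))"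
    by (rule has_derivative_transform_within_open)
      (use f(2) in \<open>auto simp: G_def expand[symmetric]\<close>)
  moreover have "(\<Sum>i\<in>Basis. \<Sum>j\<in>Basis.
        (?v \<bullet> i) * (?w \<bullet> j) * D_metric ?x (fst h) i j +
        ((?v \<bullet> i) * (snd (snd h) \<bullet> j) + (fst (snd h) \<bullet> i) * (?w \<bullet> j)) * B ?x i j) =
      D_metric ?x (fst h) ?v ?w + B ?x (fst (snd h)) ?w + B ?x ?v (snd (snd h))" for h
    unfolding D_metric_expand[OF f(2), of _ ?v ?w] expand[OF f(2), of "fst (snd h)"]
      expand[OF f(2), of ?v]
    by (simp add: sum.distrib algebra_simps)
  ultimately have G: "(G has_derivative
      (\<lambda>h. D_metric ?x (fst h) ?v ?w + B ?x (fst (snd h)) ?w + B ?x ?v (snd (snd h)))) (at (?x, ?v, ?w))"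
    by simp
  have "((\<lambda>z. (f z, v z, w z)) has_derivative (\<lambda>h. (f' h, v' h, w' h))) (at z within S)"
    by (intro has_derivative_Pair f v w)
  from has_derivative_compose[OF this G] show ?thesis
    by (simp add: G_def)
qed

text \<open>With \<open>V\<close> the velocity and \<open>J\<close> the variation field
  \<open>DF \<eta>\<close>, the Koszul formula turns the rate of \<open>H B(V, J)\<close> into the
  defect paired with \<open>J\<close>, up to half the derivative of \<open>H B(V, V)\<close> in
  direction \<eta>, which \<open>E\<close> makes vanish. \<open>E\<close> is demanded at a single
  point, because the unit speed identity will be known on a strip only.\<close>

lemma first_variation:
  fixes F :: "real \<times> 'z::euclidean_space \<Rightarrow> 'e"
  assumes W: "open W" "(\<tau>, z) \<in> W" and F: "Ck_open 2 W F" "F ` W \<subseteq> X"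
    and H: "(H has_derivative H') (at (F (\<tau>, z)))"
    and G: "\<And>u. B (F (\<tau>, z)) G u = H' u"
  defines "V \<equiv> \<lambda>p. frechet_derivative F (at p) (1, 0)"
    and "A \<equiv> vector_derivative (\<lambda>t. H (F (t, z)) *\<^sub>R frechet_derivative F (at (t, z)) (1, 0)) (at \<tau>)"
  assumes E: "((\<lambda>p. H (F p) * B (F p) (V p) (V p)) has_derivative (\<lambda>_. 0)) (at (\<tau>, z))"
  shows "((\<lambda>t. H (F (t, z)) *\<^sub>R V (t, z)) has_vector_derivative A) (at \<tau>)" (is ?t1)
    and "((\<lambda>t. H (F (t, z)) * B (F (t, z)) (V (t, z)) (frechet_derivative F (at (t, z)) \<eta>))
      has_real_derivative
      B (F (\<tau>, z)) (A + koszul (F (\<tau>, z)) (V (\<tau>, z)) (H (F (\<tau>, z)) *\<^sub>R V (\<tau>, z))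
        - (1/2 * B (F (\<tau>, z)) (V (\<tau>, z)) (V (\<tau>, z))) *\<^sub>R G)
        (frechet_derivative F (at (\<tau>, z)) \<eta>)) (at \<tau>)" (is ?t2)
proof -
  let ?p = "(\<tau>, z)"
  define J where "J p = frechet_derivative F (at p) \<eta>" for p
  define DV where "DV = frechet_derivative V (at ?p)"
  define DJ where "DJ = frechet_derivative J (at ?p)"
  let ?x = "F ?p" let ?v = "V ?p" let ?j = "J ?p"
  have F2: "Ck_open (Suc (Suc 0)) W F"
    using F(1) by (simp only: numeral_2_eq_2)
  have x: "?x \<in> X" using W F by auto
  have dF: "(F has_derivative frechet_derivative F (at ?p)) (at ?p)"
    by (rule Ck_open_has_derivative[OF F2 W(2)])
  have dV: "(V has_derivative DV) (at ?p)"
    unfolding V_def DV_def by (rule Ck_open_has_derivative[OF Ck_open_frechet[OF F2] W(2)])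
  have dJ: "(J has_derivative DJ) (at ?p)"
    unfolding J_def DJ_def by (rule Ck_open_has_derivative[OF Ck_open_frechet[OF F2] W(2)])
  have Vp: "frechet_derivative F (at ?p) (1, 0) = ?v"
    by (simp add: V_def)
  \<comment> \<open>The change of the variation field in time is the change of the velocity across
    the curves.\<close>
  have sw: "DJ (1, 0) = DV \<eta>"
    unfolding DJ_def DV_def J_def V_def by (rule second_derivative_symmetric[OF W F(1)])
  have dH: "((\<lambda>p. H (F p)) has_derivative (\<lambda>h. H' (frechet_derivative F (at ?p) h))) (at ?p)"
    by (rule has_derivative_compose[OF dF H])
  have line: "((\<lambda>t. f (t, z)) has_vector_derivative f' (1, 0)) (at \<tau>)"
    if "(f has_derivative f') (at ?p)" for f :: "real \<times> 'z \<Rightarrow> 'c::real_normed_vector" and f'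
  proof -
    have "((\<lambda>t. (t, z)) has_derivative (\<lambda>r. (r, 0))) (at \<tau>)"
      by (auto intro!: derivative_eq_intros)
    from has_derivative_compose[OF this that]
    have "((\<lambda>t. f (t, z)) has_derivative (\<lambda>r. f' (r, 0))) (at \<tau>)" .
    moreover have "(\<lambda>r. f' (r, 0)) = (\<lambda>r. r *\<^sub>R f' (1, 0))"
    proof
      show "f' (r, 0) = r *\<^sub>R f' (1, 0)" for r
        using linear_scale[OF has_derivative_linear[OF that], of r "(1, 0)"] by simp
    qed
    ultimately show ?thesis
      unfolding has_vector_derivative_def by (rule back_subst)
  qed
  have "((\<lambda>p. H (F p) *\<^sub>R V p) has_derivative
      (\<lambda>h. H ?x *\<^sub>R DV h + H' (frechet_derivative F (at ?p) h) *\<^sub>R ?v)) (at ?p)"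
    by (rule has_derivative_scaleR[OF dH dV])
  from line[OF this]
  have A1: "((\<lambda>t. H (F (t, z)) *\<^sub>R V (t, z)) has_vector_derivative
      H ?x *\<^sub>R DV (1, 0) + H' ?v *\<^sub>R ?v) (at \<tau>)"
    by (simp only: Vp)
  then have A: "A = H ?x *\<^sub>R DV (1, 0) + H' ?v *\<^sub>R ?v"
    unfolding A_def V_def by (rule vector_derivative_at)
  show ?t1 using A1 unfolding A .
  have dB: "((\<lambda>p. B (F p) (V p) (V p)) has_derivative
      (\<lambda>h. D_metric ?x (frechet_derivative F (at ?p) h) ?v ?v + B ?x (DV h) ?v + B ?x ?v (DV h))) (at ?p)"
    by (rule has_derivative_metric[OF dF x dV dV])
  have "((\<lambda>p. H (F p) * B (F p) (V p) (V p)) has_derivative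
      (\<lambda>h. H ?x * (D_metric ?x (frechet_derivative F (at ?p) h) ?v ?v + B ?x (DV h) ?v + B ?x ?v (DV h))
        + H' (frechet_derivative F (at ?p) h) * B ?x ?v ?v)) (at ?p)"
    by (rule has_derivative_mult[OF dH dB])
  from has_derivative_unique[OF this E]
  have E': "H ?x * (D_metric ?x ?j ?v ?v + B ?x (DV \<eta>) ?v + B ?x ?v (DV \<eta>)) + H' ?j * B ?x ?v ?v = 0"
    unfolding J_def by metis
  have dB': "((\<lambda>p. B (F p) (V p) (J p)) has_derivative
      (\<lambda>h. D_metric ?x (frechet_derivative F (at ?p) h) ?v ?j + B ?x (DV h) ?j + B ?x ?v (DJ h))) (at ?p)"
    by (rule has_derivative_metric[OF dF x dV dJ])
  have "((\<lambda>p. H (F p) * B (F p) (V p) (J p)) has_derivative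
      (\<lambda>h. H ?x * (D_metric ?x (frechet_derivative F (at ?p) h) ?v ?j + B ?x (DV h) ?j + B ?x ?v (DJ h))
        + H' (frechet_derivative F (at ?p) h) * B ?x ?v ?j)) (at ?p)"
    by (rule has_derivative_mult[OF dH dB'])
  from line[OF this]
  have Q: "((\<lambda>t. H (F (t, z)) * B (F (t, z)) (V (t, z)) (J (t, z))) has_real_derivative
      H ?x * (D_metric ?x ?v ?v ?j + B ?x (DV (1, 0)) ?j + B ?x ?v (DV \<eta>)) + H' ?v * B ?x ?v ?j) (at \<tau>)"
    by (simp add: Vp sw has_real_derivative_iff_has_vector_derivative)
  have scale: "D_metric ?x u ?v (H ?x *\<^sub>R ?v) = H ?x * D_metric ?x u ?v ?v"
    "D_metric ?x u (H ?x *\<^sub>R ?v) w = H ?x * D_metric ?x u ?v w"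
    "D_metric ?x (H ?x *\<^sub>R ?v) v w = H ?x * D_metric ?x ?v v w" for u v w
    using linear_scale[OF linear_D_metric_right[OF x]] linear_scale[OF linear_D_metric_left[OF x]]
      linear_scale[OF linear_D_metric[OF x]] by simp_all
  have s: "B ?x (DV \<eta>) ?v = B ?x ?v (DV \<eta>)"
    by (rule sym[OF x])
  \<comment> \<open>After the Koszul expansion the two sides differ by exactly half of
    \<open>E'\<close>.\<close>
  have "H ?x * (D_metric ?x ?v ?v ?j + B ?x (DV (1, 0)) ?j + B ?x ?v (DV \<eta>)) + H' ?v * B ?x ?v ?j
    = B ?x (A + koszul ?x ?v (H ?x *\<^sub>R ?v) - (1/2 * B ?x ?v ?v) *\<^sub>R G) ?j"
    using E' unfolding A
    by (simp add: add_left[OF x] diff_left[OF x] scale_left[OF x] koszul[OF x] G scale s algebra_simps)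
  then show ?t2
    using Q by (simp add: J_def)
qed

end

section \<open>Charts and tangent vectors\<close>

lemma has_vector_derivative_transform_eventually:
  assumes "(f has_vector_derivative f') (at x within S)"
    and "\<forall>\<^sub>F x' in at x within S. f x' = h x'" "f x = h x" "x \<in> S"
  shows "(h has_vector_derivative f') (at x within S)"
  using assms has_derivative_transform_eventually unfolding has_vector_derivative_def by blast

lemma eventually_within_preimage:
  assumes "continuous_on S f" "x \<in> S" "open V" "f x \<in> V"
  shows "\<forall>\<^sub>F y in at x within S. f y \<in> V"
  using assms by (auto simp: continuous_on_def dest: topological_tendstoD)

lemma eventually_within_open:
  assumes "open V" "x \<in> V"
  shows "\<forall>\<^sub>F y in at x within S. y \<in> V \<inter> S"
  unfolding eventually_at_topological using assms by auto

context
  fixes c :: "('m::topological_space, 'e::euclidean_space) chart"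
  assumes c: "is_chart c"
begin

lemma chart_inv_chart: "p \<in> fst c \<Longrightarrow> chart_inv c (snd c p) = p"
  using c by (auto simp: is_chart_def)

lemma chart_chart_inv: "x \<in> snd c ` fst c \<Longrightarrow> snd c (chart_inv c x) = x"
  by (rule f_inv_into_f)

lemma chart_inv_in: "x \<in> snd c ` fst c \<Longrightarrow> chart_inv c x \<in> fst c"
  by (rule inv_into_into)

lemma open_chart: "open (fst c)" "open (snd c ` fst c)"
  using c by (auto simp: is_chart_def)

lemma continuous_on_chart: "continuous_on (fst c) (snd c)"
  using c by (auto simp: is_chart_def homeomorphism_def)

lemma continuous_on_chart_inv: "continuous_on (snd c ` fst c) (chart_inv c)"
  using c unfolding is_chart_def homeomorphism_def by blast

lemma chart_image_eq:
  "snd c ` (fst c \<inter> O') = {x \<in> snd c ` fst c. chart_inv c x \<in> O'}"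
  using chart_inv_chart by (force simp: image_iff)

lemma open_chart_image: "open O' \<Longrightarrow> open (snd c ` (fst c \<inter> O'))"
  unfolding chart_image_eq
  using continuous_open_preimage[OF continuous_on_chart_inv open_chart(2), of O']
  by (simp add: vimage_def Int_def)

end

section \<open>Coordinate changes and their derivatives\<close>

definition D_transition :: "('m::topological_space, 'e::euclidean_space) chart \<Rightarrow>
    ('m, 'e) chart \<Rightarrow> 'm \<Rightarrow> 'e \<Rightarrow> 'e" where
  "D_transition c d p = frechet_derivative (snd d \<circ> chart_inv c) (at (snd c p))"

lemma Ck_compatible_sym: "Ck_compatible k c d \<longleftrightarrow> Ck_compatible k d c"
  unfolding Ck_compatible_def by (auto simp: Int_commute)

lemma Ck_open_transition:
  assumes "is_chart c" "is_chart d" "Ck_compatible k c d"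
  shows "Ck_open k (snd c ` (fst c \<inter> fst d)) (snd d \<circ> chart_inv c)"
  using assms open_chart_image[OF assms(1) open_chart(1)[OF assms(2)]]
  by (intro Ck_on_open_imp) (auto simp: Ck_compatible_def)

text \<open>The charts are merely compatible and not taken from the atlas, which admits the
  straightening chart of a hypersurface.\<close>

lemma has_derivative_transition:
  assumes "is_chart c" "is_chart d" "Ck_compatible k c d" "k \<ge> 1" "p \<in> fst c" "p \<in> fst d"
  shows "((snd d \<circ> chart_inv c) has_derivative D_transition c d p) (at (snd c p))"
  unfolding D_transition_def
  by (rule Ck_open_has_derivative'[OF Ck_open_transition[OF assms(1-3)] assms(4)]) (use assms in auto)

text \<open>The chain rule for coordinate changes; it is what makes the family of components in
  \<open>coord_vector\<close> a tangent vector.\<close>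

lemma D_transition_trans:
  assumes ch: "is_chart c" "is_chart d" "is_chart e"
    and co: "Ck_compatible k c d" "Ck_compatible k d e" "k \<ge> 1"
    and p: "p \<in> fst c" "p \<in> fst d" "p \<in> fst e"
  shows "D_transition d e p (D_transition c d p v) = D_transition c e p v"
proof -
  have "((snd d \<circ> chart_inv c) has_derivative D_transition c d p) (at (snd c p))"
    using has_derivative_transition ch co p by blast
  moreover have "((snd e \<circ> chart_inv d) has_derivative D_transition d e p) (at ((snd d \<circ> chart_inv c) (snd c p)))"
    using has_derivative_transition[OF ch(2,3) co(2,3) p(2,3)] chart_inv_chart[OF ch(1) p(1)] by simp
  ultimately have "((\<lambda>x. (snd e \<circ> chart_inv d) ((snd d \<circ> chart_inv c) x)) has_derivative
      (\<lambda>v. D_transition d e p (D_transition c d p v))) (at (snd c p))"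
    by (rule has_derivative_compose)
  then have "((snd e \<circ> chart_inv c) has_derivative
      (\<lambda>v. D_transition d e p (D_transition c d p v))) (at (snd c p))"
  proof (rule has_derivative_transform_within_open)
    show "open (snd c ` (fst c \<inter> (fst d \<inter> fst e)))"
      using ch by (intro open_chart_image open_Int open_chart)
    show "snd c p \<in> snd c ` (fst c \<inter> (fst d \<inter> fst e))"
      using p by blast
    show "(snd e \<circ> chart_inv d) ((snd d \<circ> chart_inv c) x) = (snd e \<circ> chart_inv c) x"
      if "x \<in> snd c ` (fst c \<inter> (fst d \<inter> fst e))" for x
      using that by (auto simp: chart_inv_chart[OF ch(1)] chart_inv_chart[OF ch(2)])
  qed
  from frechet_derivative_eqI[OF this] show ?thesis
    by (simp add: D_transition_def)
qed

lemma D_transition_self: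
  assumes "is_chart c" "p \<in> fst c"
  shows "D_transition c c p v = v"
proof -
  have "((snd c \<circ> chart_inv c) has_derivative (\<lambda>v. v)) (at (snd c p))"
    by (rule has_derivative_transform_within_open[OF has_derivative_ident open_chart(2)[OF assms(1)]])
      (use assms in \<open>auto simp: chart_inv_chart\<close>)
  from frechet_derivative_eqI[OF this] show ?thesis
    by (simp add: D_transition_def)
qed

text \<open>The only chart of the real line is the identity, and the local extension of the
  coordinate curve supplies the derivative, one-sided at an end point of \<open>I\<close>.\<close>

lemma Ck_map_curve_has_derivative:
  fixes \<gamma> :: "real \<Rightarrow> 'm::topological_space"
  assumes \<gamma>: "Ck_map 1 real_atlas I A \<gamma>" and \<tau>: "\<tau> \<in> I" and d: "d \<in> charts_at A (\<gamma> \<tau>)"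
    and od: "open (fst d)"
  shows "\<exists>u. ((\<lambda>s. snd d (\<gamma> s)) has_vector_derivative u) (at \<tau> within I)"
proof -
  have inv: "inv_into UNIV (\<lambda>x::real. x) = (\<lambda>x. x)"
    by (auto intro!: ext inv_into_f_f)
  have ck: "Ck_on 1 (I \<inter> \<gamma> -` fst d) (snd d \<circ> \<gamma>)" and cont: "continuous_on I \<gamma>"
    using \<gamma> d by (auto simp: Ck_map_def real_atlas_def inv charts_at_def comp_def)
  have \<tau>': "\<tau> \<in> I \<inter> \<gamma> -` fst d"
    using \<tau> d by (simp add: charts_at_def)
  obtain U F where U: "open U" "\<tau> \<in> U" "Ck_open 1 U F"
    "\<forall>z\<in>U \<inter> (I \<inter> \<gamma> -` fst d). F z = snd d (\<gamma> z)"
    using ck[unfolded Ck_on_def comp_def] \<tau>' by blast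
  have "F differentiable (at \<tau>)"
    by (rule differentiableI[OF Ck_open_has_derivative'[OF U(3) order_refl U(2)]])
  then have "(F has_vector_derivative vector_derivative F (at \<tau>)) (at \<tau> within I)"
    by (rule has_vector_derivative_at_within[OF vector_derivative_works[THEN iffD1]])
  then have "((\<lambda>s. snd d (\<gamma> s)) has_vector_derivative vector_derivative F (at \<tau>)) (at \<tau> within I)"
  proof (rule has_vector_derivative_transform_eventually)
    have "\<gamma> \<tau> \<in> fst d" using \<tau>' by simp
    from eventually_within_preimage[OF cont \<tau> od this] eventually_within_open[OF U(1,2), of I]
    show "\<forall>\<^sub>F s in at \<tau> within I. F s = snd d (\<gamma> s)"
      by eventually_elim (use U(4) in auto)
  qed (use U \<tau>' in auto)
  then show ?thesis by blast
qed

section \<open>Tangent vectors and curves on a manifold\<close>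

locale manifold =
  fixes A :: "('m::{second_countable_topology, t2_space}, 'e::euclidean_space) chart set"
  assumes atlas: "smooth_atlas A"
begin

lemma is_chart: "c \<in> A \<Longrightarrow> is_chart c"
  using atlas by (simp add: smooth_atlas_def)

lemma compatible: "c \<in> A \<Longrightarrow> d \<in> A \<Longrightarrow> Ck_compatible k c d"
  using atlas by (simp add: smooth_atlas_def)

lemma chart_around: "\<exists>c. c \<in> charts_at A p"
proof -
  have "p \<in> (\<Union>c\<in>A. fst c)"
    using atlas by (simp add: smooth_atlas_def)
  then show ?thesis
    unfolding charts_at_def by blast
qed

lemma charts_atD: "c \<in> charts_at A p \<Longrightarrow> c \<in> A \<and> p \<in> fst c \<and> is_chart c"
  by (simp add: charts_at_def is_chart)

lemma D_transition:
  assumes "c \<in> charts_at A p" "d \<in> charts_at A p"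
  shows "((snd d \<circ> chart_inv c) has_derivative D_transition c d p) (at (snd c p))"
  using assms by (auto dest!: charts_atD intro!: has_derivative_transition[of _ _ 1] compatible)

lemma linear_D_transition:
  assumes "c \<in> charts_at A p" "d \<in> charts_at A p"
  shows "linear (D_transition c d p)"
  using D_transition[OF assms] by (rule has_derivative_linear)

lemma D_transition_cocycle:
  assumes "c \<in> charts_at A p" "d \<in> charts_at A p" "e \<in> charts_at A p"
  shows "D_transition d e p (D_transition c d p v) = D_transition c e p v"
  using assms by (auto dest!: charts_atD intro!: D_transition_trans[of _ _ _ 1] compatible)

lemma coord_vector_apply:
  "d \<in> charts_at A p \<Longrightarrow> coord_vector A c p v d = D_transition c d p v"
  by (simp add: coord_vector_def D_transition_def)

lemma coord_vector_self [simp]: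
  "c \<in> charts_at A p \<Longrightarrow> coord_vector A c p v c = v"
  by (simp add: coord_vector_apply D_transition_self charts_atD)

lemma coord_vector_in_tangent_space [intro, simp]:
  assumes "c \<in> charts_at A p"
  shows "coord_vector A c p v \<in> tangent_space A p"
  unfolding tangent_space_def D_transition_def[symmetric]
  using assms D_transition_cocycle by (auto simp: coord_vector_apply) (simp add: coord_vector_def)

lemma coord_vector_component [simp]:
  assumes "c \<in> charts_at A p" "w \<in> tangent_space A p"
  shows "coord_vector A c p (w c) = w"
proof
  fix d
  show "coord_vector A c p (w c) d = w d"
  proof (cases "d \<in> charts_at A p")
    case True
    then have "w d = frechet_derivative (snd d \<circ> chart_inv c) (at (snd c p)) (w c)"
      using assms unfolding tangent_space_def by blast
    then show ?thesis
      using True by (simp add: coord_vector_def)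
  next
    case False
    then have "w d = 0"
      using assms(2) unfolding tangent_space_def by blast
    then show ?thesis
      using False by (simp add: coord_vector_def)
  qed
qed

lemma coord_vector_linear:
  assumes "c \<in> charts_at A p"
  shows "coord_vector A c p (r *\<^sub>R u + s *\<^sub>R v) =
    (\<lambda>d. r *\<^sub>R coord_vector A c p u d + s *\<^sub>R coord_vector A c p v d)"
proof
  fix d
  show "coord_vector A c p (r *\<^sub>R u + s *\<^sub>R v) d =
    r *\<^sub>R coord_vector A c p u d + s *\<^sub>R coord_vector A c p v d"
    using linear_D_transition[OF assms, of d]
    by (cases "d \<in> charts_at A p")
      (simp_all add: coord_vector_apply linear_add linear_scale, simp add: coord_vector_def)
qed

text \<open>One chart suffices: the chain rule for coordinate changes transports the derivative to
  every other chart. That \<tau> is a limit point of \<open>I\<close> makes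
  \<open>vector_derivative\<close> single-valued.\<close>

lemma velocity_eq:
  assumes c: "c \<in> charts_at A (\<gamma> \<tau>)" and \<tau>: "\<tau> \<in> I" "at \<tau> within I \<noteq> bot"
    and cont: "continuous_on I \<gamma>"
    and u: "((\<lambda>s. snd c (\<gamma> s)) has_vector_derivative u) (at \<tau> within I)"
  shows "velocity A I \<gamma> \<tau> = coord_vector A c (\<gamma> \<tau>) u"
    and "d \<in> charts_at A (\<gamma> \<tau>) \<Longrightarrow>
      ((\<lambda>s. snd d (\<gamma> s)) has_vector_derivative coord_vector A c (\<gamma> \<tau>) u d) (at \<tau> within I)"
proof -
  have *: "((\<lambda>s. snd d (\<gamma> s)) has_vector_derivative D_transition c d (\<gamma> \<tau>) u) (at \<tau> within I)"
    if d: "d \<in> charts_at A (\<gamma> \<tau>)" for d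
  proof -
    have "((\<lambda>s. (snd d \<circ> chart_inv c) (snd c (\<gamma> s))) has_derivative
        (\<lambda>r. D_transition c d (\<gamma> \<tau>) (r *\<^sub>R u))) (at \<tau> within I)"
      by (rule has_derivative_compose[where f = "\<lambda>s. snd c (\<gamma> s)", OF u[unfolded has_vector_derivative_def] D_transition[OF c d]])
    then have "((\<lambda>s. (snd d \<circ> chart_inv c) (snd c (\<gamma> s))) has_vector_derivative
        D_transition c d (\<gamma> \<tau>) u) (at \<tau> within I)"
      unfolding has_vector_derivative_def using linear_scale[OF linear_D_transition[OF c d]] by simp
    then show ?thesis
    proof (rule has_vector_derivative_transform_eventually)
      show "\<forall>\<^sub>F s in at \<tau> within I. (snd d \<circ> chart_inv c) (snd c (\<gamma> s)) = snd d (\<gamma> s)"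
        using eventually_within_preimage[OF cont \<tau>(1) open_chart(1), of c] charts_atD[OF c]
        by (auto simp: chart_inv_chart elim: eventually_mono)
    qed (use charts_atD[OF c] \<tau> in \<open>auto simp: chart_inv_chart\<close>)
  qed
  show "d \<in> charts_at A (\<gamma> \<tau>) \<Longrightarrow>
      ((\<lambda>s. snd d (\<gamma> s)) has_vector_derivative coord_vector A c (\<gamma> \<tau>) u d) (at \<tau> within I)"
    using * by (simp add: coord_vector_apply)
  show "velocity A I \<gamma> \<tau> = coord_vector A c (\<gamma> \<tau>) u"
  proof
    fix d
    show "velocity A I \<gamma> \<tau> d = coord_vector A c (\<gamma> \<tau>) u d"
    proof (cases "d \<in> charts_at A (\<gamma> \<tau>)")
      case True
      then show ?thesis
        using vector_derivative_within[OF \<tau>(2) *[OF True]]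
        by (simp add: velocity_def coord_vector_apply)
    qed (simp add: velocity_def coord_vector_def)
  qed
qed

text \<open>A local criterion: it is enough to see the curve near each time in one chart, as
  coordinate changes preserve the regularity in all others.\<close>

lemma Ck_map_curveI:
  assumes "\<And>\<tau>. \<tau> \<in> I \<Longrightarrow> \<exists>d U F. d \<in> charts_at A (\<gamma> \<tau>) \<and> open U \<and> \<tau> \<in> U \<and> Ck_open k U F \<and>
    F ` U \<subseteq> snd d ` fst d \<and> (\<forall>s\<in>U \<inter> I. \<gamma> s = chart_inv d (F s))"
  shows "Ck_map k real_atlas I A \<gamma>"
proof -
  have inv: "inv_into UNIV (\<lambda>x::real. x) = (\<lambda>x. x)"
    by (auto intro!: ext inv_into_f_f)
  have cont: "continuous_on I \<gamma>"
    unfolding continuous_on_def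
  proof
    fix \<tau> assume \<tau>: "\<tau> \<in> I"
    then obtain d U F where d: "d \<in> charts_at A (\<gamma> \<tau>)" and U: "open U" "\<tau> \<in> U" "Ck_open k U F"
      "F ` U \<subseteq> snd d ` fst d" and eq: "\<forall>s\<in>U \<inter> I. \<gamma> s = chart_inv d (F s)"
      using assms by meson
    have "continuous_on U (\<lambda>s. chart_inv d (F s))"
      using continuous_on_compose2[OF continuous_on_chart_inv Ck_open_continuous_on[OF U(3)] U(4)]
        charts_atD[OF d] by blast
    then have "((\<lambda>s. chart_inv d (F s)) \<longlongrightarrow> \<gamma> \<tau>) (at \<tau>)"
      using U(1,2) \<tau> eq by (simp add: continuous_on_eq_continuous_at isCont_def)
    then have "((\<lambda>s. chart_inv d (F s)) \<longlongrightarrow> \<gamma> \<tau>) (at \<tau> within I)"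
      by (rule tendsto_within_subset) simp
    then show "(\<gamma> \<longlongrightarrow> \<gamma> \<tau>) (at \<tau> within I)"
      by (rule Lim_transform_eventually)
        (use eventually_within_open[OF U(1,2), of I] eq in \<open>auto elim: eventually_mono\<close>)
  qed
  have "Ck_on k (I \<inter> \<gamma> -` fst d') (snd d' \<circ> \<gamma>)" if d': "d' \<in> A" for d'
    unfolding Ck_on_def
  proof
    fix \<tau> assume \<tau>: "\<tau> \<in> I \<inter> \<gamma> -` fst d'"
    then obtain d U F where d: "d \<in> charts_at A (\<gamma> \<tau>)" and U: "open U" "\<tau> \<in> U" "Ck_open k U F"
      "F ` U \<subseteq> snd d ` fst d" and eq: "\<forall>s\<in>U \<inter> I. \<gamma> s = chart_inv d (F s)"
      using assms by (metis IntD1)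
    note chd = charts_atD[OF d]
    let ?O = "snd d ` (fst d \<inter> fst d')"
    have O: "open ?O"
      using chd d' by (intro open_chart_image open_chart is_chart) auto
    \<comment> \<open>Only times at which \<open>F\<close> lies in the overlap can be transported to
      \<open>d'\<close>.\<close>
    define U' where "U' = U \<inter> F -` ?O"
    have U': "open U'"
      unfolding U'_def by (rule continuous_open_preimage[OF Ck_open_continuous_on[OF U(3)] U(1) O])
    have F_eq: "F s = snd d (\<gamma> s)" "\<gamma> s \<in> fst d" if "s \<in> U \<inter> I" for s
      using that eq U(4) chart_chart_inv[of d "F s"] chart_inv_in[of d "F s"] chd by auto
    have "Ck_open k U' (\<lambda>s. (snd d' \<circ> chart_inv d) (F s))"
      by (rule Ck_open_compose[OF U' Ck_open_subset[OF U(3)] O Ck_open_transition])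
        (use chd d' is_chart compatible in \<open>auto simp: U'_def\<close>)
    moreover have "\<tau> \<in> U'"
      using \<tau> U F_eq[of \<tau>] by (auto simp: U'_def)
    moreover have "\<forall>s\<in>U' \<inter> (I \<inter> \<gamma> -` fst d'). (snd d' \<circ> chart_inv d) (F s) = (snd d' \<circ> \<gamma>) s"
      using eq by (auto simp: U'_def)
    ultimately show "\<exists>U F. open U \<and> \<tau> \<in> U \<and> Ck_open k U F \<and>
        (\<forall>z\<in>U \<inter> (I \<inter> \<gamma> -` fst d'). F z = (snd d' \<circ> \<gamma>) z)"
      using U' by blast
  qed
  then show ?thesis
    using cont by (auto simp: Ck_map_def real_atlas_def inv comp_def)
qed

end

section \<open>Riemannian metrics in charts\<close>

locale riemannian = manifold A
  for A :: "('m::{second_countable_topology, t2_space}, 'e::euclidean_space) chart set" +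
  fixes g :: "('m, 'e) metric"
  assumes metric: "riemannian_metric A g"
begin

lemma metric_sym:
  "u \<in> tangent_space A p \<Longrightarrow> v \<in> tangent_space A p \<Longrightarrow> g p u v = g p v u"
  using metric unfolding riemannian_metric_def by blast

lemma metric_pos:
  "v \<in> tangent_space A p \<Longrightarrow> v \<noteq> (\<lambda>c. 0) \<Longrightarrow> 0 < g p v v"
  using metric unfolding riemannian_metric_def by blast

lemma metric_linear:
  "\<lbrakk>u \<in> tangent_space A p; v \<in> tangent_space A p; w \<in> tangent_space A p\<rbrakk> \<Longrightarrow>
    g p (\<lambda>c. r *\<^sub>R u c + s *\<^sub>R v c) w = r * g p u w + s * g p v w"
  using metric unfolding riemannian_metric_def by blast

lemma metric_coord_vector:
  assumes "c \<in> charts_at A q"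
  shows "g q (coord_vector A c q v) (coord_vector A c q w) = metric_coeff A g c (snd c q) v w"
  using assms charts_atD[OF assms] by (simp add: metric_coeff_def chart_inv_chart)

lemma metric_family:
  assumes c: "c \<in> A"
  shows "metric_family (snd c ` fst c) (metric_coeff A g c)"
proof (rule metric_family.intro)
  show "open (snd c ` fst c)"
    using open_chart is_chart[OF c] by blast
  fix x assume "x \<in> snd c ` fst c"
  then have q: "c \<in> charts_at A (chart_inv c x)"
    using c chart_inv_in is_chart[OF c] by (simp add: charts_at_def)
  note T = coord_vector_in_tangent_space[OF q]
  show "linear (\<lambda>v. metric_coeff A g c x v w)" for w
  proof (rule linearI)
    show "metric_coeff A g c x (u + v) w = metric_coeff A g c x u w + metric_coeff A g c x v w" for u v
      using metric_linear[OF T T T, of 1 u 1 v w] coord_vector_linear[OF q, of 1 u 1 v]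
      by (simp add: metric_coeff_def)
    show "metric_coeff A g c x (r *\<^sub>R u) w = r *\<^sub>R metric_coeff A g c x u w" for r u
      using metric_linear[OF T T T, of r u 0 u w] coord_vector_linear[OF q, of r u 0 u]
      by (simp add: metric_coeff_def)
  qed
  show "metric_coeff A g c x v w = metric_coeff A g c x w v" for v w
    unfolding metric_coeff_def by (rule metric_sym[OF T T])
  show "0 < metric_coeff A g c x v v" if "v \<noteq> 0" for v
    unfolding metric_coeff_def
  proof (rule metric_pos[OF T])
    show "coord_vector A c (chart_inv c x) v \<noteq> (\<lambda>c. 0)"
      using coord_vector_self[OF q, of v] that by auto
  qed
next
  show "Ck_open n (snd c ` fst c) (\<lambda>x. metric_coeff A g c x v w)" for n v w
    using metric c open_chart(2)[OF is_chart[OF c]]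
    by (intro Ck_on_open_imp) (auto simp: riemannian_metric_def)
qed

lemma christoffel_eq:
  assumes "c \<in> A"
  shows "christoffel A g c x v w = metric_family.koszul (metric_coeff A g c) x v w"
  using metric_family[OF assms]
  by (simp add: metric_family.koszul_def metric_family.D_metric_def christoffel_def)

end

section \<open>The cylinder over a manifold\<close>

lemma fst_cylinder [simp]: "fst (cylinder c) = UNIV \<times> fst c"
  by (simp add: cylinder_def)

lemma snd_cylinder [simp]: "snd (cylinder c) (t, p) = (t, snd c p)"
  by (simp add: cylinder_def)

lemma image_cylinder: "snd (cylinder c) ` (T \<times> P) = T \<times> snd c ` P"
  by (force simp: cylinder_def)

text \<open>\<open>product_vector\<close> recovers a chart from its cylinder by
  \<open>the_inv\<close>, which is meaningful only for an injective map.\<close>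

lemma inj_cylinder: "inj cylinder"
proof (rule injI)
  fix c c' :: "('m, 'e) chart"
  assume "cylinder c = cylinder c'"
  then have "(UNIV :: real set) \<times> fst c = UNIV \<times> fst c'" "map_prod id (snd c) = (map_prod id (snd c') :: real \<times> _ \<Rightarrow> _)"
    by (auto simp: cylinder_def)
  then have "fst c = fst c'" "snd c p = snd c' p" for p
    by (auto dest: fun_cong[where x = "(0, p)"])
  then show "c = c'"
    by (simp add: prod_eq_iff fun_eq_iff)
qed

lemma the_inv_cylinder [simp]: "the_inv cylinder (cylinder c) = c"
  by (rule the_inv_f_f[OF inj_cylinder])

lemma charts_at_cylinder: "charts_at (cylinder ` A) (t, p) = cylinder ` charts_at A p"
  by (auto simp: charts_at_def)

text \<open>The second form is what the first becomes once the simp rule \<open>fst_cylinder\<close>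
  has rewritten the domain.\<close>

lemma chart_inv_cylinder:
  assumes "is_chart c" "x \<in> snd c ` fst c"
  shows "chart_inv (cylinder c) (t, x) = (t, chart_inv c x)"
    and "inv_into (UNIV \<times> fst c) (snd (cylinder c)) (t, x) = (t, chart_inv c x)"
proof -
  have "inj_on (snd (cylinder c)) (UNIV \<times> fst c)"
    using assms(1) by (auto simp: inj_on_def is_chart_def)
  then show "inv_into (UNIV \<times> fst c) (snd (cylinder c)) (t, x) = (t, chart_inv c x)"
    using chart_inv_in[OF assms] chart_chart_inv[OF assms] by (intro inv_into_f_eq) auto
  then show "chart_inv (cylinder c) (t, x) = (t, chart_inv c x)"
    by simp
qed

lemma is_chart_cylinder:
  assumes c: "is_chart c"
  shows "is_chart (cylinder c)"
proof -
  have im: "snd (cylinder c) ` fst (cylinder c) = UNIV \<times> snd c ` fst c"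
    by (simp add: image_cylinder)
  have "homeomorphism (UNIV \<times> fst c) (UNIV \<times> snd c ` fst c) (snd (cylinder c)) (chart_inv (cylinder c))"
  proof (rule homeomorphismI)
    have "continuous_on (UNIV \<times> fst c) (\<lambda>p. (fst p, snd c (snd p)))"
      by (intro continuous_intros continuous_on_compose2[OF continuous_on_chart[OF c]]) auto
    then show "continuous_on (UNIV \<times> fst c) (snd (cylinder c))"
      by (rule continuous_on_eq) auto
    have "continuous_on (UNIV \<times> snd c ` fst c) (\<lambda>p. (fst p, chart_inv c (snd p)))"
      by (intro continuous_intros continuous_on_compose2[OF continuous_on_chart_inv[OF c]]) auto
    then show "continuous_on (UNIV \<times> snd c ` fst c) (chart_inv (cylinder c))"
      by (rule continuous_on_eq) (auto simp: chart_inv_cylinder[OF c])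
  qed (auto simp: chart_inv_cylinder[OF c] chart_inv_chart[OF c])
  moreover have "inj_on (snd (cylinder c)) (fst (cylinder c))"
    using c by (auto simp: inj_on_def is_chart_def)
  ultimately show ?thesis
    using c unfolding is_chart_def im by (auto intro: open_Times)
qed

lemma is_chart_real: "is_chart (UNIV, \<lambda>x::real. x)"
proof -
  have "inv (\<lambda>x::real. x) = (\<lambda>x. x)"
    by (auto intro!: ext inv_into_f_f)
  then show ?thesis
    by (auto simp: is_chart_def homeomorphism_def)
qed

text \<open>The gateway from manifolds to calculus on open sets. Besides the extension promised by
  \<open>Ck_on\<close>, it arranges that points of \<open>S\<close> near \<open>x\<close> really are
  sent into the target chart, and that the extension never leaves the image of that chart.\<close>

lemma Ck_map_extension:
  assumes f: "Ck_map k A S B f" and x: "x \<in> S" "c \<in> A" "x \<in> fst c" "d \<in> B" "f x \<in> fst d"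
    and ch: "is_chart c" "is_chart d"
  obtains U F where "open U" "snd c x \<in> U" "Ck_open k U F" "F ` U \<subseteq> snd d ` fst d"
    "\<And>z. \<lbrakk>z \<in> S; z \<in> fst c; snd c z \<in> U\<rbrakk> \<Longrightarrow> f z \<in> fst d \<and> F (snd c z) = snd d (f z)"
proof -
  have xS: "snd c x \<in> snd c ` (S \<inter> fst c \<inter> f -` fst d)"
    using x by auto
  have "\<forall>c\<in>A. \<forall>d\<in>B. Ck_on k (snd c ` (S \<inter> fst c \<inter> f -` fst d)) (snd d \<circ> f \<circ> chart_inv c)"
    using f unfolding Ck_map_def by (rule conjunct2)
  then have ck: "Ck_on k (snd c ` (S \<inter> fst c \<inter> f -` fst d)) (snd d \<circ> f \<circ> chart_inv c)"
    using x(2,4) by blast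
  from bspec[OF ck[unfolded Ck_on_def] xS] obtain U F where U: "open U" "snd c x \<in> U" "Ck_open k U F"
    and eq: "\<forall>z\<in>U \<inter> snd c ` (S \<inter> fst c \<inter> f -` fst d). F z = (snd d \<circ> f \<circ> chart_inv c) z"
    by (elim exE conjE) (rule that)
  have "continuous_on S f"
    using f by (simp add: Ck_map_def)
  from continuous_on_open_invariant[THEN iffD1, rule_format, OF this open_chart(1)[OF ch(2)]]
  \<comment> \<open>\<open>f\<close> is continuous on \<open>S\<close> only, so the preimage of the
    target chart is the trace on \<open>S\<close> of some open set.\<close>
  obtain O' where O': "open O'" "O' \<inter> S = f -` fst d \<inter> S"
    by (elim exE conjE) (rule that)
  define U' where "U' = U \<inter> snd c ` (fst c \<inter> O')"
  have U': "open U'"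
    unfolding U'_def using U(1) open_chart_image[OF ch(1) O'(1)] by blast
  \<comment> \<open>Off the image of \<open>S\<close> nothing ties \<open>F\<close> to the chart
    \<open>d\<close>; this cut forces its values into the image of \<open>d\<close>.\<close>
  define U'' where "U'' = U' \<inter> F -` (snd d ` fst d)"
  have sub: "U'' \<subseteq> U" "U' \<subseteq> U"
    by (auto simp: U''_def U'_def)
  have key: "f z \<in> fst d \<and> F (snd c z) = snd d (f z)" if z: "z \<in> S" "z \<in> fst c" "snd c z \<in> U'" for z
  proof -
    obtain z' where "z' \<in> fst c" "z' \<in> O'" "snd c z = snd c z'"
      using z(3) unfolding U'_def by blast
    then have "z \<in> O'"
      using z(2) ch(1) by (auto simp: is_chart_def inj_on_def)
    then have fz: "f z \<in> fst d"
      using O'(2) z(1) by blast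
    then show ?thesis
      using eq z sub(2) by (auto simp: chart_inv_chart[OF ch(1)])
  qed
  show thesis
  proof (rule that)
    show "open U''"
      unfolding U''_def
      by (rule continuous_open_preimage[OF continuous_on_subset[OF Ck_open_continuous_on[OF U(3)] sub(2)]
            U' open_chart(2)[OF ch(2)]])
    have "snd c x \<in> U'"
      using U(2) x O'(2) by (auto simp: U'_def)
    then show "snd c x \<in> U''"
      using key[of x] x by (auto simp: U''_def)
    show "Ck_open k U'' F"
      by (rule Ck_open_subset[OF U(3) sub(1)])
  qed (use key in \<open>auto simp: U''_def\<close>)
qed

text \<open>Provides a candidate for the choice in \<open>dir_deriv\<close>; that all candidates
  give the same value is shown separately.\<close>

lemma Ck_map_has_derivative:
  assumes f: "Ck_map k A S B f" "k \<ge> 1" and x: "x \<in> S" "c \<in> charts_at A x" "d \<in> charts_at B (f x)"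
    and ch: "is_chart c" "is_chart d"
  shows "\<exists>L. ((snd d \<circ> f \<circ> chart_inv c) has_derivative L) (at (snd c x) within snd c ` (S \<inter> fst c))"
proof -
  from x have x': "c \<in> A" "x \<in> fst c" "d \<in> B" "f x \<in> fst d"
    by (auto simp: charts_at_def)
  obtain U F where U: "open U" "snd c x \<in> U" "Ck_open k U F" "F ` U \<subseteq> snd d ` fst d"
    and eq: "\<And>z. \<lbrakk>z \<in> S; z \<in> fst c; snd c z \<in> U\<rbrakk> \<Longrightarrow> f z \<in> fst d \<and> F (snd c z) = snd d (f z)"
    using Ck_map_extension[OF f(1) x(1) x' ch] by metis
  have "(F has_derivative frechet_derivative F (at (snd c x))) (at (snd c x) within snd c ` (S \<inter> fst c))"
    by (rule has_derivative_at_withinI[OF Ck_open_has_derivative'[OF U(3) f(2) U(2)]])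
  then have "((snd d \<circ> f \<circ> chart_inv c) has_derivative frechet_derivative F (at (snd c x)))
      (at (snd c x) within snd c ` (S \<inter> fst c))"
  proof (rule has_derivative_transform_eventually)
    show "\<forall>\<^sub>F z in at (snd c x) within snd c ` (S \<inter> fst c). F z = (snd d \<circ> f \<circ> chart_inv c) z"
      using eventually_within_open[OF U(1,2)] 
      by eventually_elim (auto simp: chart_inv_chart[OF ch(1)] eq)
  qed (use x x' U(2) eq in \<open>auto simp: chart_inv_chart[OF ch(1)]\<close>)
  then show ?thesis by blast
qed

section \<open>The flow of hypersurfaces\<close>

locale normal_flow = riemannian A g
  for A :: "('m::{second_countable_topology, t2_space}, 'e::euclidean_space) chart set" and g +
  fixes S D :: "'m set" and k :: nat and a b :: real and y :: "real \<times> 'm \<Rightarrow> 'm"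
  assumes hypersurface: "Ck_hypersurface k A S"
    and k2: "k \<ge> 2" and ab: "a < 0" "0 < b"
    and diffeo: "Ck_diffeomorphism k (cylinder ` A) ({a..b} \<times> S) A D y"
    and y0: "\<And>p. p \<in> S \<Longrightarrow> y (0, p) = p"
begin

lemma y_map: "Ck_map k (cylinder ` A) ({a..b} \<times> S) A y"
  using diffeo by (simp add: Ck_diffeomorphism_def)

lemma y_inv_map: "Ck_map k A D (cylinder ` A) (inv_into ({a..b} \<times> S) y)"
  using diffeo by (simp add: Ck_diffeomorphism_def)

lemma y_cont: "continuous_on ({a..b} \<times> S) y"
  using y_map by (simp add: Ck_map_def)

lemma y_in: "t \<in> {a..b} \<Longrightarrow> p \<in> S \<Longrightarrow> y (t, p) \<in> D"
  using diffeo by (auto simp: Ck_diffeomorphism_def bij_betw_def)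

lemma y_inv: "t \<in> {a..b} \<Longrightarrow> p \<in> S \<Longrightarrow> inv_into ({a..b} \<times> S) y (y (t, p)) = (t, p)"
  using diffeo by (auto simp: Ck_diffeomorphism_def bij_betw_def intro!: inv_into_f_f)

lemma y_surj:
  assumes "q \<in> D"
  obtains t p where "t \<in> {a..b}" "p \<in> S" "y (t, p) = q"
proof -
  have "q \<in> y ` ({a..b} \<times> S)"
    using diffeo assms by (simp add: Ck_diffeomorphism_def bij_betw_def)
  then show thesis using that by auto
qed

lemma y_cont_time: "p \<in> S \<Longrightarrow> continuous_on {a..b} (\<lambda>t. y (t, p))"
  by (rule continuous_on_compose2[OF y_cont]) (auto intro!: continuous_intros)

lemma time_limit: "t \<in> {a..b} \<Longrightarrow> at t within {a..b} \<noteq> bot"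
  using ab by (simp add: trivial_limit_within islimpt_Icc)

text \<open>Resolves the choice in \<open>dir_deriv\<close> for vectors tangent to the hypersurface.
  The curve \<open>(t, \<gamma> s)\<close> stays in the domain of \<open>y\<close>, so every
  derivative \<open>L\<close> within that domain must send its velocity to the derivative of
  \<open>y (t, \<gamma> s)\<close>, however \<open>L\<close> acts on transverse vectors.\<close>

lemma differential_curve:
  assumes \<epsilon>: "\<epsilon> > 0" and \<gamma>: "Ck_map 1 real_atlas {-\<epsilon><..<\<epsilon>} A \<gamma>" "\<gamma> ` {-\<epsilon><..<\<epsilon>} \<subseteq> S" "\<gamma> 0 = p"
    and t: "t \<in> {a..b}" and d: "d \<in> charts_at A (y (t, p))"
    and u: "((\<lambda>s. snd d (y (t, \<gamma> s))) has_vector_derivative u) (at 0)"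
  shows "differential (cylinder ` A) ({a..b} \<times> S) A y (t, p)
      (product_vector A p 0 (velocity A {-\<epsilon><..<\<epsilon>} \<gamma> 0)) = coord_vector A d (y (t, p)) u"
proof -
  let ?I = "{-\<epsilon><..<\<epsilon>}" and ?w = "velocity A {-\<epsilon><..<\<epsilon>} \<gamma> 0" and ?q = "y (t, p)"
  have p: "p \<in> S" using \<gamma>(2,3) \<epsilon> by force
  have I: "0 \<in> ?I" "at 0 within ?I \<noteq> bot" "open ?I"
    using \<epsilon> by (auto simp: at_within_open[of 0 ?I])
  have atI: "at 0 within ?I = at 0"
    using I at_within_open[of 0 ?I] by simp
  have cont\<gamma>: "continuous_on ?I \<gamma>"
    using \<gamma>(1) by (simp add: Ck_map_def)
  have cont: "continuous_on ?I (\<lambda>s. y (t, \<gamma> s))"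
    by (rule continuous_on_compose2[OF y_cont]) (use \<gamma> t cont\<gamma> in \<open>auto intro!: continuous_intros\<close>)
  have comp: "((\<lambda>s. snd d' (y (t, \<gamma> s))) has_vector_derivative coord_vector A d ?q u d') (at 0)"
    if "d' \<in> charts_at A ?q" for d'
    using velocity_eq(2)[of d "\<lambda>s. y (t, \<gamma> s)" 0 ?I u d'] that d u I cont
    by (simp add: atI \<gamma>(3))
  have main: "dir_deriv (cylinder ` A) ({a..b} \<times> S) (snd d' \<circ> y) (t, p) (product_vector A p 0 ?w)
      = coord_vector A d ?q u d'" if d': "d' \<in> charts_at A ?q" for d'
    unfolding dir_deriv_def
  proof (rule the_equality)
    have uniq: "L (product_vector A p 0 ?w C) = coord_vector A d ?q u d'"
      if C: "C \<in> charts_at (cylinder ` A) (t, p)"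
        and L: "((snd d' \<circ> y \<circ> chart_inv C) has_derivative L)
          (at (snd C (t, p)) within snd C ` (({a..b} \<times> S) \<inter> fst C))" for C L
    proof -
      obtain c where c: "c \<in> charts_at A p" and C_eq: "C = cylinder c"
        using C by (auto simp: charts_at_cylinder)
      note chc = charts_atD[OF c]
      obtain v where v: "((\<lambda>s. snd c (\<gamma> s)) has_vector_derivative v) (at 0 within ?I)"
        using Ck_map_curve_has_derivative[OF \<gamma>(1) I(1), of c] c \<gamma>(3) open_chart(1) chc by blast
      have w: "?w = coord_vector A c p v"
        using velocity_eq(1)[OF _ I(1,2) cont\<gamma> v] c \<gamma>(3) by simp
      \<comment> \<open>The chart \<open>c\<close> belongs to the competing derivative; the time
        interval is cut so that the curve stays inside it.\<close>
      define I' where "I' = ?I \<inter> \<gamma> -` fst c"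
      have I': "open I'" "0 \<in> I'"
        unfolding I'_def using continuous_open_preimage[OF cont\<gamma> I(3) open_chart(1)[of c]] chc I(1) \<gamma>(3)
        by auto
      let ?h = "\<lambda>s. (t, snd c (\<gamma> s))"
      have "(?h has_derivative (\<lambda>r. (0, r *\<^sub>R v))) (at 0 within I')"
        using v I' by (intro has_derivative_Pair has_derivative_const)
          (simp add: atI has_vector_derivative_def at_within_open[of 0 I'])
      moreover have "?h ` I' \<subseteq> snd C ` (({a..b} \<times> S) \<inter> fst C)"
        using t \<gamma>(2) by (force simp: I'_def C_eq)
      then have "((snd d' \<circ> y \<circ> chart_inv C) has_derivative L) (at (?h 0) within ?h ` I')"
        using has_derivative_subset[OF L] by (simp add: C_eq \<gamma>(3))
      ultimately have "((\<lambda>s. (snd d' \<circ> y \<circ> chart_inv C) (?h s)) has_derivative (\<lambda>r. L (0, r *\<^sub>R v))) (at 0 within I')"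
        by (rule has_derivative_in_compose)
      then have "((\<lambda>s. (snd d' \<circ> y \<circ> chart_inv C) (?h s)) has_derivative (\<lambda>r. L (0, r *\<^sub>R v))) (at 0)"
        using I' by (simp add: at_within_open[of 0 I'])
      then have "((\<lambda>s. snd d' (y (t, \<gamma> s))) has_derivative (\<lambda>r. L (0, r *\<^sub>R v))) (at 0)"
        by (rule has_derivative_transform_within_open[OF _ I'])
          (use chc in \<open>auto simp: I'_def C_eq chart_inv_cylinder chart_inv_chart\<close>)
      from has_derivative_unique[OF this comp[OF d', unfolded has_vector_derivative_def]]
      have "L (0, 1 *\<^sub>R v) = 1 *\<^sub>R coord_vector A d ?q u d'"
        by metis
      then show ?thesis
        using c by (simp add: w product_vector_def C_eq)
    qed
    obtain c where c: "c \<in> charts_at A p"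
      using chart_around by blast
    have C: "cylinder c \<in> charts_at (cylinder ` A) (t, p)"
      using c by (simp add: charts_at_cylinder)
    have "\<exists>L. ((snd d' \<circ> y \<circ> chart_inv (cylinder c)) has_derivative L)
        (at (snd (cylinder c) (t, p)) within snd (cylinder c) ` (({a..b} \<times> S) \<inter> fst (cylinder c)))"
      by (rule Ck_map_has_derivative[OF y_map _ _ C])
        (use k2 t p d' charts_atD[OF c] charts_atD[OF d'] is_chart_cylinder[of c] in auto)
    then show "\<exists>C\<in>charts_at (cylinder ` A) (t, p). \<exists>L.
        ((snd d' \<circ> y \<circ> chart_inv C) has_derivative L)
          (at (snd C (t, p)) within snd C ` (({a..b} \<times> S) \<inter> fst C)) \<and>
        coord_vector A d ?q u d' = L (product_vector A p 0 ?w C)"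
      using uniq[OF C] C by metis
    show "\<And>u'. \<exists>C\<in>charts_at (cylinder ` A) (t, p). \<exists>L.
        ((snd d' \<circ> y \<circ> chart_inv C) has_derivative L)
          (at (snd C (t, p)) within snd C ` (({a..b} \<times> S) \<inter> fst C)) \<and>
        u' = L (product_vector A p 0 ?w C) \<Longrightarrow> u' = coord_vector A d ?q u d'"
      using uniq by blast
  qed
  show ?thesis
  proof
    show "differential (cylinder ` A) ({a..b} \<times> S) A y (t, p) (product_vector A p 0 ?w) d' =
      coord_vector A d ?q u d'" for d'
      using main by (cases "d' \<in> charts_at A ?q") (simp_all add: differential_def coord_vector_def)
  qed
qed

text \<open>\<open>y (0, p) = p\<close> makes the differential at time 0 the inclusion. This links
  the pairing at time 0 to the initial velocities.\<close>

lemma differential_initial: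
  assumes "p \<in> S" "w \<in> tangent_of_subset A S p"
  shows "differential (cylinder ` A) ({a..b} \<times> S) A y (0, p) (product_vector A p 0 w) = w"
proof -
  obtain \<epsilon> \<gamma> where \<epsilon>: "\<epsilon> > 0" and \<gamma>: "Ck_map 1 real_atlas {-\<epsilon><..<\<epsilon>} A \<gamma>" "\<gamma> ` {-\<epsilon><..<\<epsilon>} \<subseteq> S" "\<gamma> 0 = p"
    and w: "w = velocity A {-\<epsilon><..<\<epsilon>} \<gamma> 0"
    using assms(2) by (auto simp: tangent_of_subset_def)
  let ?I = "{-\<epsilon><..<\<epsilon>}"
  have I: "0 \<in> ?I" "at 0 within ?I \<noteq> bot" "open ?I"
    using \<epsilon> by (auto simp: at_within_open[of 0 ?I])
  have atI: "at 0 within ?I = at 0"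
    using I at_within_open[of 0 ?I] by simp
  obtain c where c: "c \<in> charts_at A p"
    using chart_around by blast
  obtain v where v: "((\<lambda>s. snd c (\<gamma> s)) has_vector_derivative v) (at 0 within ?I)"
    using Ck_map_curve_has_derivative[OF \<gamma>(1) I(1), of c] c \<gamma>(3) open_chart(1) charts_atD[OF c] by blast
  have cont\<gamma>: "continuous_on ?I \<gamma>"
    using \<gamma>(1) by (simp add: Ck_map_def)
  have w': "w = coord_vector A c p v"
    using velocity_eq(1)[OF _ I(1,2) cont\<gamma> v] c \<gamma>(3) w by simp
  have "((\<lambda>s. snd c (y (0, \<gamma> s))) has_derivative (\<lambda>r. r *\<^sub>R v)) (at 0)"
    by (rule has_derivative_transform_within_open[OF v[unfolded atI has_vector_derivative_def] I(3,1)])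
      (use \<gamma>(2) y0 in \<open>auto simp: image_subset_iff\<close>)
  then have "((\<lambda>s. snd c (y (0, \<gamma> s))) has_vector_derivative v) (at 0)"
    by (simp add: has_vector_derivative_def)
  from differential_curve[OF \<epsilon> \<gamma> _ _ this] show ?thesis
    using ab c y0[OF assms(1)] by (simp add: w[symmetric] w'[symmetric])
qed

end

section \<open>Parametrizing the hypersurface by its model hyperplane\<close>

definition hyperplane_proj :: "'e::euclidean_space \<Rightarrow> 'e \<Rightarrow> 'e" where
  "hyperplane_proj n z = z - ((n \<bullet> z) / (n \<bullet> n)) *\<^sub>R n"

lemma hyperplane_proj:
  assumes "n \<noteq> 0"
  shows "n \<bullet> hyperplane_proj n z = 0"
  using assms by (simp add: hyperplane_proj_def inner_diff_right)

lemma hyperplane_proj_id: "n \<bullet> z = 0 \<Longrightarrow> hyperplane_proj n z = z"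
  by (simp add: hyperplane_proj_def)

lemma bounded_linear_hyperplane_proj: "bounded_linear (hyperplane_proj n)"
proof -
  have "linear (hyperplane_proj n)"
    by (rule linearI)
      (simp_all add: hyperplane_proj_def inner_add_right add_divide_distrib algebra_simps)
  then show ?thesis
    by (simp add: linear_conv_bounded_linear)
qed

text \<open>Straightened coordinates around a point of the flow: \<open>F\<close> represents
  \<open>(t, z) \<mapsto> y (t, \<sigma> z)\<close> in the chart \<open>d\<close>, where \<open>\<sigma>\<close> parametrizes the hypersurface by
  points of \<open>'e\<close>, constantly along the normal \<open>n\<close> of the model hyperplane.  \<open>F\<close> is also
  defined for some \<open>t\<close> outside \<open>{a..b}\<close>, and \<open>K\<close> inverts it on the image of \<open>D\<close>.\<close>

locale flow_box = normal_flow A g S D k a b y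
  for A :: "('m::{second_countable_topology, t2_space}, 'e::euclidean_space) chart set"
    and g S D k a b y +
  fixes \<tau> :: real and p :: 'm and d :: "('m, 'e) chart"
    and W :: "(real \<times> 'e) set" and F :: "real \<times> 'e \<Rightarrow> 'e" and \<sigma> :: "'e \<Rightarrow> 'm" and z :: 'e
    and V :: "'e set" and K :: "'e \<Rightarrow> real \<times> 'e" and n :: 'e
  assumes \<tau>: "\<tau> \<in> {a..b}" and p: "p \<in> S" and d: "d \<in> charts_at A (y (\<tau>, p))"
    and n: "n \<noteq> 0"
    and W: "open W" "(\<tau>, z) \<in> W" and F: "Ck_open k W F" "F ` W \<subseteq> snd d ` fst d"
    and \<sigma>: "\<sigma> z = p"
    and box: "\<And>t x. \<lbrakk>(t, x) \<in> W; t \<in> {a..b}\<rbrakk> \<Longrightarrow>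
      \<sigma> x \<in> S \<and> y (t, \<sigma> x) \<in> fst d \<and> snd d (y (t, \<sigma> x)) = F (t, x)"
    and V: "open V" "snd d (y (\<tau>, p)) \<in> V" and K: "Ck_open k V K"
    and K_F: "\<And>t x. \<lbrakk>(t, x) \<in> W; t \<in> {a..b}; F (t, x) \<in> V\<rbrakk> \<Longrightarrow> K (F (t, x)) = (t, hyperplane_proj n x)"
    and F_K: "\<And>q. \<lbrakk>q \<in> D; q \<in> fst d; snd d q \<in> V\<rbrakk> \<Longrightarrow>
      \<exists>t x. K (snd d q) = (t, x) \<and> (t, x) \<in> W \<and> t \<in> {a..b} \<and> q = y (t, \<sigma> x)"
    and tangent_box: "\<And>w. w \<in> tangent_of_subset A S p \<Longrightarrow>
      \<exists>\<zeta>. \<forall>t\<in>{a..b}. (t, z) \<in> W \<longrightarrow>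
        differential (cylinder ` A) ({a..b} \<times> S) A y (t, p) (product_vector A p 0 w) =
          coord_vector A d (y (t, p)) (frechet_derivative F (at (t, z)) (0, \<zeta>))"
    and box_tangent: "\<And>\<zeta>. \<exists>w\<in>tangent_of_subset A S p. \<forall>t\<in>{a..b}. (t, z) \<in> W \<longrightarrow>
        differential (cylinder ` A) ({a..b} \<times> S) A y (t, p) (product_vector A p 0 w) =
          coord_vector A d (y (t, p)) (frechet_derivative F (at (t, z)) (0, \<zeta>))"

context normal_flow
begin

text \<open>\<open>y\<close> and its inverse are extended in charts and then composed with the
  change to straightened coordinates, which gives \<open>F\<close> and \<open>K\<close>. The two
  tangent clauses identify vectors tangent to \<open>S\<close> with parameter directions \<zeta>
  that do not depend on the time, so that \<open>DF (0, \<zeta>)\<close> is the variation field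
  along a whole piece of the curve.\<close>

lemma flow_box_exists:
  assumes \<tau>: "\<tau> \<in> {a..b}" and p: "p \<in> S" and d: "d \<in> charts_at A (y (\<tau>, p))"
  shows "\<exists>W F \<sigma> z V K n. flow_box A g S D k a b y \<tau> p d W F \<sigma> z V K n"
proof -
  note chd = charts_atD[OF d]
  obtain c where c: "c \<in> charts_at A p"
    using chart_around by blast
  note chc = charts_atD[OF c]
  from bspec[OF hypersurface[unfolded Ck_hypersurface_def] p] obtain c0 n where ch0: "is_chart c0"
    and co: "\<forall>d\<in>A. Ck_compatible k c0 d" and p0: "p \<in> fst c0" and n: "n \<noteq> 0"
    and S0: "snd c0 ` (S \<inter> fst c0) = {x \<in> snd c0 ` fst c0. n \<bullet> x = 0}"
    by (elim exE conjE) (rule that)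
  have k1: "k \<ge> 1" using k2 by simp
  let ?pr = "hyperplane_proj n"
  have contpr: "continuous_on UNIV ?pr"
    using bounded_linear_hyperplane_proj linear_continuous_on by blast
  have vopen: "open {x. ?pr x \<in> O'}" if "open O'" for O'
    using continuous_open_preimage[OF contpr open_UNIV that] by (simp add: vimage_def)
  let ?O = "snd c0 ` (fst c0 \<inter> fst c)"
  have O: "open ?O"
    by (rule open_chart_image[OF ch0 open_chart(1)]) (use chc in blast)
  \<comment> \<open>Projecting before testing makes \<open>N\<close> an open subset of the full
    model space; a point off the hyperplane names the same point of \<open>S\<close> as its
    projection.\<close>
  define N where "N = {x. ?pr x \<in> ?O}"
  have N: "open N"
    unfolding N_def by (rule vopen[OF O])
  define \<sigma> where "\<sigma> x = chart_inv c0 (?pr x)" for x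
  have \<sigma>: "\<sigma> x \<in> S" "\<sigma> x \<in> fst c0" "snd c0 (\<sigma> x) = ?pr x" if "?pr x \<in> snd c0 ` fst c0" for x
  proof -
    show "\<sigma> x \<in> fst c0" "snd c0 (\<sigma> x) = ?pr x"
      using chart_inv_in[OF ch0 that] chart_chart_inv[OF ch0 that] by (simp_all add: \<sigma>_def)
    have "?pr x \<in> snd c0 ` (S \<inter> fst c0)"
      using that hyperplane_proj[OF n] by (simp add: S0)
    then show "\<sigma> x \<in> S"
      using chart_inv_chart[OF ch0] by (auto simp: \<sigma>_def)
  qed
  have \<sigma>N: "\<sigma> x \<in> S" "\<sigma> x \<in> fst c0" "\<sigma> x \<in> fst c" "snd c0 (\<sigma> x) = ?pr x" if "x \<in> N" for x
  proof -
    have "?pr x \<in> snd c0 ` fst c0"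
      using that by (auto simp: N_def)
    then show "\<sigma> x \<in> S" "\<sigma> x \<in> fst c0" "snd c0 (\<sigma> x) = ?pr x"
      using \<sigma> by blast+
    show "\<sigma> x \<in> fst c"
      using that chart_inv_chart[OF ch0] by (auto simp: N_def \<sigma>_def)
  qed
  have pr_chart: "?pr (snd c0 q) = snd c0 q" if "q \<in> S" "q \<in> fst c0" for q
  proof -
    have "snd c0 q \<in> {x \<in> snd c0 ` fst c0. n \<bullet> x = 0}"
      using that unfolding S0[symmetric] by blast
    then show ?thesis
      by (simp add: hyperplane_proj_id)
  qed
  have \<sigma>_chart: "\<sigma> (snd c0 q) = q" if "q \<in> S" "q \<in> fst c0" for q
    using chart_inv_chart[OF ch0 that(2)] pr_chart[OF that] by (simp add: \<sigma>_def)
  have chartN: "snd c0 q \<in> N" if "q \<in> S" "q \<in> fst c0" "q \<in> fst c" for q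
    using that pr_chart by (auto simp: N_def)
  define z where "z = snd c0 p"
  have z: "\<sigma> z = p" "z \<in> N" "?pr z = z"
    using \<sigma>_chart pr_chart chartN p p0 chc by (auto simp: z_def)
  define s where "s x = (snd c \<circ> chart_inv c0) (?pr x)" for x
  have s_eq: "s x = snd c (\<sigma> x)" for x
    by (simp add: s_def \<sigma>_def)
  have s: "Ck_open k N s"
    unfolding s_def
    by (rule Ck_open_compose[OF N Ck_open_bounded_linear[OF bounded_linear_hyperplane_proj] O
          Ck_open_transition[OF ch0]]) (use chc co in \<open>auto simp: N_def\<close>)
  have C: "cylinder c \<in> cylinder ` A" "(\<tau>, p) \<in> fst (cylinder c)" "is_chart (cylinder c)"
    "(\<tau>, p) \<in> {a..b} \<times> S"
    using chc is_chart_cylinder[of c] \<tau> p by auto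
  have d': "d \<in> A" "y (\<tau>, p) \<in> fst d" "is_chart d"
    using chd by auto
  obtain U G where U: "open U" "snd (cylinder c) (\<tau>, p) \<in> U" "Ck_open k U G" "G ` U \<subseteq> snd d ` fst d"
    and G: "\<And>x. \<lbrakk>x \<in> {a..b} \<times> S; x \<in> fst (cylinder c); snd (cylinder c) x \<in> U\<rbrakk> \<Longrightarrow>
      y x \<in> fst d \<and> G (snd (cylinder c) x) = snd d (y x)"
    by (rule Ck_map_extension[OF y_map C(4,1,2) d'(1,2) C(3) d'(3)]) (rule that)
  \<comment> \<open>\<open>G\<close> expects coordinates in the atlas chart \<open>c\<close>, while
    points of \<open>S\<close> are named through the straightening chart \<open>c0\<close>;
    \<open>s\<close> bridges the two.\<close>
  define T where "T q = (fst q, s (snd q))" for q :: "real \<times> 'e"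
  have T: "Ck_open k (UNIV \<times> N) T"
    unfolding T_def
    by (intro Ck_open_Pair open_Times open_UNIV N Ck_open_bounded_linear bounded_linear_fst
        Ck_open_compose[OF _ _ N s]) (auto intro: bounded_linear_snd)
  define W where "W = (UNIV \<times> N) \<inter> T -` U"
  have W: "open W"
    unfolding W_def
    by (rule continuous_open_preimage[OF Ck_open_continuous_on[OF T] _ U(1)]) (intro open_Times open_UNIV N)
  define F where "F q = G (T q)" for q
  have F: "Ck_open k W F"
    unfolding F_def
    by (rule Ck_open_compose[OF W Ck_open_subset[OF T] U(1,3)]) (auto simp: W_def)
  have FW: "F ` W \<subseteq> snd d ` fst d"
    using U(4) by (auto simp: F_def W_def)
  have zW: "(\<tau>, z) \<in> W"
    using U(2) z by (simp add: W_def T_def s_eq)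
  have WN: "x \<in> N" if "(t, x) \<in> W" for t x
    using that by (simp add: W_def)
  have box: "\<sigma> x \<in> S \<and> y (t, \<sigma> x) \<in> fst d \<and> snd d (y (t, \<sigma> x)) = F (t, x)"
    if "(t, x) \<in> W" "t \<in> {a..b}" for t x
    using G[of "(t, \<sigma> x)"] \<sigma>N[OF WN[OF that(1)]] that by (auto simp: W_def F_def T_def s_eq)
  let ?yi = "inv_into ({a..b} \<times> S) y"
  let ?q = "y (\<tau>, p)"
  have yi: "?yi ?q \<in> fst (cylinder c)"
    using y_inv[OF \<tau> p] C by simp
  \<comment> \<open>The inverse of \<open>y\<close> in the same pair of charts; changing its space
    component from \<open>c\<close> to \<open>c0\<close> will give \<open>K\<close>.\<close>
  obtain V0 H where V0: "open V0" "snd d ?q \<in> V0" "Ck_open k V0 H"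
    and H: "\<And>q. \<lbrakk>q \<in> D; q \<in> fst d; snd d q \<in> V0\<rbrakk> \<Longrightarrow>
      ?yi q \<in> fst (cylinder c) \<and> H (snd d q) = snd (cylinder c) (?yi q)"
    by (rule Ck_map_extension[OF y_inv_map y_in[OF \<tau> p] d'(1,2) C(1) yi d'(3) C(3)]) (rule that)
  let ?O' = "snd c ` (fst c \<inter> fst c0)"
  have O': "open ?O'"
    by (rule open_chart_image[OF _ open_chart(1)]) (use chc ch0 in auto)
  have UO': "open (UNIV \<times> ?O' :: (real \<times> 'e) set)"
    by (intro open_Times open_UNIV O')
  define V1 where "V1 = V0 \<inter> H -` (UNIV \<times> ?O')"
  have V1: "open V1"
    unfolding V1_def by (rule continuous_open_preimage[OF Ck_open_continuous_on[OF V0(3)] V0(1) UO'])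
  have H1: "Ck_open k V1 H"
    by (rule Ck_open_subset[OF V0(3)]) (simp add: V1_def)
  define K where "K x = (fst (H x), (snd c0 \<circ> chart_inv c) (snd (H x)))" for x
  have K1: "Ck_open k V1 K"
    unfolding K_def
  proof (intro Ck_open_Pair V1 Ck_open_fst H1)
    show "Ck_open k V1 (\<lambda>x. (snd c0 \<circ> chart_inv c) (snd (H x)))"
      by (rule Ck_open_compose[OF V1 Ck_open_snd[OF V1 H1] O' Ck_open_transition])
        (use chc ch0 co Ck_compatible_sym[of k c0 c] in \<open>auto simp: V1_def\<close>)
  qed
  have K_eq: "\<exists>t q'. ?yi q = (t, q') \<and> t \<in> {a..b} \<and> q' \<in> S \<and> q = y (t, q') \<and> q' \<in> fst c \<and> q' \<in> fst c0 \<and> K (snd d q) = (t, snd c0 q')"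
    if q: "q \<in> D" "q \<in> fst d" "snd d q \<in> V1" for q
  proof -
    obtain t q' where t: "t \<in> {a..b}" "q' \<in> S" "y (t, q') = q"
      using y_surj[OF q(1)] by blast
    then have yq: "?yi q = (t, q')"
      using y_inv by blast
    have "snd d q \<in> V0"
      using q(3) by (simp add: V1_def)
    with H[OF q(1,2)] yq have q': "q' \<in> fst c" and Hq: "H (snd d q) = (t, snd c q')"
      by auto
    have "snd c q' \<in> ?O'"
      using q(3) Hq by (simp add: V1_def)
    then have "q' \<in> fst c0"
      using q' chart_image_eq[of c "fst c0"] chart_inv_chart[of c q'] chc by simp
    then show ?thesis
      using t yq q' Hq chart_inv_chart[of c q'] chc by (simp add: K_def)
  qed
  \<comment> \<open>The cut by \<open>K\<close> puts the parameters found in \<open>F_K\<close>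
    inside the domain of \<open>F\<close>.\<close>
  define V where "V = V1 \<inter> K -` W"
  have V: "open V"
    unfolding V_def by (rule continuous_open_preimage[OF Ck_open_continuous_on[OF K1] V1 W])
  have "H (snd d ?q) = (\<tau>, snd c p)"
    using H[OF y_in[OF \<tau> p] d'(2) V0(2)] y_inv[OF \<tau> p] by simp
  then have qV1: "snd d ?q \<in> V1"
    using V0(2) p0 chc by (auto simp: V1_def)
  from K_eq[OF y_in[OF \<tau> p] d'(2) this] have "K (snd d ?q) = (\<tau>, z)"
    using y_inv[OF \<tau> p] by (auto simp: z_def)
  then have qV: "snd d ?q \<in> V"
    using qV1 zW by (simp add: V_def)
  have K: "Ck_open k V K"
    by (rule Ck_open_subset[OF K1]) (simp add: V_def)
  have K_F: "K (F (t, x)) = (t, ?pr x)" if x: "(t, x) \<in> W" "t \<in> {a..b}" "F (t, x) \<in> V" for t x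
  proof -
    let ?q' = "y (t, \<sigma> x)"
    have b: "\<sigma> x \<in> S" "?q' \<in> fst d" "snd d ?q' = F (t, x)"
      using box[OF x(1,2)] by auto
    have "snd d ?q' \<in> V1"
      using x(3) b(3) by (simp add: V_def)
    from K_eq[OF y_in[OF x(2) b(1)] b(2) this] show ?thesis
      using y_inv[OF x(2) b(1)] \<sigma>N(4)[OF WN[OF x(1)]] b(3) by auto
  qed
  have F_K: "\<exists>t x. K (snd d q) = (t, x) \<and> (t, x) \<in> W \<and> t \<in> {a..b} \<and> q = y (t, \<sigma> x)"
    if q: "q \<in> D" "q \<in> fst d" "snd d q \<in> V" for q
  proof -
    have "snd d q \<in> V1" "K (snd d q) \<in> W"
      using q(3) by (simp_all add: V_def)
    with K_eq[OF q(1,2)] \<sigma>_chart show ?thesis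
      by metis
  qed
  have dF: "(F has_derivative frechet_derivative F (at q)) (at q)" if "q \<in> W" for q
    by (rule Ck_open_has_derivative'[OF F k1 that])
  \<comment> \<open>One computation for both tangent clauses: \<gamma> has to be \<sigma> of a
    parameter curve only near 0, and the direction \<zeta> of that parameter curve then serves all
    times at once.\<close>
  have curve: "differential (cylinder ` A) ({a..b} \<times> S) A y (t, p) (product_vector A p 0 (velocity A {-\<epsilon><..<\<epsilon>} \<gamma> 0)) =
      coord_vector A d (y (t, p)) (frechet_derivative F (at (t, z)) (0, \<zeta>))"
    if \<epsilon>: "\<epsilon> > 0" and \<gamma>: "Ck_map 1 real_atlas {-\<epsilon><..<\<epsilon>} A \<gamma>" "\<gamma> ` {-\<epsilon><..<\<epsilon>} \<subseteq> S" "\<gamma> 0 = p"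
      and \<kappa>: "(\<kappa> has_vector_derivative \<zeta>) (at 0)" "\<kappa> 0 = z" "\<forall>\<^sub>F r in at 0. \<gamma> r = \<sigma> (\<kappa> r)"
      and t: "t \<in> {a..b}" "(t, z) \<in> W" for \<epsilon> \<gamma> \<kappa> \<zeta> t
  proof (rule differential_curve[OF \<epsilon> \<gamma> t(1)])
    show "d \<in> charts_at A (y (t, p))"
      using box[OF t(2,1)] chd z(1) by (simp add: charts_at_def)
    have "((\<lambda>r. (t, \<kappa> r)) has_derivative (\<lambda>r. (0, r *\<^sub>R \<zeta>))) (at 0)"
      using \<kappa>(1) by (intro has_derivative_Pair has_derivative_const) (simp add: has_vector_derivative_def)
    moreover have "(F has_derivative frechet_derivative F (at (t, z))) (at (t, \<kappa> 0))"
      using dF[OF t(2)] \<kappa>(2) by simp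
    ultimately have "((\<lambda>r. F (t, \<kappa> r)) has_derivative (\<lambda>r. frechet_derivative F (at (t, z)) (0, r *\<^sub>R \<zeta>))) (at 0)"
      by (rule has_derivative_compose)
    moreover have "frechet_derivative F (at (t, z)) (0, r *\<^sub>R \<zeta>) = r *\<^sub>R frechet_derivative F (at (t, z)) (0, \<zeta>)" for r
      using linear_scale[OF has_derivative_linear[OF dF[OF t(2)]], of r "(0, \<zeta>)"] by simp
    ultimately have "((\<lambda>r. F (t, \<kappa> r)) has_vector_derivative frechet_derivative F (at (t, z)) (0, \<zeta>)) (at 0)"
      by (simp add: has_vector_derivative_def)
    then show "((\<lambda>r. snd d (y (t, \<gamma> r))) has_vector_derivative frechet_derivative F (at (t, z)) (0, \<zeta>)) (at 0)"
    proof (rule has_vector_derivative_transform_eventually)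
      have "isCont \<kappa> 0"
        using \<kappa>(1) has_vector_derivative_continuous by blast
      then have "((\<lambda>r. (t, \<kappa> r)) \<longlongrightarrow> (t, z)) (at 0)"
        using \<kappa>(2) by (auto intro!: tendsto_intros simp: isCont_def)
      then have "\<forall>\<^sub>F r in at 0. (t, \<kappa> r) \<in> W"
        using W t(2) by (rule topological_tendstoD)
      then show "\<forall>\<^sub>F r in at 0. F (t, \<kappa> r) = snd d (y (t, \<gamma> r))"
        using \<kappa>(3) by eventually_elim (use box t(1) in auto)
      show "F (t, \<kappa> 0) = snd d (y (t, \<gamma> 0))"
        using box[OF t(2,1)] by (simp add: \<kappa>(2) \<gamma>(3) z(1))
    qed simp
  qed
  \<comment> \<open>The parameter curve is \<gamma> read in \<open>c0\<close>. Its derivative is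
    obtained through the atlas chart \<open>c\<close>, where \<open>Ck_map\<close> provides
    one.\<close>
  have tangent_box: "\<exists>\<zeta>. \<forall>t\<in>{a..b}. (t, z) \<in> W \<longrightarrow>
        differential (cylinder ` A) ({a..b} \<times> S) A y (t, p) (product_vector A p 0 w) =
          coord_vector A d (y (t, p)) (frechet_derivative F (at (t, z)) (0, \<zeta>))"
    if w: "w \<in> tangent_of_subset A S p" for w
  proof -
    obtain \<epsilon> \<gamma> where \<epsilon>: "\<epsilon> > 0" and \<gamma>: "Ck_map 1 real_atlas {-\<epsilon><..<\<epsilon>} A \<gamma>" "\<gamma> ` {-\<epsilon><..<\<epsilon>} \<subseteq> S" "\<gamma> 0 = p"
      and w: "w = velocity A {-\<epsilon><..<\<epsilon>} \<gamma> 0"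
      using w by (auto simp: tangent_of_subset_def)
    let ?I = "{-\<epsilon><..<\<epsilon>}"
    have I: "0 \<in> ?I" "open ?I" using \<epsilon> by auto
    have atI: "at 0 within ?I = at 0"
      using I at_within_open[of 0 ?I] by simp
    obtain v where v: "((\<lambda>s. snd c (\<gamma> s)) has_vector_derivative v) (at 0)"
      using Ck_map_curve_has_derivative[OF \<gamma>(1) I(1), of c] c \<gamma>(3) open_chart(1) chc unfolding atI by blast
    have cont\<gamma>: "continuous_on ?I \<gamma>"
      using \<gamma>(1) by (simp add: Ck_map_def)
    have opn: "open (fst c \<inter> fst c0)"
      using open_chart(1) chc ch0 by blast
    have pc: "\<gamma> 0 \<in> fst c \<inter> fst c0"
      using \<gamma>(3) p0 chc by simp
    have ev: "\<forall>\<^sub>F r in at 0. \<gamma> r \<in> fst c \<inter> fst c0"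
      using eventually_within_preimage[OF cont\<gamma> I(1) opn pc] by (simp add: atI)
    have evS: "\<forall>\<^sub>F r in at 0. \<gamma> r \<in> S"
      using eventually_within_open[OF I(2,1), of UNIV]
      by eventually_elim (use \<gamma>(2) in auto)
    have "((snd c0 \<circ> chart_inv c) has_derivative D_transition c c0 p) (at (snd c p))"
      by (rule has_derivative_transition[OF _ _ _ k1]) (use chc ch0 co p0 Ck_compatible_sym[of k c0 c] in auto)
    then have D: "((snd c0 \<circ> chart_inv c) has_derivative D_transition c c0 p) (at (snd c (\<gamma> 0)))"
      by (simp add: \<gamma>(3))
    have "((\<lambda>r. (snd c0 \<circ> chart_inv c) (snd c (\<gamma> r))) has_derivative
        (\<lambda>r. D_transition c c0 p (r *\<^sub>R v))) (at 0)"
      by (rule has_derivative_compose[where f = "\<lambda>s. snd c (\<gamma> s)", OF v[unfolded has_vector_derivative_def] D])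
    then have "((\<lambda>r. (snd c0 \<circ> chart_inv c) (snd c (\<gamma> r))) has_vector_derivative D_transition c c0 p v) (at 0)"
      unfolding has_vector_derivative_def
      using linear_scale[OF has_derivative_linear[OF D]] by simp
    then have "((\<lambda>r. snd c0 (\<gamma> r)) has_vector_derivative D_transition c c0 p v) (at 0)"
    proof (rule has_vector_derivative_transform_eventually)
      show "\<forall>\<^sub>F r in at 0. (snd c0 \<circ> chart_inv c) (snd c (\<gamma> r)) = snd c0 (\<gamma> r)"
        using ev by eventually_elim (use chc in \<open>auto simp: chart_inv_chart\<close>)
    qed (use pc chc in \<open>auto simp: chart_inv_chart\<close>)
    moreover have "snd c0 (\<gamma> 0) = z"
      by (simp add: \<gamma>(3) z_def)
    moreover have "\<forall>\<^sub>F r in at 0. \<gamma> r = \<sigma> (snd c0 (\<gamma> r))"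
      using ev evS by eventually_elim (simp add: \<sigma>_chart)
    ultimately show ?thesis
      using curve[OF \<epsilon> \<gamma>] unfolding w by blast
  qed
  have box_tangent: "\<exists>w\<in>tangent_of_subset A S p. \<forall>t\<in>{a..b}. (t, z) \<in> W \<longrightarrow>
        differential (cylinder ` A) ({a..b} \<times> S) A y (t, p) (product_vector A p 0 w) =
          coord_vector A d (y (t, p)) (frechet_derivative F (at (t, z)) (0, \<zeta>))" for \<zeta>
  proof -
    \<comment> \<open>A straight line of parameters; \<sigma> bends it into \<open>S\<close> even if
      \<zeta> points out of the hyperplane.\<close>
    define \<kappa> where "\<kappa> r = z + r *\<^sub>R \<zeta>" for r :: real
    have \<kappa>C: "Ck_open 1 UNIV \<kappa>"
      unfolding \<kappa>_def
      by (intro Ck_open_add open_UNIV Ck_open_const Ck_open_bounded_linear bounded_linear_scaleR_left)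
    have "open (\<kappa> -` N)"
      using continuous_open_preimage[OF Ck_open_continuous_on[OF \<kappa>C] open_UNIV N] by simp
    moreover have "0 \<in> \<kappa> -` N"
      using z by (simp add: \<kappa>_def)
    ultimately obtain \<epsilon> where \<epsilon>: "\<epsilon> > 0" "ball 0 \<epsilon> \<subseteq> \<kappa> -` N"
      using openE by blast
    have \<kappa>N: "\<kappa> r \<in> N" if "r \<in> {-\<epsilon><..<\<epsilon>}" for r
      using \<epsilon>(2) that by (auto simp: subset_eq dist_real_def)
    have \<gamma>S: "(\<lambda>r. \<sigma> (\<kappa> r)) ` {-\<epsilon><..<\<epsilon>} \<subseteq> S" "\<sigma> (\<kappa> 0) = p"
      using \<kappa>N \<sigma>N z by (auto simp: \<kappa>_def)
    have s\<kappa>: "Ck_open 1 {-\<epsilon><..<\<epsilon>} (\<lambda>r. s (\<kappa> r))"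
      by (rule Ck_open_compose[OF _ Ck_open_subset[OF \<kappa>C] N Ck_open_mono[OF s k1]]) (use \<kappa>N in auto)
    have \<gamma>: "Ck_map 1 real_atlas {-\<epsilon><..<\<epsilon>} A (\<lambda>r. \<sigma> (\<kappa> r))"
    proof (rule Ck_map_curveI)
      fix r assume r: "r \<in> {-\<epsilon><..<\<epsilon>}"
      have "c \<in> charts_at A (\<sigma> (\<kappa> r))"
        using \<sigma>N(3)[OF \<kappa>N[OF r]] chc by (simp add: charts_at_def)
      moreover have "(\<lambda>r. s (\<kappa> r)) ` {-\<epsilon><..<\<epsilon>} \<subseteq> snd c ` fst c"
        using \<sigma>N(3)[OF \<kappa>N] by (auto simp: s_eq)
      moreover have "\<forall>r\<in>{-\<epsilon><..<\<epsilon>} \<inter> {-\<epsilon><..<\<epsilon>}. \<sigma> (\<kappa> r) = chart_inv c (s (\<kappa> r))"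
        using \<sigma>N(3)[OF \<kappa>N] chc by (auto simp: s_eq chart_inv_chart)
      ultimately show "\<exists>d U F. d \<in> charts_at A (\<sigma> (\<kappa> r)) \<and> open U \<and> r \<in> U \<and> Ck_open 1 U F \<and>
          F ` U \<subseteq> snd d ` fst d \<and> (\<forall>s\<in>U \<inter> {-\<epsilon><..<\<epsilon>}. \<sigma> (\<kappa> s) = chart_inv d (F s))"
        using r s\<kappa> by (intro exI[of _ c] exI[of _ "{-\<epsilon><..<\<epsilon>}"] exI[of _ "\<lambda>r. s (\<kappa> r)"]) simp
    qed
    have "(\<kappa> has_vector_derivative \<zeta>) (at 0)"
      unfolding \<kappa>_def by (auto intro!: derivative_eq_intros simp: has_vector_derivative_def)
    moreover have "\<kappa> 0 = z"
      by (simp add: \<kappa>_def)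
    moreover have "\<forall>\<^sub>F r in at 0. \<sigma> (\<kappa> r) = \<sigma> (\<kappa> r)"
      by simp
    ultimately have "\<forall>t\<in>{a..b}. (t, z) \<in> W \<longrightarrow>
        differential (cylinder ` A) ({a..b} \<times> S) A y (t, p)
          (product_vector A p 0 (velocity A {-\<epsilon><..<\<epsilon>} (\<lambda>r. \<sigma> (\<kappa> r)) 0)) =
          coord_vector A d (y (t, p)) (frechet_derivative F (at (t, z)) (0, \<zeta>))"
      using curve[OF \<epsilon>(1) \<gamma> \<gamma>S] by blast
    moreover have "velocity A {-\<epsilon><..<\<epsilon>} (\<lambda>r. \<sigma> (\<kappa> r)) 0 \<in> tangent_of_subset A S p"
      using \<epsilon>(1) \<gamma> \<gamma>S unfolding tangent_of_subset_def by blast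
    ultimately show ?thesis by blast
  qed
  have "flow_box A g S D k a b y \<tau> p d W F \<sigma> z V K n"
    by (rule flow_box.intro[OF normal_flow_axioms flow_box_axioms.intro[OF \<tau> p d n W zW F FW z(1) box V qV K K_F F_K tangent_box box_tangent]])
  then show ?thesis by blast
qed

end

text \<open>A derivative is fixed by its values on a basis, and from every point of the strip, end
  times included, arbitrarily short steps along each basis vector, in at least one sense, stay in
  the strip.\<close>

lemma strip_derivative_unique:
  fixes f :: "real \<times> 'e::euclidean_space \<Rightarrow> 'c::real_normed_vector"
  assumes ab: "a < b" and t: "t \<in> {a..b}" and U: "open U" "(t, x) \<in> U"
    and f: "(f has_derivative f') (at (t, x) within ({a..b} \<times> UNIV) \<inter> U)"
      "(f has_derivative f'') (at (t, x) within ({a..b} \<times> UNIV) \<inter> U)"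
  shows "f' = f''"
proof (rule frechet_derivative_unique_within[OF f])
  fix i :: "real \<times> 'e" and e :: real
  assume i: "i \<in> Basis" and e: "e > 0"
  obtain r where r: "r > 0" "ball (t, x) r \<subseteq> U"
    using U openE by blast
  \<comment> \<open>A quarter of the width leaves room for the step, and the same factor makes it
    strictly shorter than \<open>e\<close> and \<open>r\<close>.\<close>
  define m where "m = min (min e r) (b - a) / 4"
  have m: "m > 0" "m < e" "m < r" "4 * m \<le> b - a"
    using e r ab by (auto simp: m_def)
  \<comment> \<open>The step goes towards the farther end of the time interval.\<close>
  define c where "c = (if 2 * t \<le> a + b then m else - m)"
  have c: "\<bar>c\<bar> = m"
    using m by (simp add: c_def)
  have i01: "fst i = 0 \<or> fst i = 1"
    using i by (auto simp: Basis_prod_def)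
  have ni: "norm i = 1"
    using i by simp
  have "fst ((t, x) + c *\<^sub>R i) \<in> {a..b}"
    using i01 t m(1,4) by (auto simp: c_def)
  then have "(t, x) + c *\<^sub>R i \<in> {a..b} \<times> UNIV"
    by (simp add: mem_Times_iff)
  moreover have "dist (t, x) ((t, x) + c *\<^sub>R i) = m"
    using ni c by (simp add: dist_norm)
  then have "(t, x) + c *\<^sub>R i \<in> U"
    using r(2) m(3) by auto
  ultimately show "\<exists>c. 0 < \<bar>c\<bar> \<and> \<bar>c\<bar> < e \<and> (t, x) + c *\<^sub>R i \<in> ({a..b} \<times> UNIV) \<inter> U"
    using c m by (intro exI[of _ c]) auto
qed

lemma (in manifold) continuous_on_extension:
  assumes "\<And>q. q \<in> D \<Longrightarrow> \<exists>c U F. c \<in> charts_at A q \<and> open U \<and> snd c q \<in> U \<and> Ck_open k U F \<and>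
    (\<forall>q'\<in>D \<inter> fst c. snd c q' \<in> U \<longrightarrow> F (snd c q') = \<Psi> q')"
  shows "continuous_on D (\<Psi> :: 'm \<Rightarrow> real)"
  unfolding continuous_on_def
proof
  fix q assume q: "q \<in> D"
  from assms[OF q] obtain c U F where c: "c \<in> charts_at A q" and U: "open U" "snd c q \<in> U" "Ck_open k U F"
    and eq: "\<forall>q'\<in>D \<inter> fst c. snd c q' \<in> U \<longrightarrow> F (snd c q') = \<Psi> q'"
    by (elim exE conjE) (rule that)
  note chc = charts_atD[OF c]
  have cc: "continuous_on (fst c) (snd c)" and oc: "open (fst c)"
    using continuous_on_chart[of c] open_chart(1)[of c] chc by auto
  have "isCont (snd c) q"
    using cc oc chc continuous_on_eq_continuous_at by blast
  moreover have "isCont F (snd c q)"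
    using Ck_open_continuous_on[OF U(3)] U(1,2) continuous_on_eq_continuous_at by blast
  ultimately have "isCont (F \<circ> snd c) q"
    by (intro continuous_at_compose)
  then have "((\<lambda>q'. F (snd c q')) \<longlongrightarrow> F (snd c q)) (at q)"
    by (simp add: isCont_def comp_def)
  then have "((\<lambda>q'. F (snd c q')) \<longlongrightarrow> F (snd c q)) (at q within D)"
    by (rule tendsto_within_subset) simp
  moreover have "F (snd c q) = \<Psi> q"
    using eq q U(2) chc by auto
  moreover have "\<forall>\<^sub>F q' in at q within D. F (snd c q') = \<Psi> q'"
  proof -
    have O: "open (snd c -` U \<inter> fst c)"
      using continuous_open_preimage[OF cc oc U(1)] by (simp add: Int_commute)
    have "q \<in> snd c -` U \<inter> fst c"
      using chc U(2) by simp
    from eventually_within_open[OF O this, of D] show ?thesis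
      by eventually_elim (use eq in auto)
  qed
  ultimately show "(\<Psi> \<longlongrightarrow> \<Psi> q) (at q within D)"
    using Lim_transform_eventually by force
qed

section \<open>Velocity, inverse and surjectivity of the flow in a box\<close>

context flow_box
begin

lemma dA: "d \<in> A" "is_chart d" "y (\<tau>, p) \<in> fst d"
  using charts_atD[OF d] by auto

interpretation B: metric_family "snd d ` fst d" "metric_coeff A g d"
  by (rule metric_family[OF dA(1)])

lemma F2: "Ck_open 2 W F" and F1: "Ck_open (Suc 0) W F"
  by (rule Ck_open_mono[OF F(1)], use k2 in linarith)+

lemma dF: "q \<in> W \<Longrightarrow> (F has_derivative frechet_derivative F (at q)) (at q)"
  by (rule Ck_open_has_derivative[OF F1])

lemma F_base: "F (\<tau>, z) = snd d (y (\<tau>, p))"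
  using box[OF W(2) \<tau>] by (simp add: \<sigma>)

lemma charts_box: "(t, x) \<in> W \<Longrightarrow> t \<in> {a..b} \<Longrightarrow> d \<in> charts_at A (y (t, \<sigma> x))"
  using box dA(1) by (simp add: charts_at_def)

lemma F_in: "q \<in> W \<Longrightarrow> F q \<in> snd d ` fst d"
  using F(2) by blast

lemma g_box:
  assumes "(t, x) \<in> W" "t \<in> {a..b}"
  shows "g (y (t, \<sigma> x)) (coord_vector A d (y (t, \<sigma> x)) u) (coord_vector A d (y (t, \<sigma> x)) v) =
    metric_coeff A g d (F (t, x)) u v"
  using metric_coord_vector[OF charts_box[OF assms]] box[OF assms] by simp

text \<open>Stated for neighbouring parameters \<open>x\<close> as well, since the unit speed
  identity is differentiated across the curves.\<close>

lemma velocity_box: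
  assumes tx: "(t, x) \<in> W" and t: "t \<in> {a..b}"
  shows "velocity A {a..b} (\<lambda>t. y (t, \<sigma> x)) t =
    coord_vector A d (y (t, \<sigma> x)) (frechet_derivative F (at (t, x)) (1, 0))"
proof (rule velocity_eq(1)[OF charts_box[OF tx t] t time_limit[OF t] y_cont_time])
  show "\<sigma> x \<in> S" using box[OF tx t] by simp
  have "((\<lambda>t. (t, x)) has_derivative (\<lambda>r. (r, 0))) (at t within {a..b})"
    by (auto intro!: derivative_eq_intros)
  from has_derivative_compose[OF this dF[OF tx]]
  have "((\<lambda>t. F (t, x)) has_derivative (\<lambda>r. frechet_derivative F (at (t, x)) (r, 0))) (at t within {a..b})" .
  moreover have "(\<lambda>r. frechet_derivative F (at (t, x)) (r, 0)) = (\<lambda>r. r *\<^sub>R frechet_derivative F (at (t, x)) (1, 0))"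
  proof
    show "frechet_derivative F (at (t, x)) (r, 0) = r *\<^sub>R frechet_derivative F (at (t, x)) (1, 0)" for r
      using linear_scale[OF has_derivative_linear[OF dF[OF tx]], of r "(1, 0)"] by simp
  qed
  ultimately have "((\<lambda>t. F (t, x)) has_vector_derivative frechet_derivative F (at (t, x)) (1, 0)) (at t within {a..b})"
    unfolding has_vector_derivative_def by (rule back_subst)
  then show "((\<lambda>t. snd d (y (t, \<sigma> x))) has_vector_derivative frechet_derivative F (at (t, x)) (1, 0)) (at t within {a..b})"
  proof (rule has_vector_derivative_transform_eventually)
    have "open ((\<lambda>t. (t, x)) -` W)"
      by (rule open_vimage[OF W(1)]) (intro continuous_intros)
    from eventually_within_open[OF this, of t "{a..b}"] tx
    show "\<forall>\<^sub>F t in at t within {a..b}. F (t, x) = snd d (y (t, \<sigma> x))"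
      by (auto elim!: eventually_mono dest: box)
  qed (use box[OF tx t] t in auto)
qed

lemma time_nbhd:
  assumes "open U" "(\<tau>, z) \<in> U"
  shows "\<forall>\<^sub>F t in at \<tau> within {a..b}. t \<in> {a..b} \<and> (t, z) \<in> U"
proof -
  have "open ((\<lambda>t. (t, z)) -` U)"
    by (rule open_vimage[OF assms(1)]) (intro continuous_intros)
  from eventually_within_open[OF this, of \<tau> "{a..b}"] assms(2)
  show ?thesis
    by (auto elim!: eventually_mono)
qed

text \<open>\<open>K\<close> inverts \<open>F\<close> up to the projection on the strip only;
  uniqueness of derivatives there makes the full derivatives obey the same relation, end times
  included.\<close>

lemma DK_DF:
  shows "frechet_derivative K (at (F (\<tau>, z))) (frechet_derivative F (at (\<tau>, z)) (r, u)) = (r, hyperplane_proj n u)"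
proof -
  let ?W = "W \<inter> F -` V"
  have oW: "open ?W"
    by (rule continuous_open_preimage[OF Ck_open_continuous_on[OF F(1)] W(1) V(1)])
  have zW: "(\<tau>, z) \<in> ?W"
    using W(2) V(2) F_base by simp
  have k1: "k \<ge> 1" using k2 by simp
  have dK: "(K has_derivative frechet_derivative K (at (F (\<tau>, z)))) (at (F (\<tau>, z)))"
    by (rule Ck_open_has_derivative'[OF K k1]) (use zW in simp)
  have 1: "((\<lambda>q. K (F q)) has_derivative
      (\<lambda>h. frechet_derivative K (at (F (\<tau>, z))) (frechet_derivative F (at (\<tau>, z)) h)))
      (at (\<tau>, z) within ({a..b} \<times> UNIV) \<inter> ?W)"
    by (rule has_derivative_compose[OF has_derivative_at_withinI[OF dF[OF W(2)]] dK])
  have "((\<lambda>q. (fst q, hyperplane_proj n (snd q))) has_derivative (\<lambda>h. (fst h, hyperplane_proj n (snd h))))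
      (at (\<tau>, z) within ({a..b} \<times> UNIV) \<inter> ?W)"
    by (intro has_derivative_Pair has_derivative_fst has_derivative_snd has_derivative_ident
        bounded_linear.has_derivative[OF bounded_linear_hyperplane_proj])
  then have 2: "((\<lambda>q. K (F q)) has_derivative (\<lambda>h. (fst h, hyperplane_proj n (snd h))))
      (at (\<tau>, z) within ({a..b} \<times> UNIV) \<inter> ?W)"
    by (rule has_derivative_transform[rotated 2])
      (use \<tau> zW in \<open>auto simp: K_F\<close>)
  have "(\<lambda>h. frechet_derivative K (at (F (\<tau>, z))) (frechet_derivative F (at (\<tau>, z)) h)) =
      (\<lambda>h. (fst h, hyperplane_proj n (snd h)))"
    by (rule strip_derivative_unique[OF _ \<tau> oW zW 1 2]) (use ab in simp)
  from fun_cong[OF this, of "(r, u)"] show ?thesis by simp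
qed

lemma linear_DK: "linear (frechet_derivative K (at (F (\<tau>, z))))"
proof -
  have "k \<ge> 1" using k2 by simp
  from Ck_open_has_derivative'[OF K this, of "F (\<tau>, z)"] show ?thesis
    using V(2) F_base has_derivative_linear by auto
qed

text \<open>\<open>DK\<close> sends this vector to \<open>(1, 0)\<close>. It is the source of the
  positive speed.\<close>

lemma DF_time_nonzero: "frechet_derivative F (at (\<tau>, z)) (1, 0) \<noteq> 0"
proof
  assume "frechet_derivative F (at (\<tau>, z)) (1, 0) = 0"
  with DK_DF[of 1 0] linear_0[OF linear_DK] show False
    by (simp add: prod_eq_iff)
qed

text \<open>\<open>DF\<close> has one dimension too many in its source. Feeding the normal component
  of \<open>u\<close> into the time slot and the projection of \<open>u\<close> into the space slot
  gives an endomorphism \<Phi>, injective by \<open>DK_DF\<close> and hence onto.\<close>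

lemma DF_surj: "\<exists>\<eta>. frechet_derivative F (at (\<tau>, z)) \<eta> = u"
proof -
  define \<Phi> where "\<Phi> u = frechet_derivative F (at (\<tau>, z)) (n \<bullet> u, hyperplane_proj n u)" for u
  have lin: "linear (\<lambda>u. (n \<bullet> u, hyperplane_proj n u))"
    by (rule linearI) (simp_all add: inner_add_right
        linear_add[OF bounded_linear.linear[OF bounded_linear_hyperplane_proj]]
        linear_scale[OF bounded_linear.linear[OF bounded_linear_hyperplane_proj]])
  have "linear \<Phi>"
    using linear_compose[OF lin has_derivative_linear[OF dF[OF W(2)]]]
    unfolding \<Phi>_def[abs_def] comp_def .
  moreover have "inj \<Phi>"
  proof (subst linear_injective_0[OF \<open>linear \<Phi>\<close>], intro allI impI)
    fix u assume "\<Phi> u = 0"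
    with DK_DF[of "n \<bullet> u" "hyperplane_proj n u"] linear_0[OF linear_DK]
    have "n \<bullet> u = 0" "hyperplane_proj n (hyperplane_proj n u) = 0"
      by (auto simp: \<Phi>_def prod_eq_iff)
    then show "u = 0"
      by (simp add: hyperplane_proj_id)
  qed
  ultimately have "surj \<Phi>"
    using linear_injective_imp_surjective by blast
  from surjD[OF this, of u] obtain v where "u = \<Phi> v"
    by (elim exE) (rule that)
  then have "frechet_derivative F (at (\<tau>, z)) (n \<bullet> v, hyperplane_proj n v) = u"
    by (simp add: \<Phi>_def)
  then show ?thesis ..
qed

end

text \<open>A \<open>C\<^sup>1\<close> function \<open>\<Psi>\<close> on \<open>D\<close> together with an extension \<open>H\<close> of its
  coordinate expression.\<close>

locale flow_box_function = flow_box A g S D k a b y \<tau> p d W F \<sigma> z V K n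
  for A :: "('m::{second_countable_topology, t2_space}, 'e::euclidean_space) chart set"
    and g S D k a b y \<tau> p d W F \<sigma> z V K n +
  fixes \<Psi> :: "'m \<Rightarrow> real" and U and H
  assumes \<Psi>: "Ck_map (k - 1) A D real_atlas \<Psi>"
    and U: "open U" "snd d (y (\<tau>, p)) \<in> U" and H: "Ck_open (k - 1) U H"
    and H_eq: "\<And>q. \<lbrakk>q \<in> D; q \<in> fst d; snd d q \<in> U\<rbrakk> \<Longrightarrow> H (snd d q) = \<Psi> q"
begin

interpretation B: metric_family "snd d ` fst d" "metric_coeff A g d"
  by (rule metric_family[OF dA(1)])

abbreviation "x0 \<equiv> F (\<tau>, z)"

lemma dH: "(H has_derivative frechet_derivative H (at x0)) (at x0)"
proof -
  have "k - 1 \<ge> 1" using k2 by simp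
  from Ck_open_has_derivative'[OF H this] show ?thesis
    using U(2) F_base by simp
qed

definition W' where "W' = W \<inter> F -` U"

lemma W': "open W'" "(\<tau>, z) \<in> W'" "W' \<subseteq> W"
  using continuous_open_preimage[OF Ck_open_continuous_on[OF F(1)] W(1) U(1)] W(2) U(2) F_base
  by (auto simp: W'_def)

lemma \<Psi>_box: "(t, x) \<in> W' \<Longrightarrow> t \<in> {a..b} \<Longrightarrow> \<Psi> (y (t, \<sigma> x)) = H (F (t, x))"
  using box[of t x] H_eq[OF y_in, of t "\<sigma> x"] by (auto simp: W'_def)

lemma x0_eq: "snd d (y (\<tau>, p)) = x0" "y (\<tau>, p) \<in> D" "x0 \<in> snd d ` fst d"
  using F_base y_in[OF \<tau> p] F_in[OF W(2)] by auto

text \<open>A derivative of \<open>\<Psi>\<close> within \<open>D\<close> is unique: composed with \<open>F\<close> it is the derivative of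
  \<open>\<Psi> \<circ> y\<close> within a strip, where derivatives are unique, and \<open>D F\<close> is onto.\<close>

lemma dir_deriv_box:
  assumes w: "w \<in> tangent_space A (y (\<tau>, p))"
  shows "dir_deriv A D \<Psi> (y (\<tau>, p)) w = frechet_derivative H (at x0) (w d)"
  unfolding dir_deriv_def
proof (rule the_equality)
  let ?q = "y (\<tau>, p)"
  have "(H has_derivative frechet_derivative H (at x0)) (at x0 within snd d ` (D \<inter> fst d))"
    by (rule has_derivative_at_withinI[OF dH])
  then have "((\<Psi> \<circ> chart_inv d) has_derivative frechet_derivative H (at x0)) (at x0 within snd d ` (D \<inter> fst d))"
  proof (rule has_derivative_transform_eventually)
    have "x0 \<in> U" using U(2) by (simp add: x0_eq)
    from eventually_within_open[OF U(1) this, of "snd d ` (D \<inter> fst d)"]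
    show "\<forall>\<^sub>F x in at x0 within snd d ` (D \<inter> fst d). H x = (\<Psi> \<circ> chart_inv d) x"
      by eventually_elim (use dA H_eq in \<open>auto simp: chart_inv_chart\<close>)
    show "H x0 = (\<Psi> \<circ> chart_inv d) x0"
      using H_eq[OF x0_eq(2) dA(3) U(2)] chart_inv_chart[OF dA(2,3)] by (simp add: x0_eq(1))
    show "x0 \<in> snd d ` (D \<inter> fst d)"
      using imageI[of ?q "D \<inter> fst d" "snd d"] x0_eq dA(3) by simp
  qed
  then show "\<exists>c\<in>charts_at A ?q. \<exists>L.
      ((\<Psi> \<circ> chart_inv c) has_derivative L) (at (snd c ?q) within snd c ` (D \<inter> fst c)) \<and>
      frechet_derivative H (at x0) (w d) = L (w c)"
    by (intro bexI[OF _ d] exI[of _ "frechet_derivative H (at x0)"] conjI) (simp_all add: x0_eq(1))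
  fix u
  assume "\<exists>c\<in>charts_at A ?q. \<exists>L.
      ((\<Psi> \<circ> chart_inv c) has_derivative L) (at (snd c ?q) within snd c ` (D \<inter> fst c)) \<and> u = L (w c)"
  then obtain c L where c: "c \<in> charts_at A ?q"
    and L: "((\<Psi> \<circ> chart_inv c) has_derivative L) (at (snd c ?q) within snd c ` (D \<inter> fst c))"
    and u: "u = L (w c)"
    by blast
  note chc = charts_atD[OF c]
  let ?O = "snd d ` (fst d \<inter> fst c)"
  have O: "open ?O"
    by (rule open_chart_image[OF dA(2) open_chart(1)]) (use chc in blast)
  have Oq: "x0 \<in> ?O"
    using imageI[of ?q "fst d \<inter> fst c" "snd d"] x0_eq(1) dA(3) chc by simp
  \<comment> \<open>The competing derivative may be taken in another chart \<open>c\<close>; the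
    domain is cut so that \<open>F\<close> stays in the overlap of \<open>d\<close> and
    \<open>c\<close>.\<close>
  define W'' where "W'' = W' \<inter> F -` ?O"
  have cW': "continuous_on W' F"
    using Ck_open_continuous_on[OF F(1)] W'(3) continuous_on_subset by blast
  have W'': "open W''" "(\<tau>, z) \<in> W''"
    unfolding W''_def using continuous_open_preimage[OF cW' W'(1) O] W'(2) Oq by auto
  let ?T = "({a..b} \<times> UNIV) \<inter> W''"
  let ?h = "\<lambda>q. (snd c \<circ> chart_inv d) (F q)"
  have h: "?h (t, x) = snd c (y (t, \<sigma> x)) \<and> y (t, \<sigma> x) \<in> D \<inter> fst c" if "(t, x) \<in> W''" "t \<in> {a..b}" for t x
  proof -
    have tx: "(t, x) \<in> W" "F (t, x) \<in> ?O" using that W'(3) by (auto simp: W''_def)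
    have b: "y (t, \<sigma> x) \<in> fst d" "snd d (y (t, \<sigma> x)) = F (t, x)" "\<sigma> x \<in> S"
      using box[OF tx(1) that(2)] by auto
    have "chart_inv d (F (t, x)) = y (t, \<sigma> x)"
      using chart_inv_chart[OF dA(2) b(1)] b(2) by simp
    then show ?thesis
      using tx(2) y_in[OF that(2) b(3)] chart_image_eq[OF dA(2), of "fst c"] by auto
  qed
  have dh: "(?h has_derivative (\<lambda>v. D_transition d c ?q (frechet_derivative F (at (\<tau>, z)) v))) (at (\<tau>, z) within ?T)"
    by (rule has_derivative_compose[OF has_derivative_at_withinI[OF dF[OF W(2)]]
          D_transition[OF d c, unfolded x0_eq(1)]])
  have sub: "?h ` ?T \<subseteq> snd c ` (D \<inter> fst c)"
    using h by (auto simp del: comp_apply)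
  have "((\<Psi> \<circ> chart_inv c) has_derivative L) (at (?h (\<tau>, z)) within ?h ` ?T)"
    using has_derivative_subset[OF L sub] h[OF W''(2) \<tau>] \<sigma> by (simp del: comp_apply)
  from has_derivative_in_compose[OF dh this]
  have 1: "((\<lambda>q. (\<Psi> \<circ> chart_inv c) (?h q)) has_derivative
      (\<lambda>v. L (D_transition d c ?q (frechet_derivative F (at (\<tau>, z)) v)))) (at (\<tau>, z) within ?T)" .
  have "((\<lambda>q. H (F q)) has_derivative (\<lambda>v. frechet_derivative H (at x0) (frechet_derivative F (at (\<tau>, z)) v)))
      (at (\<tau>, z) within ?T)"
    by (rule has_derivative_compose[OF has_derivative_at_withinI[OF dF[OF W(2)]] dH])
  then have 2: "((\<lambda>q. (\<Psi> \<circ> chart_inv c) (?h q)) has_derivative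
      (\<lambda>v. frechet_derivative H (at x0) (frechet_derivative F (at (\<tau>, z)) v))) (at (\<tau>, z) within ?T)"
  proof (rule has_derivative_transform[rotated 2])
    show "(\<tau>, z) \<in> ?T" using W''(2) \<tau> by simp
    show "(\<Psi> \<circ> chart_inv c) (?h q) = H (F q)" if "q \<in> ?T" for q
    proof -
      obtain t x where q: "q = (t, x)" "(t, x) \<in> W''" "t \<in> {a..b}"
        using \<open>q \<in> ?T\<close> by (cases q) auto
      have "(t, x) \<in> W'" using q(2) by (simp add: W''_def)
      then show ?thesis
        using h[OF q(2,3)] \<Psi>_box[OF _ q(3)] chart_inv_chart[of c "y (t, \<sigma> x)"] chc q(1) by simp
    qed
  qed
  have eq: "(\<lambda>v. L (D_transition d c ?q (frechet_derivative F (at (\<tau>, z)) v))) =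
      (\<lambda>v. frechet_derivative H (at x0) (frechet_derivative F (at (\<tau>, z)) v))"
    by (rule strip_derivative_unique[OF _ \<tau> W'' 1 2]) (use ab in simp)
  obtain \<eta> where \<eta>: "frechet_derivative F (at (\<tau>, z)) \<eta> = w d"
    using DF_surj by blast
  have "w c = D_transition d c ?q (w d)"
    using coord_vector_component[OF d w] coord_vector_apply[OF c, of d "w d"] by simp
  then show "u = frechet_derivative H (at x0) (w d)"
    using fun_cong[OF eq, of \<eta>] by (simp add: u \<eta>)
qed

text \<open>The Riesz vector of \<open>DH\<close> in the chart \<open>d\<close>, carried back to the
  manifold, meets the description in \<open>gradient\<close>; uniqueness is again that of
  Riesz.\<close>

lemma gradient_box:
  "gradient A g D \<Psi> (y (\<tau>, p)) \<in> tangent_space A (y (\<tau>, p))"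
  "metric_coeff A g d x0 (gradient A g D \<Psi> (y (\<tau>, p)) d) u = frechet_derivative H (at x0) u"
proof -
  let ?q = "y (\<tau>, p)"
  have gc: "g ?q (coord_vector A d ?q v) (coord_vector A d ?q w) = metric_coeff A g d x0 v w" for v w
    using metric_coord_vector[OF d] x0_eq(1) by simp
  from B.riesz[OF x0_eq(3) has_derivative_linear[OF dH]]
  obtain G where G: "\<forall>u. metric_coeff A g d x0 G u = frechet_derivative H (at x0) u"
    and unique: "\<And>G'. \<forall>u. metric_coeff A g d x0 G' u = frechet_derivative H (at x0) u \<Longrightarrow> G' = G"
    by (elim ex1E) blast
  have "gradient A g D \<Psi> ?q = coord_vector A d ?q G"
    unfolding gradient_def
  proof (rule the_equality)
    have "g ?q (coord_vector A d ?q G) w = dir_deriv A D \<Psi> ?q w" if w: "w \<in> tangent_space A ?q" for w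
      using gc[of G "w d"] G by (simp add: dir_deriv_box[OF w] coord_vector_component[OF d w])
    then show "coord_vector A d ?q G \<in> tangent_space A ?q \<and>
        (\<forall>w\<in>tangent_space A ?q. g ?q (coord_vector A d ?q G) w = dir_deriv A D \<Psi> ?q w)"
      using d by auto
    fix v
    assume v: "v \<in> tangent_space A ?q \<and> (\<forall>w\<in>tangent_space A ?q. g ?q v w = dir_deriv A D \<Psi> ?q w)"
    have "metric_coeff A g d x0 (v d) u = frechet_derivative H (at x0) u" for u
    proof -
      have cu: "coord_vector A d ?q u \<in> tangent_space A ?q"
        using d by simp
      have "metric_coeff A g d x0 (v d) u = g ?q v (coord_vector A d ?q u)"
        using gc[of "v d" u] coord_vector_component[OF d, of v] v by simp
      also have "\<dots> = frechet_derivative H (at x0) u"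
        using v cu dir_deriv_box[OF cu] d by simp
      finally show ?thesis .
    qed
    then have "v d = G"
      using unique by blast
    then show "v = coord_vector A d ?q G"
      using coord_vector_component[OF d, of v] v by simp
  qed
  then show "gradient A g D \<Psi> ?q \<in> tangent_space A ?q"
    "metric_coeff A g d x0 (gradient A g D \<Psi> ?q d) u = frechet_derivative H (at x0) u"
    using d G by simp_all
qed

section \<open>The geodesic equation as the vanishing of a defect\<close>

abbreviation (input) "\<gamma> \<equiv> (\<lambda>t. y (t, p))"

text \<open>This is \<open>R\<close> of the overview in the single chart \<open>d\<close>. Charts
  are treated one by one, which avoids showing that \<open>cov_deriv\<close> transforms as a tangent
  vector.\<close>

definition defect :: 'e where
  "defect = cov_deriv A g {a..b} \<gamma> (\<lambda>s c. \<Psi> (\<gamma> s) *\<^sub>R velocity A {a..b} \<gamma> s c) \<tau> d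
    - (1 / 2 * g (\<gamma> \<tau>) (velocity A {a..b} \<gamma> \<tau>) (velocity A {a..b} \<gamma> \<tau>)) *\<^sub>R gradient A g D \<Psi> (\<gamma> \<tau>) d"

text \<open>All curves are required to have unit speed, because the identity is differentiated in
  directions across them. Transferring \<open>first_variation\<close> from the extension
  \<open>H\<close> back to \<Psi> leaves a derivative within the time interval.\<close>

lemma geodesic_defect:
  assumes unit: "\<And>p. p \<in> S \<Longrightarrow> unit_speed A (conformal_metric \<Psi> g) {a..b} (\<lambda>t. y (t, p))"
  shows "(\<lambda>s. \<Psi> (\<gamma> s) *\<^sub>R velocity A {a..b} \<gamma> s d) differentiable (at \<tau> within {a..b})"
    and "((\<lambda>t. \<Psi> (\<gamma> t) * metric_coeff A g d (F (t, z)) (frechet_derivative F (at (t, z)) (1, 0))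
          (frechet_derivative F (at (t, z)) \<eta>)) has_real_derivative
        metric_coeff A g d x0 defect (frechet_derivative F (at (\<tau>, z)) \<eta>)) (at \<tau> within {a..b})"
proof -
  let ?V = "\<lambda>q. frechet_derivative F (at q) (1, 0)"
  let ?q = "y (\<tau>, p)"
  have F2': "Ck_open (Suc (Suc 0)) W F"
    using F2 by (simp only: numeral_2_eq_2)
  have E1: "H (F (t, x)) * metric_coeff A g d (F (t, x)) (?V (t, x)) (?V (t, x)) = 1"
    if tx: "(t, x) \<in> W'" "t \<in> {a..b}" for t x
  proof -
    have tW: "(t, x) \<in> W" using tx(1) W'(3) by blast
    have "\<sigma> x \<in> S" using box[OF tW tx(2)] by simp
    from unit[OF this] tx(2)
    have "\<Psi> (y (t, \<sigma> x)) * g (y (t, \<sigma> x)) (velocity A {a..b} (\<lambda>t. y (t, \<sigma> x)) t)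
        (velocity A {a..b} (\<lambda>t. y (t, \<sigma> x)) t) = 1"
      unfolding unit_speed_def conformal_metric_def by blast
    then show ?thesis
      by (simp only: velocity_box[OF tW tx(2)] g_box[OF tW tx(2)] \<Psi>_box[OF tx])
  qed
  have dV: "(?V has_derivative frechet_derivative ?V (at (\<tau>, z))) (at (\<tau>, z))"
    by (rule Ck_open_has_derivative[OF Ck_open_frechet[OF F2'] W(2)])
  have dHF: "((\<lambda>q. H (F q)) has_derivative (\<lambda>v. frechet_derivative H (at x0) (frechet_derivative F (at (\<tau>, z)) v))) (at (\<tau>, z))"
    by (rule has_derivative_compose[OF dF[OF W(2)] dH])
  \<comment> \<open>The extended expression has some full derivative; its value is then read off
    from the strip, where the expression is 1.\<close>
  have "\<exists>E'. ((\<lambda>q. H (F q) * metric_coeff A g d (F q) (?V q) (?V q)) has_derivative E') (at (\<tau>, z))"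
    using has_derivative_mult[OF dHF B.has_derivative_metric[OF dF[OF W(2)] x0_eq(3) dV dV]] by blast
  then obtain E' where E': "((\<lambda>q. H (F q) * metric_coeff A g d (F q) (?V q) (?V q)) has_derivative E') (at (\<tau>, z))"
    by blast
  let ?T = "({a..b} \<times> UNIV) \<inter> W'"
  have "((\<lambda>q. 1 :: real) has_derivative (\<lambda>_. 0)) (at (\<tau>, z) within ?T)"
    by simp
  then have "((\<lambda>q. H (F q) * metric_coeff A g d (F q) (?V q) (?V q)) has_derivative (\<lambda>_. 0)) (at (\<tau>, z) within ?T)"
    by (rule has_derivative_transform[rotated 2]) (use W'(2) \<tau> E1 in auto)
  then have "E' = (\<lambda>_. 0)"
    by (rule strip_derivative_unique[OF _ \<tau> W'(1,2) has_derivative_at_withinI[OF E'], rotated]) (use ab in simp)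
  with E' have E: "((\<lambda>q. H (F q) * metric_coeff A g d (F q) (?V q) (?V q)) has_derivative (\<lambda>_. 0)) (at (\<tau>, z))"
    by simp
  note fv = B.first_variation[OF W F2 F(2) dH gradient_box(2) E]
  have ev: "\<forall>\<^sub>F t in at \<tau> within {a..b}. t \<in> {a..b} \<and> (t, z) \<in> W'"
    by (rule time_nbhd[OF W'(1,2)])
  have vel: "velocity A {a..b} \<gamma> t = coord_vector A d (\<gamma> t) (?V (t, z))" if "(t, z) \<in> W" "t \<in> {a..b}" for t
    using velocity_box[OF that] by (simp add: \<sigma>)
  have veld: "velocity A {a..b} \<gamma> t d = ?V (t, z)" if "(t, z) \<in> W" "t \<in> {a..b}" for t
    using vel[OF that] charts_box[OF that] by (simp add: \<sigma>)
  have \<Psi>z: "\<Psi> (\<gamma> t) = H (F (t, z))" if "(t, z) \<in> W'" "t \<in> {a..b}" for t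
    using \<Psi>_box[OF that] by (simp add: \<sigma>)
  let ?A = "vector_derivative (\<lambda>t. H (F (t, z)) *\<^sub>R ?V (t, z)) (at \<tau>)"
  have A: "((\<lambda>s. \<Psi> (\<gamma> s) *\<^sub>R velocity A {a..b} \<gamma> s d) has_vector_derivative ?A) (at \<tau> within {a..b})"
  proof (rule has_vector_derivative_transform_eventually[OF has_vector_derivative_at_within[OF fv(1)]])
    show "\<forall>\<^sub>F t in at \<tau> within {a..b}. H (F (t, z)) *\<^sub>R ?V (t, z) = \<Psi> (\<gamma> t) *\<^sub>R velocity A {a..b} \<gamma> t d"
      using ev by eventually_elim (use \<Psi>z veld W'(3) in auto)
    show "H (F (\<tau>, z)) *\<^sub>R ?V (\<tau>, z) = \<Psi> (\<gamma> \<tau>) *\<^sub>R velocity A {a..b} \<gamma> \<tau> d"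
      using \<Psi>z[OF W'(2) \<tau>] veld[OF W(2) \<tau>] by simp
  qed (rule \<tau>)
  then show "(\<lambda>s. \<Psi> (\<gamma> s) *\<^sub>R velocity A {a..b} \<gamma> s d) differentiable (at \<tau> within {a..b})"
    by (rule differentiableI_vector)
  have gV: "g ?q (velocity A {a..b} \<gamma> \<tau>) (velocity A {a..b} \<gamma> \<tau>) = metric_coeff A g d x0 (?V (\<tau>, z)) (?V (\<tau>, z))"
    using g_box[OF W(2) \<tau>] vel[OF W(2) \<tau>] by (simp add: \<sigma>)
  have cov: "cov_deriv A g {a..b} \<gamma> (\<lambda>s c. \<Psi> (\<gamma> s) *\<^sub>R velocity A {a..b} \<gamma> s c) \<tau> d =
      ?A + B.koszul x0 (?V (\<tau>, z)) (H x0 *\<^sub>R ?V (\<tau>, z))"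
    using d \<Psi>z[OF W'(2) \<tau>] veld[OF W(2) \<tau>]
    by (simp add: cov_deriv_def vector_derivative_within[OF time_limit[OF \<tau>] A] christoffel_eq[OF dA(1)] x0_eq(1))
  have defect: "defect = ?A + B.koszul x0 (?V (\<tau>, z)) (H x0 *\<^sub>R ?V (\<tau>, z))
      - (1 / 2 * metric_coeff A g d x0 (?V (\<tau>, z)) (?V (\<tau>, z))) *\<^sub>R gradient A g D \<Psi> ?q d"
    unfolding defect_def cov gV ..
  have "((\<lambda>t. H (F (t, z)) * metric_coeff A g d (F (t, z)) (?V (t, z)) (frechet_derivative F (at (t, z)) \<eta>))
      has_vector_derivative metric_coeff A g d x0 defect (frechet_derivative F (at (\<tau>, z)) \<eta>)) (at \<tau> within {a..b})"
    unfolding defect has_real_derivative_iff_has_vector_derivative[symmetric]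
    by (rule has_field_derivative_at_within[OF fv(2)])
  then have "((\<lambda>t. \<Psi> (\<gamma> t) * metric_coeff A g d (F (t, z)) (?V (t, z)) (frechet_derivative F (at (t, z)) \<eta>))
      has_vector_derivative metric_coeff A g d x0 defect (frechet_derivative F (at (\<tau>, z)) \<eta>)) (at \<tau> within {a..b})"
  proof (rule has_vector_derivative_transform_eventually)
    show "\<forall>\<^sub>F t in at \<tau> within {a..b}.
        H (F (t, z)) * metric_coeff A g d (F (t, z)) (?V (t, z)) (frechet_derivative F (at (t, z)) \<eta>) =
        \<Psi> (\<gamma> t) * metric_coeff A g d (F (t, z)) (?V (t, z)) (frechet_derivative F (at (t, z)) \<eta>)"
      using ev by eventually_elim (use \<Psi>z in auto)
  qed (use \<Psi>z[OF W'(2) \<tau>] \<tau> in auto)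
  then show "((\<lambda>t. \<Psi> (\<gamma> t) * metric_coeff A g d (F (t, z)) (?V (t, z)) (frechet_derivative F (at (t, z)) \<eta>))
      has_real_derivative metric_coeff A g d x0 defect (frechet_derivative F (at (\<tau>, z)) \<eta>)) (at \<tau> within {a..b})"
    by (simp add: has_real_derivative_iff_has_vector_derivative)
qed

lemma defect_zeroI:
  assumes "\<And>\<eta>. metric_coeff A g d x0 defect (frechet_derivative F (at (\<tau>, z)) \<eta>) = 0"
  shows "defect = 0"
proof (rule B.nondegenerate[OF x0_eq(3)])
  show "metric_coeff A g d x0 defect u = 0" for u
    using DF_surj[of u] assms by metis
qed

end

lemma (in manifold) Ck_map_realI:
  fixes \<Psi> :: "'m \<Rightarrow> real"
  assumes "\<And>q c. q \<in> D \<Longrightarrow> c \<in> charts_at A q \<Longrightarrow> \<exists>U F. open U \<and> snd c q \<in> U \<and> Ck_open k U F \<and>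
    (\<forall>q'\<in>D \<inter> fst c. snd c q' \<in> U \<longrightarrow> F (snd c q') = \<Psi> q')"
  shows "Ck_map k A D real_atlas \<Psi>"
proof -
  have "Ck_on k (snd c ` (D \<inter> fst c)) (\<lambda>x. \<Psi> (chart_inv c x))" if c: "c \<in> A" for c
    unfolding Ck_on_def
  proof
    fix x assume "x \<in> snd c ` (D \<inter> fst c)"
    then obtain q where q: "q \<in> D" "q \<in> fst c" "x = snd c q"
      by blast
    have "c \<in> charts_at A q"
      using c q(2) by (simp add: charts_at_def)
    from assms[OF q(1) this] obtain U F where U: "open U" "snd c q \<in> U" "Ck_open k U F"
      and eq: "\<forall>q'\<in>D \<inter> fst c. snd c q' \<in> U \<longrightarrow> F (snd c q') = \<Psi> q'"
      by (elim exE conjE) (rule that)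
    have "\<forall>z\<in>U \<inter> snd c ` (D \<inter> fst c). F z = \<Psi> (chart_inv c z)"
      using eq by (auto simp: chart_inv_chart[OF is_chart[OF c]])
    with U q(3) show "\<exists>U F. open U \<and> x \<in> U \<and> Ck_open k U F \<and>
        (\<forall>z\<in>U \<inter> snd c ` (D \<inter> fst c). F z = \<Psi> (chart_inv c z))"
      by blast
  qed
  moreover have "continuous_on D \<Psi>"
  proof (rule continuous_on_extension)
    fix q assume q: "q \<in> D"
    obtain c where c: "c \<in> charts_at A q"
      using chart_around by blast
    show "\<exists>c U F. c \<in> charts_at A q \<and> open U \<and> snd c q \<in> U \<and> Ck_open k U F \<and>
        (\<forall>q'\<in>D \<inter> fst c. snd c q' \<in> U \<longrightarrow> F (snd c q') = \<Psi> q')"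
      using assms[OF q c] c by blast
  qed
  ultimately show ?thesis
    by (simp add: Ck_map_def real_atlas_def comp_def)
qed

lemma (in flow_box) function_exists:
  assumes \<Psi>: "Ck_map (k - 1) A D real_atlas \<Psi>"
  shows "\<exists>U H. flow_box_function A g S D k a b y \<tau> p d W F \<sigma> z V K n \<Psi> U H"
proof -
  let ?e = "(UNIV :: real set, \<lambda>x :: real. x)"
  have c: "?e \<in> real_atlas" "\<Psi> (y (\<tau>, p)) \<in> fst ?e"
    by (simp_all add: real_atlas_def)
  obtain U H where U: "open U" "snd d (y (\<tau>, p)) \<in> U" "Ck_open (k - 1) U H"
    and eq: "\<And>q. \<lbrakk>q \<in> D; q \<in> fst d; snd d q \<in> U\<rbrakk> \<Longrightarrow> \<Psi> q \<in> fst ?e \<and> H (snd d q) = snd ?e (\<Psi> q)"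
    by (rule Ck_map_extension[OF \<Psi> y_in[OF \<tau> p] dA(1,3) c dA(2) is_chart_real]) (rule that)
  have "flow_box_function A g S D k a b y \<tau> p d W F \<sigma> z V K n \<Psi> U H"
  proof (intro flow_box_function.intro flow_box_axioms flow_box_function_axioms.intro \<Psi> U)
    show "H (snd d q) = \<Psi> q" if "q \<in> D" "q \<in> fst d" "snd d q \<in> U" for q
      using eq[OF that] by simp
  qed
  then show ?thesis by blast
qed

section \<open>The conformal factor and the two implications\<close>

context normal_flow
begin

text \<open>Despite the name this is the squared \<open>g\<close>-speed, so that its inverse is the
  factor demanded by unit speed.\<close>

abbreviation speed :: "real \<Rightarrow> 'm \<Rightarrow> real" where
  "speed t p \<equiv> g (y (t, p)) (velocity A {a..b} (\<lambda>t. y (t, p)) t) (velocity A {a..b} (\<lambda>t. y (t, p)) t)"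

lemma speed_pos:
  assumes \<tau>: "\<tau> \<in> {a..b}" and p: "p \<in> S"
  shows "0 < speed \<tau> p"
proof -
  obtain d where d: "d \<in> charts_at A (y (\<tau>, p))"
    using chart_around by blast
  obtain W F \<sigma> z V K n where "flow_box A g S D k a b y \<tau> p d W F \<sigma> z V K n"
    using flow_box_exists[OF \<tau> p d] by blast
  then interpret fb: flow_box A g S D k a b y \<tau> p d W F \<sigma> z V K n .
  show ?thesis
    using fb.velocity_box[OF fb.W(2) \<tau>] fb.g_box[OF fb.W(2) \<tau>] fb.DF_time_nonzero
      metric_family.pos[OF metric_family[OF fb.dA(1)] fb.F_in[OF fb.W(2)]]
    by (simp add: fb.\<sigma>)
qed

text \<open>The only candidate on \<open>D\<close>, since unit speed says that \<Psi> times
  \<open>speed\<close> is 1; its values off \<open>D\<close> carry no meaning.\<close>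

definition flow_factor :: "'m \<Rightarrow> real" where
  "flow_factor q = (case inv_into ({a..b} \<times> S) y q of (t, p) \<Rightarrow> inverse (speed t p))"

lemma flow_factor:
  assumes "t \<in> {a..b}" "p \<in> S"
  shows "flow_factor (y (t, p)) = inverse (speed t p)"
  by (simp add: flow_factor_def y_inv[OF assms])

lemma flow_factor_pos: "q \<in> D \<Longrightarrow> 0 < flow_factor q"
  by (metis y_surj flow_factor speed_pos positive_imp_inverse_positive)

text \<open>In a chart the factor is the inverse of \<open>B(v, v)\<close>, where \<open>v x\<close>
  is the time derivative of \<open>F\<close> at \<open>K x\<close>. Differentiating \<open>F\<close>
  costs one order, whence \<open>k - 1\<close>.\<close>

lemma Ck_map_flow_factor: "Ck_map (k - 1) A D real_atlas flow_factor"
proof (rule Ck_map_realI)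
  fix q d assume q: "q \<in> D" and d: "d \<in> charts_at A q"
  obtain \<tau> p where \<tau>: "\<tau> \<in> {a..b}" and p: "p \<in> S" and yq: "y (\<tau>, p) = q"
    using y_surj[OF q] by blast
  obtain W F \<sigma> z V K n where "flow_box A g S D k a b y \<tau> p d W F \<sigma> z V K n"
    using flow_box_exists[OF \<tau> p] d yq by blast
  then interpret fb: flow_box A g S D k a b y \<tau> p d W F \<sigma> z V K n .
  interpret B: metric_family "snd d ` fst d" "metric_coeff A g d"
    by (rule metric_family[OF fb.dA(1)])
  define v where "v x = frechet_derivative F (at (K x)) (1, 0)" for x
  define E where "E x = metric_coeff A g d x (v x) (v x)" for x
  have km: "Suc (k - 1) = k" "k - 1 \<le> k" using k2 by auto
  define U where "U = (V \<inter> snd d ` fst d) \<inter> K -` W"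
  have sub: "U \<subseteq> V" "U \<subseteq> snd d ` fst d" "K ` U \<subseteq> W"
    by (auto simp: U_def)
  have U: "open U"
    unfolding U_def
    by (rule continuous_open_preimage[OF continuous_on_subset[OF Ck_open_continuous_on[OF fb.K]] _ fb.W(1)])
      (use fb.V(1) B.open_X in auto)
  have KU: "Ck_open (k - 1) U K"
    by (rule Ck_open_mono[OF Ck_open_subset[OF fb.K sub(1)] km(2)])
  have "Ck_open (k - 1) W (\<lambda>q. frechet_derivative F (at q) (1, 0))"
    by (rule Ck_open_frechet) (simp only: km(1) fb.F)
  then have "Ck_open (k - 1) U v"
    unfolding v_def by (rule Ck_open_compose[OF U KU fb.W(1) _ sub(3)])
  then have EU: "Ck_open (k - 1) U E"
    unfolding E_def
    by (intro B.Ck_open_metric[OF U _ Ck_open_bounded_linear[OF bounded_linear_ident]]) (use sub(2) in auto)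
  have key: "snd d q' \<in> U \<and> E (snd d q') = inverse (flow_factor q') \<and> E (snd d q') \<noteq> 0"
    if q': "q' \<in> D" "q' \<in> fst d" "snd d q' \<in> V" for q'
  proof -
    from fb.F_K[OF q'] obtain t x where tx: "K (snd d q') = (t, x)" "(t, x) \<in> W" "t \<in> {a..b}"
      and q'_eq: "q' = y (t, \<sigma> x)"
      by (elim exE conjE) (rule that)
    have b: "\<sigma> x \<in> S" "snd d q' = F (t, x)"
      using fb.box[OF tx(2,3)] q'_eq by auto
    have Kx: "K (F (t, x)) = (t, x)"
      using tx(1) b(2) by simp
    have "E (snd d q') = speed t (\<sigma> x)"
      unfolding fb.velocity_box[OF tx(2,3)] fb.g_box[OF tx(2,3)] by (simp add: E_def v_def Kx b(2))
    then show ?thesis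
      using speed_pos[OF tx(3) b(1)] flow_factor[OF tx(3) b(1)] q' tx
      by (simp add: U_def q'_eq)
  qed
  \<comment> \<open>At points that do not come from \<open>D\<close> the extended velocity may
    vanish.\<close>
  define U' where "U' = U \<inter> E -` (- {0})"
  have U': "open U'"
    unfolding U'_def by (rule continuous_open_preimage[OF Ck_open_continuous_on[OF EU] U]) auto
  have qV: "q \<in> fst d" "snd d q \<in> V"
    using fb.V(2) fb.dA(3) by (auto simp: yq)
  show "\<exists>U F. open U \<and> snd d q \<in> U \<and> Ck_open (k - 1) U F \<and>
      (\<forall>q'\<in>D \<inter> fst d. snd d q' \<in> U \<longrightarrow> F (snd d q') = flow_factor q')"
  proof (intro exI conjI ballI impI)
    show "Ck_open (k - 1) U' (\<lambda>x. inverse (E x))"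
      by (rule Ck_open_inverse[OF U' Ck_open_subset[OF EU]]) (auto simp: U'_def)
    show "snd d q \<in> U'"
      using key[OF q qV] flow_factor_pos[OF q] by (simp add: U'_def)
    fix q' assume "q' \<in> D \<inter> fst d" "snd d q' \<in> U'"
    then show "inverse (E (snd d q')) = flow_factor q'"
      using key[of q'] sub(1) by (auto simp: U'_def)
  qed (rule U')
qed

lemma flow_factor_unit_speed:
  assumes "p \<in> S"
  shows "unit_speed A (conformal_metric flow_factor g) {a..b} (\<lambda>t. y (t, p))"
  unfolding unit_speed_def conformal_metric_def
proof
  show "flow_factor (y (t, p)) * speed t p = 1" if "t \<in> {a..b}" for t
    using flow_factor[OF that assms] speed_pos[OF that assms] by simp
qed

text \<open>\<open>Q\<close> is written without charts because the flow box changes along the curve;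
  its derivative is computed in a fresh box at each time. Positivity of \<Psi> removes the factor at
  the end.\<close>

lemma geodesic_imp_orthogonal:
  assumes \<Psi>: "Ck_map (k - 1) A D real_atlas \<Psi>" "\<And>q. q \<in> D \<Longrightarrow> 0 < \<Psi> q"
    and unit: "\<And>p. p \<in> S \<Longrightarrow> unit_speed A (conformal_metric \<Psi> g) {a..b} (\<lambda>t. y (t, p))"
    and p: "p \<in> S"
    and geo: "conformal_geodesic A g D \<Psi> {a..b} (\<lambda>t. y (t, p))"
    and initial: "velocity A {a..b} (\<lambda>t. y (t, p)) 0 \<in> orth_complement A g p (tangent_of_subset A S p)"
    and w: "w \<in> tangent_of_subset A S p" and \<tau>: "\<tau> \<in> {a..b}"
  shows "g (y (\<tau>, p)) (velocity A {a..b} (\<lambda>t. y (t, p)) \<tau>)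
    (differential (cylinder ` A) ({a..b} \<times> S) A y (\<tau>, p) (product_vector A p 0 w)) = 0"
proof -
  define Q where "Q t = \<Psi> (y (t, p)) * g (y (t, p)) (velocity A {a..b} (\<lambda>t. y (t, p)) t)
    (differential (cylinder ` A) ({a..b} \<times> S) A y (t, p) (product_vector A p 0 w))" for t
  have der: "(Q has_field_derivative 0) (at \<tau> within {a..b})" if \<tau>: "\<tau> \<in> {a..b}" for \<tau>
  proof -
    obtain d where d: "d \<in> charts_at A (y (\<tau>, p))"
      using chart_around by blast
    obtain W F \<sigma> z V K n where "flow_box A g S D k a b y \<tau> p d W F \<sigma> z V K n"
      using flow_box_exists[OF \<tau> p d] by blast
    then interpret fb0: flow_box A g S D k a b y \<tau> p d W F \<sigma> z V K n .
    obtain U H where "flow_box_function A g S D k a b y \<tau> p d W F \<sigma> z V K n \<Psi> U H"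
      using fb0.function_exists[OF \<Psi>(1)] by blast
    then interpret fb: flow_box_function A g S D k a b y \<tau> p d W F \<sigma> z V K n \<Psi> U H .
    have "cov_deriv A g {a..b} (\<lambda>t. y (t, p)) (\<lambda>s c. \<Psi> (y (s, p)) *\<^sub>R velocity A {a..b} (\<lambda>t. y (t, p)) s c) \<tau> =
        (\<lambda>c. (1 / 2 * speed \<tau> p) *\<^sub>R gradient A g D \<Psi> (y (\<tau>, p)) c)"
      using geo \<tau> unfolding conformal_geodesic_def by blast
    from fun_cong[OF this, of d] have "fb.defect = 0"
      by (simp add: fb.defect_def)
    then have zero: "metric_coeff A g d (F (\<tau>, z)) fb.defect u = 0" for u
      using metric_family.zero_left[OF metric_family[OF fb0.dA(1)] fb.x0_eq(3)] by simp
    \<comment> \<open>The same \<zeta> serves all times in the box, so the formula for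
      \<open>Q\<close> holds near \<tau> and can be differentiated.\<close>
    obtain \<zeta> where \<zeta>: "\<forall>t\<in>{a..b}. (t, z) \<in> W \<longrightarrow>
        differential (cylinder ` A) ({a..b} \<times> S) A y (t, p) (product_vector A p 0 w) =
          coord_vector A d (y (t, p)) (frechet_derivative F (at (t, z)) (0, \<zeta>))"
      using fb0.tangent_box[OF w] by blast
    have Q: "Q t = \<Psi> (y (t, p)) * metric_coeff A g d (F (t, z)) (frechet_derivative F (at (t, z)) (1, 0))
        (frechet_derivative F (at (t, z)) (0, \<zeta>))" if t: "(t, z) \<in> W" "t \<in> {a..b}" for t
      using \<zeta> t fb0.velocity_box[OF t] fb0.g_box[OF t] by (simp add: Q_def fb0.\<sigma>)
    have "((\<lambda>t. \<Psi> (y (t, p)) * metric_coeff A g d (F (t, z)) (frechet_derivative F (at (t, z)) (1, 0))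
        (frechet_derivative F (at (t, z)) (0, \<zeta>))) has_vector_derivative 0) (at \<tau> within {a..b})"
      using fb.geodesic_defect(2)[OF unit, of "(0, \<zeta>)"]
      by (simp add: zero has_real_derivative_iff_has_vector_derivative)
    then have "(Q has_vector_derivative 0) (at \<tau> within {a..b})"
    proof (rule has_vector_derivative_transform_eventually)
      show "\<forall>\<^sub>F t in at \<tau> within {a..b}. \<Psi> (y (t, p)) * metric_coeff A g d (F (t, z))
          (frechet_derivative F (at (t, z)) (1, 0)) (frechet_derivative F (at (t, z)) (0, \<zeta>)) = Q t"
        using fb0.time_nbhd[OF fb0.W] by eventually_elim (simp add: Q)
    qed (use Q[OF fb0.W(2) \<tau>] \<tau> in auto)
    then show ?thesis
      by (simp add: has_real_derivative_iff_has_vector_derivative)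
  qed
  have "\<exists>c. \<forall>t\<in>{a..b}. Q t = c"
    by (rule has_field_derivative_zero_constant[OF _ der]) simp_all
  then obtain c where c: "\<forall>t\<in>{a..b}. Q t = c" ..
  have "g p (velocity A {a..b} (\<lambda>t. y (t, p)) 0) w = 0"
    using initial w by (auto simp: orth_complement_def)
  then have "Q 0 = 0"
    using differential_initial[OF p w] y0[OF p] by (simp add: Q_def)
  then have "Q \<tau> = 0"
    using bspec[OF c \<tau>] bspec[OF c, of 0] ab by simp
  moreover have "\<Psi> (y (\<tau>, p)) \<noteq> 0"
    using \<Psi>(2)[OF y_in[OF \<tau> p]] by simp
  ultimately show ?thesis
    unfolding Q_def mult_eq_0_iff by blast
qed

text \<open>The pairing is constant in time in each coordinate direction of the box, with constant 1
  along the curves and 0 across them. Hence the defect is orthogonal to \<open>DF \<eta>\<close> for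
  every \<eta>, by linearity.\<close>

lemma orthogonal_imp_geodesic:
  assumes orth: "\<And>\<tau> p w. \<lbrakk>\<tau> \<in> {a..b}; p \<in> S; w \<in> tangent_of_subset A S p\<rbrakk> \<Longrightarrow>
    g (y (\<tau>, p)) (velocity A {a..b} (\<lambda>t. y (t, p)) \<tau>)
      (differential (cylinder ` A) ({a..b} \<times> S) A y (\<tau>, p) (product_vector A p 0 w)) = 0"
    and p: "p \<in> S"
  shows "conformal_geodesic A g D flow_factor {a..b} (\<lambda>t. y (t, p))"
proof -
  let ?\<gamma> = "\<lambda>t. y (t, p)"
  \<comment> \<open>All charts at the point are covered, because the equation compares components in
    each. Tangency of the gradient handles the remaining charts, and the last conjunct the
    regularity of the curve.\<close>
  have box: "(\<lambda>s. flow_factor (?\<gamma> s) *\<^sub>R velocity A {a..b} ?\<gamma> s d) differentiable (at \<tau> within {a..b}) \<and>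
      cov_deriv A g {a..b} ?\<gamma> (\<lambda>s c. flow_factor (?\<gamma> s) *\<^sub>R velocity A {a..b} ?\<gamma> s c) \<tau> d =
        (1 / 2 * speed \<tau> p) *\<^sub>R gradient A g D flow_factor (?\<gamma> \<tau>) d \<and>
      gradient A g D flow_factor (?\<gamma> \<tau>) \<in> tangent_space A (?\<gamma> \<tau>) \<and>
      (\<exists>U F. open U \<and> \<tau> \<in> U \<and> Ck_open 1 U F \<and> F ` U \<subseteq> snd d ` fst d \<and> (\<forall>s\<in>U \<inter> {a..b}. ?\<gamma> s = chart_inv d (F s)))"
    if \<tau>: "\<tau> \<in> {a..b}" and d: "d \<in> charts_at A (?\<gamma> \<tau>)" for \<tau> d
  proof -
    obtain W F \<sigma> z V K n where "flow_box A g S D k a b y \<tau> p d W F \<sigma> z V K n"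
      using flow_box_exists[OF \<tau> p d] by blast
    then interpret fb0: flow_box A g S D k a b y \<tau> p d W F \<sigma> z V K n .
    obtain U H where "flow_box_function A g S D k a b y \<tau> p d W F \<sigma> z V K n flow_factor U H"
      using fb0.function_exists[OF Ck_map_flow_factor] by blast
    then interpret fb: flow_box_function A g S D k a b y \<tau> p d W F \<sigma> z V K n flow_factor U H .
    let ?m = "\<lambda>\<eta> t. flow_factor (?\<gamma> t) * metric_coeff A g d (F (t, z)) (frechet_derivative F (at (t, z)) (1, 0))
        (frechet_derivative F (at (t, z)) \<eta>)"
    let ?B = "\<lambda>u. metric_coeff A g d (F (\<tau>, z)) fb.defect u"
    let ?DF = "frechet_derivative F (at (\<tau>, z))"
    note der = fb.geodesic_defect(2)[OF flow_factor_unit_speed]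
    \<comment> \<open>By \<open>geodesic_defect\<close> the derivative of the pairing is the defect
      paired with \<open>DF \<eta>\<close>, and a constant has derivative 0.\<close>
    have const: "?B (?DF \<eta>) = 0" if c: "\<And>t. (t, z) \<in> W \<Longrightarrow> t \<in> {a..b} \<Longrightarrow> ?m \<eta> t = c" for \<eta> c
    proof -
      have "((\<lambda>_. c) has_vector_derivative ?B (?DF \<eta>)) (at \<tau> within {a..b})"
      proof (rule has_vector_derivative_transform_eventually[where f = "?m \<eta>" and h = "\<lambda>_. c"])
        show "(?m \<eta> has_vector_derivative ?B (?DF \<eta>)) (at \<tau> within {a..b})"
          using der by (simp add: has_real_derivative_iff_has_vector_derivative)
        show "\<forall>\<^sub>F t in at \<tau> within {a..b}. ?m \<eta> t = c"
          using fb0.time_nbhd[OF fb0.W] by eventually_elim (use c in blast)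
      qed (rule c[OF fb0.W(2) \<tau>] \<tau>)+
      from vector_derivative_unique_within[OF time_limit[OF \<tau>] this has_vector_derivative_const]
      show ?thesis .
    qed
    have vel: "velocity A {a..b} ?\<gamma> t = coord_vector A d (?\<gamma> t) (frechet_derivative F (at (t, z)) (1, 0))"
      if "(t, z) \<in> W" "t \<in> {a..b}" for t
      using fb0.velocity_box[OF that] by (simp add: fb0.\<sigma>)
    have gb: "g (?\<gamma> t) (coord_vector A d (?\<gamma> t) u) (coord_vector A d (?\<gamma> t) v) = metric_coeff A g d (F (t, z)) u v"
      if "(t, z) \<in> W" "t \<in> {a..b}" for t u v
      using fb0.g_box[OF that] by (simp add: fb0.\<sigma>)
    have time: "?B (?DF (1, 0)) = 0"
    proof (rule const)
      fix t assume t: "(t, z) \<in> W" "t \<in> {a..b}"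
      have "?m (1, 0) t = flow_factor (?\<gamma> t) * speed t p"
        by (simp only: vel[OF t] gb[OF t])
      also have "\<dots> = 1"
        using flow_factor_unit_speed[OF p] t(2) unfolding unit_speed_def conformal_metric_def by blast
      finally show "?m (1, 0) t = 1" .
    qed
    \<comment> \<open>\<open>box_tangent\<close> realizes each \<zeta> by a vector tangent to
      \<open>S\<close>, to which the orthogonality hypothesis applies.\<close>
    have space: "?B (?DF (0, \<zeta>)) = 0" for \<zeta>
    proof (rule const)
      obtain w where w: "w \<in> tangent_of_subset A S p" and dw: "\<forall>t\<in>{a..b}. (t, z) \<in> W \<longrightarrow>
          differential (cylinder ` A) ({a..b} \<times> S) A y (t, p) (product_vector A p 0 w) =
            coord_vector A d (y (t, p)) (frechet_derivative F (at (t, z)) (0, \<zeta>))"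
        using fb0.box_tangent[of \<zeta>] by blast
      fix t assume t: "(t, z) \<in> W" "t \<in> {a..b}"
      have "metric_coeff A g d (F (t, z)) (frechet_derivative F (at (t, z)) (1, 0))
          (frechet_derivative F (at (t, z)) (0, \<zeta>)) = 0"
        using orth[OF t(2) p w] dw t by (simp add: vel[OF t] gb[OF t])
      then show "?m (0, \<zeta>) t = 0"
        by simp
    qed
    have "fb.defect = 0"
    proof (rule fb.defect_zeroI)
      fix \<eta> :: "real \<times> 'e"
      note lin = has_derivative_linear[OF fb0.dF[OF fb0.W(2)]]
      note linB = metric_family.linear_right[OF metric_family[OF fb0.dA(1)] fb.x0_eq(3), of fb.defect]
      have "\<eta> = fst \<eta> *\<^sub>R (1, 0) + (0, snd \<eta>)"
        by (simp add: prod_eq_iff)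
      then have "?DF \<eta> = fst \<eta> *\<^sub>R ?DF (1, 0) + ?DF (0, snd \<eta>)"
        using linear_add[OF lin] linear_scale[OF lin] by metis
      then show "?B (?DF \<eta>) = 0"
        using time space by (simp add: linear_add[OF linB] linear_scale[OF linB])
    qed
    then have "cov_deriv A g {a..b} ?\<gamma> (\<lambda>s c. flow_factor (?\<gamma> s) *\<^sub>R velocity A {a..b} ?\<gamma> s c) \<tau> d =
        (1 / 2 * speed \<tau> p) *\<^sub>R gradient A g D flow_factor (?\<gamma> \<tau>) d"
      by (simp add: fb.defect_def)
    moreover have "\<exists>U F. open U \<and> \<tau> \<in> U \<and> Ck_open 1 U F \<and> F ` U \<subseteq> snd d ` fst d \<and>
        (\<forall>s\<in>U \<inter> {a..b}. ?\<gamma> s = chart_inv d (F s))"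
    proof (intro exI conjI ballI)
      let ?U = "(\<lambda>t. (t, z)) -` W"
      show oU: "open ?U"
        by (rule open_vimage[OF fb0.W(1)]) (intro continuous_intros)
      show "\<tau> \<in> ?U" using fb0.W(2) by simp
      have "Ck_open 1 W F"
        using fb0.F1 by (simp only: One_nat_def)
      then show "Ck_open 1 ?U (\<lambda>t. F (t, z))"
        by (rule Ck_open_compose[OF oU Ck_open_Pair[OF oU Ck_open_bounded_linear[OF bounded_linear_ident] Ck_open_const] fb0.W(1)])
          auto
      show "(\<lambda>t. F (t, z)) ` ?U \<subseteq> snd d ` fst d"
        using fb0.F(2) by auto
      fix s assume "s \<in> ?U \<inter> {a..b}"
      then show "?\<gamma> s = chart_inv d (F (s, z))"
        using fb0.box[of s z] chart_inv_chart[OF fb0.dA(2), of "?\<gamma> s"] by (simp add: fb0.\<sigma>)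
    qed
    ultimately show ?thesis
      using fb.geodesic_defect(1)[OF flow_factor_unit_speed] fb.gradient_box(1) by blast
  qed
  have "Ck_map 1 real_atlas {a..b} A ?\<gamma>"
  proof (rule Ck_map_curveI)
    fix \<tau> assume \<tau>: "\<tau> \<in> {a..b}"
    obtain d where d: "d \<in> charts_at A (?\<gamma> \<tau>)"
      using chart_around by blast
    show "\<exists>d U F. d \<in> charts_at A (?\<gamma> \<tau>) \<and> open U \<and> \<tau> \<in> U \<and> Ck_open 1 U F \<and>
        F ` U \<subseteq> snd d ` fst d \<and> (\<forall>s\<in>U \<inter> {a..b}. ?\<gamma> s = chart_inv d (F s))"
      using box[OF \<tau> d] d by blast
  qed
  moreover have "cov_deriv A g {a..b} ?\<gamma> (\<lambda>s c. flow_factor (?\<gamma> s) *\<^sub>R velocity A {a..b} ?\<gamma> s c) \<tau> =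
      (\<lambda>c. (1 / 2 * speed \<tau> p) *\<^sub>R gradient A g D flow_factor (?\<gamma> \<tau>) c)" if \<tau>: "\<tau> \<in> {a..b}" for \<tau>
  proof
    fix d
    show "cov_deriv A g {a..b} ?\<gamma> (\<lambda>s c. flow_factor (?\<gamma> s) *\<^sub>R velocity A {a..b} ?\<gamma> s c) \<tau> d =
      (1 / 2 * speed \<tau> p) *\<^sub>R gradient A g D flow_factor (?\<gamma> \<tau>) d"
    proof (cases "d \<in> charts_at A (?\<gamma> \<tau>)")
      case True
      then show ?thesis using box[OF \<tau>] by blast
    next
      case False
      obtain c where "c \<in> charts_at A (?\<gamma> \<tau>)"
        using chart_around by blast
      then have "gradient A g D flow_factor (?\<gamma> \<tau>) \<in> tangent_space A (?\<gamma> \<tau>)"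
        using box[OF \<tau>] by blast
      then have "gradient A g D flow_factor (?\<gamma> \<tau>) d = 0"
        using False unfolding tangent_space_def by blast
      then show ?thesis
        using False by (simp add: cov_deriv_def)
    qed
  qed
  moreover have "?\<gamma> ` {a..b} \<subseteq> D"
    using y_in p by blast
  ultimately show ?thesis
    unfolding conformal_geodesic_def using box by blast
qed

end

text \<open>Existence is witnessed by \<open>flow_factor\<close>. The formula is unit speed solved
  for \<Psi>, so it is asserted of every admissible factor, which makes the factor unique on
  \<open>D\<close>.\<close>

theorem proposition2p1:
  fixes A :: "('m::{second_countable_topology, t2_space}, 'e::euclidean_space) chart set"
    and g :: "('m, 'e) metric"
    and S D :: "'m set"
    and k :: nat
    and a b :: real
    and y :: "real \<times> 'm \<Rightarrow> 'm"
  assumes "smooth_atlas A"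
    and "riemannian_metric A g"
    and "Ck_hypersurface k A S"
    and "k \<ge> 2"
    and "a < 0" and "0 < b"
    and "Ck_diffeomorphism k (cylinder ` A) ({a..b} \<times> S) A D y"
    and "\<And>p. p \<in> S \<Longrightarrow> y (0, p) = p"
    and "\<And>p. p \<in> S \<Longrightarrow>
      velocity A {a..b} (\<lambda>t. y (t, p)) 0 \<in> orth_complement A g p (tangent_of_subset A S p)"
  shows "((\<exists>\<Psi> :: 'm \<Rightarrow> real.
            (\<forall>q\<in>D. 0 < \<Psi> q) \<and> Ck_map (k - 1) A D real_atlas \<Psi> \<and>
            (\<forall>p\<in>S. unit_speed A (conformal_metric \<Psi> g) {a..b} (\<lambda>t. y (t, p)) \<and>
                    conformal_geodesic A g D \<Psi> {a..b} (\<lambda>t. y (t, p))))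
          \<longleftrightarrow>
          (\<forall>\<tau>\<in>{a..b}. \<forall>p\<in>S. \<forall>w\<in>tangent_of_subset A S p.
            g (y (\<tau>, p)) (velocity A {a..b} (\<lambda>t. y (t, p)) \<tau>)
              (differential (cylinder ` A) ({a..b} \<times> S) A y (\<tau>, p) (product_vector A p 0 w)) = 0))
         \<and>
         (\<forall>\<Psi> :: 'm \<Rightarrow> real.
            (\<forall>q\<in>D. 0 < \<Psi> q) \<and> Ck_map (k - 1) A D real_atlas \<Psi> \<and>
            (\<forall>p\<in>S. unit_speed A (conformal_metric \<Psi> g) {a..b} (\<lambda>t. y (t, p)) \<and>
                    conformal_geodesic A g D \<Psi> {a..b} (\<lambda>t. y (t, p)))
          \<longrightarrow>
          (\<forall>\<tau>\<in>{a..b}. \<forall>p\<in>S. \<Psi> (y (\<tau>, p)) =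
            inverse (g (y (\<tau>, p)) (velocity A {a..b} (\<lambda>t. y (t, p)) \<tau>)
                                   (velocity A {a..b} (\<lambda>t. y (t, p)) \<tau>))))"
proof -
  interpret normal_flow A g S D k a b y
    by (intro normal_flow.intro riemannian.intro manifold.intro riemannian_axioms.intro
        normal_flow_axioms.intro assms)
  let ?geo = "\<lambda>\<Psi>. (\<forall>q\<in>D. 0 < \<Psi> q) \<and> Ck_map (k - 1) A D real_atlas \<Psi> \<and>
    (\<forall>p\<in>S. unit_speed A (conformal_metric \<Psi> g) {a..b} (\<lambda>t. y (t, p)) \<and>
            conformal_geodesic A g D \<Psi> {a..b} (\<lambda>t. y (t, p)))"
  let ?orth = "\<forall>\<tau>\<in>{a..b}. \<forall>p\<in>S. \<forall>w\<in>tangent_of_subset A S p.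
    g (y (\<tau>, p)) (velocity A {a..b} (\<lambda>t. y (t, p)) \<tau>)
      (differential (cylinder ` A) ({a..b} \<times> S) A y (\<tau>, p) (product_vector A p 0 w)) = 0"
  show ?thesis
  proof (intro conjI iffI allI impI)
    assume "\<exists>\<Psi>. ?geo \<Psi>"
    then obtain \<Psi> where "?geo \<Psi>" ..
    then show ?orth
      using geodesic_imp_orthogonal[of \<Psi>] assms(9) by blast
  next
    assume orth: ?orth
    have "conformal_geodesic A g D flow_factor {a..b} (\<lambda>t. y (t, p))" if "p \<in> S" for p
      by (rule orthogonal_imp_geodesic[OF _ that]) (use orth in blast)
    then have fac: "?geo flow_factor"
      using flow_factor_pos Ck_map_flow_factor flow_factor_unit_speed by blast
    show "\<exists>\<Psi>. ?geo \<Psi>"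
      by (rule exI[where x = flow_factor], rule fac)
  next
    fix \<Psi> :: "'m \<Rightarrow> real"
    assume geo: "?geo \<Psi>"
    have "\<Psi> (y (\<tau>, p)) = inverse (speed \<tau> p)" if "\<tau> \<in> {a..b}" "p \<in> S" for \<tau> p
    proof -
      have "\<Psi> (y (\<tau>, p)) * speed \<tau> p = 1"
        using geo that unfolding unit_speed_def conformal_metric_def by blast
      then show ?thesis
        by (metis inverse_unique mult.commute)
    qed
    then show "\<forall>\<tau>\<in>{a..b}. \<forall>p\<in>S. \<Psi> (y (\<tau>, p)) = inverse (speed \<tau> p)"
      by blast
  qed
qed

end
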